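(* Let $k$ be a field, $A=k[x_1,\dots,x_n]$ ($n\ge1$), and let $M_0,M_1,\dots,M_s$ be a sequence of non-empty finite sets of monomials of $A$ such that $M_0=\{x_1,\dots,x_n\}$ and each $M_i$ consists of monomials of the same degree $d_i$, $i=0,1,\dots,s$. Let $\mathfrak m$ be the maximal graded ideal of $A$ and $J_i$ the ideal generated by the monomials of $M_i$. Let $R=R(\mathfrak m|J_1,\dots,J_s)$ and let $\mathbf Q$ be the sequence of polytopes $Q_{M_0},Q_{M_1},\dots,Q_{M_s}$. Then $\deg P_R(u)=n-1$, and for any $\alpha\in\mathbb N^{s+1}$ with $|\alpha|=n-1$, $$e_\alpha(\mathfrak m|J_1,\dots,J_s)=\frac{MV_{n-1}(\mathbf Q_\alpha)}{\sqrt n}.$$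
   Context: For a finite set $M$ of monomials of $A$, $Q_M\subset\mathbb R^n$ is the convex hull of the exponent vectors of the monomials in $M$. For $\alpha=(\alpha_0,\dots,\alpha_s)\in\mathbb N^{s+1}$, $\mathbf Q_\alpha$ is the multiset consisting of $\alpha_0$ copies of $Q_{M_0}$, ..., $\alpha_s$ copies of $Q_{M_s}$; $|\alpha|=\alpha_0+\cdots+\alpha_s$, $\alpha!=\alpha_0!\cdots\alpha_s!$, $u^\alpha=u_0^{\alpha_0}\cdots u_s^{\alpha_s}$. Mixed volume: for convex polytopes $Q_1,\dots,Q_r$ in $\mathbb R^n$ with $\dim(Q_1+\cdots+Q_r)\le r$, $$MV_r(Q_1,\dots,Q_r):=\sum_{h=1}^r\ \sum_{1\le i_1<\cdots<i_h\le r}(-1)^{r-h}V_r(Q_{i_1}+\cdots+Q_{i_h}),$$ where $+$ is Minkowski sum and $V_r$ is the $r$-dimensional Euclidean volume (zero for polytopes of dimension $<r$); by convention $MV_0(\emptyset)=1$. Mixed multiplicities: $R(\mathfrak m|J_1,\dots,J_s):=\bigoplus_{u\in\mathbb N^{s+1}}\mathfrak m^{u_0}J_1^{u_1}\cdots J_s^{u_s}/\mathfrak m^{u_0+1}J_1^{u_1}\cdots J_s^{u_s}$. $P_R(u)$ is the polynomial with $\ell(R_u)=P_R(u)$ whenever all $u_i$ are sufficiently large. With $r=\deg P_R$, write $P_R(u)=\sum_{|\alpha|=r}\frac1{\alpha!}e_\alpha u^\alpha+\{\text{terms of degree}<r\}$ and set $e_\alpha(\mathfrak m|J_1,\dots,J_s):=e_\alpha$.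 *)

theory Defs
  imports "HOL-Analysis.Analysis" "HOL-Library.Poly_Mapping" "HOL-Library.Set_Algebras"
begin

section \<open>Polynomial rings and ideals\<close>

text \<open>
  A finitely supported map \<open>a :: 'x \<Rightarrow>\<^sub>0 nat\<close> encodes the monomial
  \<open>\<Prod>x. x ^ a x\<close>; sets of monomials are represented by sets of such exponent maps.
  With the convolution product, \<open>('x, 'k) mpoly\<close> is the polynomial ring over \<open>'k\<close>
  in the variables \<open>'x\<close>.
\<close>

type_synonym ('x, 'k) mpoly = "('x \<Rightarrow>\<^sub>0 nat) \<Rightarrow>\<^sub>0 'k"

definition monomial :: "('x \<Rightarrow>\<^sub>0 nat) \<Rightarrow> ('x, 'k::comm_ring_1) mpoly" where
  "monomial a = Poly_Mapping.single a 1"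

definition variables :: "('x \<Rightarrow>\<^sub>0 nat) set" where
  "variables = range (\<lambda>x. Poly_Mapping.single x 1)"

definition monomial_degree :: "('x::finite \<Rightarrow>\<^sub>0 nat) \<Rightarrow> nat" where
  "monomial_degree a = (\<Sum>x\<in>UNIV. Poly_Mapping.lookup a x)"

definition ideal_gen :: "'a::comm_ring_1 set \<Rightarrow> 'a set" where
  "ideal_gen S = module.span (*) S"

definition monomial_ideal :: "('x \<Rightarrow>\<^sub>0 nat) set \<Rightarrow> ('x, 'k::comm_ring_1) mpoly set" where
  "monomial_ideal M = ideal_gen (monomial ` M)"

definition maximal_graded_ideal :: "('x, 'k::comm_ring_1) mpoly set" where
  "maximal_graded_ideal = monomial_ideal variables"


section \<open>Quotients of ideals and their length\<close>

text \<open>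
  For ideals \<open>N \<subseteq> I\<close> of a ring, \<open>ideal_quotient I N\<close> is the set of cosets \<open>x + N\<close> with
  \<open>x \<in> I\<close>.  Addition of cosets is addition of sets, the zero coset is \<open>N\<close>, and
  \<open>r *o X + N\<close> is the coset \<open>r \<cdot> X\<close>.
\<close>

definition ideal_quotient :: "'a::comm_ring_1 set \<Rightarrow> 'a set \<Rightarrow> 'a set set" where
  "ideal_quotient I N = (\<lambda>x. x +o N) ` I"

definition quotient_submodule :: "'a::comm_ring_1 set \<Rightarrow> 'a set \<Rightarrow> 'a set set \<Rightarrow> bool" where
  "quotient_submodule I N S \<longleftrightarrow>
     S \<subseteq> ideal_quotient I N \<and> N \<in> S \<and> (\<forall>X\<in>S. \<forall>Y\<in>S. X + Y \<in> S) \<and> (\<forall>r. \<forall>X\<in>S. r *o X + N \<in> S)"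

text \<open>The length of the module \<open>I / N\<close>: the supremum of the lengths of chains of submodules.\<close>

definition quotient_length :: "'a::comm_ring_1 set \<Rightarrow> 'a set \<Rightarrow> enat" where
  "quotient_length I N =
     Sup {enat l | l. \<exists>C. (\<forall>i\<le>l. quotient_submodule I N (C i)) \<and> (\<forall>i<l. C i \<subset> C (Suc i))}"


section \<open>The multigraded algebra \<open>R(m|J\<^sub>1,\<dots>,J\<^sub>s)\<close>\<close>

text \<open>
  \<open>m ^ a * (\<Prod>i=1..s. J i ^ u i)\<close> below is the set of all elementwise products of one element
  from each factor (operations on sets), with empty product \<open>{1}\<close>; the ideal it generates is the
  product of ideals \<open>m\<^sup>a J\<^sub>1\<^bsup>u 1\<^esup> \<dots> J\<^sub>s\<^bsup>u s\<^esup>\<close>.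
\<close>

definition power_product ::
    "'a::comm_ring_1 set \<Rightarrow> (nat \<Rightarrow> 'a set) \<Rightarrow> nat \<Rightarrow> nat \<Rightarrow> (nat \<Rightarrow> nat) \<Rightarrow> 'a set" where
  "power_product m J s a u = ideal_gen (m ^ a * (\<Prod>i=1..s. J i ^ u i))"

text \<open>
  The Hilbert function \<open>u \<mapsto> \<ell>(R\<^sub>u)\<close> of \<open>R = R(m|J\<^sub>1,\<dots>,J\<^sub>s)\<close>, where
  \<open>R\<^sub>u = m\<^bsup>u 0\<^esup> J\<^sub>1\<^bsup>u 1\<^esup> \<dots> J\<^sub>s\<^bsup>u s\<^esup> / m\<^bsup>u 0 + 1\<^esup> J\<^sub>1\<^bsup>u 1\<^esup> \<dots> J\<^sub>s\<^bsup>u s\<^esup>\<close>.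
  As \<open>R\<^sub>u\<close> is annihilated by \<open>m\<close>, its submodules over \<open>A\<close> and over \<open>R\<^sub>0 = A/m\<close>
  are the same.
\<close>

definition hilbert_function ::
    "'a::comm_ring_1 set \<Rightarrow> (nat \<Rightarrow> 'a set) \<Rightarrow> nat \<Rightarrow> (nat \<Rightarrow> nat) \<Rightarrow> enat" where
  "hilbert_function m J s u =
     quotient_length (power_product m J s (u 0) u) (power_product m J s (u 0 + 1) u)"


section \<open>Hilbert polynomials and mixed multiplicities\<close>

definition eval_poly :: "(nat, real) mpoly \<Rightarrow> (nat \<Rightarrow> nat) \<Rightarrow> real" where
  "eval_poly P u =
     (\<Sum>\<beta>\<in>Poly_Mapping.keys P. Poly_Mapping.lookup P \<beta> *
        (\<Prod>i\<in>Poly_Mapping.keys \<beta>. real (u i) ^ Poly_Mapping.lookup \<beta> i))"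

definition is_hilbert_polynomial ::
    "nat \<Rightarrow> ((nat \<Rightarrow> nat) \<Rightarrow> enat) \<Rightarrow> (nat, real) mpoly \<Rightarrow> bool" where
  "is_hilbert_polynomial s H P \<longleftrightarrow>
     (\<forall>\<beta>\<in>Poly_Mapping.keys P. Poly_Mapping.keys \<beta> \<subseteq> {..s}) \<and>
     (\<exists>N. \<forall>u. (\<forall>i\<le>s. N \<le> u i) \<longrightarrow> ereal_of_enat (H u) = ereal (eval_poly P u))"

definition hilbert_polynomial :: "nat \<Rightarrow> ((nat \<Rightarrow> nat) \<Rightarrow> enat) \<Rightarrow> (nat, real) mpoly" where
  "hilbert_polynomial s H = (THE P. is_hilbert_polynomial s H P)"

text \<open>The sum of the entries of an exponent in \<open>s + 1\<close> variables.\<close>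

definition weight :: "nat \<Rightarrow> (nat \<Rightarrow>\<^sub>0 nat) \<Rightarrow> nat" where
  "weight s \<alpha> = (\<Sum>i\<le>s. Poly_Mapping.lookup \<alpha> i)"

text \<open>Total degree in \<open>s + 1\<close> variables; the zero polynomial has degree \<open>-1\<close>.\<close>

definition total_degree :: "nat \<Rightarrow> (nat, real) mpoly \<Rightarrow> int" where
  "total_degree s P = (if P = 0 then -1 else int (Max (weight s ` Poly_Mapping.keys P)))"

text \<open>
  \<open>e\<^sub>\<alpha>\<close> for \<open>|\<alpha>| = deg P\<close>: the coefficient of \<open>u\<^sup>\<alpha>\<close> in \<open>P\<close> is \<open>e\<^sub>\<alpha> / \<alpha>!\<close>.
\<close>

definition mixed_multiplicity ::
    "'a::comm_ring_1 set \<Rightarrow> (nat \<Rightarrow> 'a set) \<Rightarrow> nat \<Rightarrow> (nat \<Rightarrow>\<^sub>0 nat) \<Rightarrow> real" where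
  "mixed_multiplicity m J s \<alpha> =
     (\<Prod>i\<le>s. fact (Poly_Mapping.lookup \<alpha> i)) *
     Poly_Mapping.lookup (hilbert_polynomial s (hilbert_function m J s)) \<alpha>"


section \<open>Mixed volumes\<close>

text \<open>
  \<open>r\<close>-dimensional Euclidean volume of a polytope of dimension at most \<open>r\<close> in a Euclidean space:
  if the dimension is \<open>r\<close>, it is the Lebesgue measure on \<open>\<real>\<^sup>r\<close> (realised as the product of \<open>r\<close>
  copies of \<open>lborel\<close>) of the set of coordinate vectors with respect to an orthonormal frame
  of the affine hull.  It does not depend on the chosen frame.  The definition carries no meaning
  for sets of dimension greater than \<open>r\<close>.
\<close>

definition orthonormal_frame :: "nat \<Rightarrow> (nat \<Rightarrow> 'e::euclidean_space) \<Rightarrow> bool" where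
  "orthonormal_frame r b \<longleftrightarrow> (\<forall>i<r. \<forall>j<r. b i \<bullet> b j = (if i = j then 1 else 0))"

definition frame_point :: "nat \<Rightarrow> 'e::euclidean_space \<Rightarrow> (nat \<Rightarrow> 'e) \<Rightarrow> (nat \<Rightarrow> real) \<Rightarrow> 'e" where
  "frame_point r p b y = p + (\<Sum>i<r. y i *\<^sub>R b i)"

definition volume :: "nat \<Rightarrow> 'e::euclidean_space set \<Rightarrow> real" where
  "volume r S =
     (if aff_dim S < int r then 0
      else let (p, b) = (SOME (p, b). orthonormal_frame r b \<and> S \<subseteq> range (frame_point r p b))
           in measure (\<Pi>\<^sub>M i\<in>{..<r}. lborel)
                {y \<in> extensional {..<r}. frame_point r p b y \<in> S})"

text \<open>
  The mixed volume \<open>MV\<^sub>r\<close> of a list of \<open>r\<close> polytopes (with \<open>dim (Q\<^sub>1 + \<dots> + Q\<^sub>r) \<le> r\<close>);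
  the sums \<open>\<Sum>i\<in>I. Qs ! i\<close> are Minkowski sums.
\<close>

definition mixed_volume :: "'e::euclidean_space set list \<Rightarrow> real" where
  "mixed_volume Qs =
     (let r = length Qs in
      if r = 0 then 1
      else (\<Sum>h=1..r. \<Sum>I | I \<subseteq> {..<r} \<and> card I = h.
              (-1) ^ (r - h) * volume r (\<Sum>i\<in>I. Qs ! i)))"

definition exponent_vector :: "('n::finite \<Rightarrow>\<^sub>0 nat) \<Rightarrow> real ^ 'n" where
  "exponent_vector a = (\<chi> j. real (Poly_Mapping.lookup a j))"

definition newton_polytope :: "('n::finite \<Rightarrow>\<^sub>0 nat) set \<Rightarrow> (real ^ 'n) set" where
  "newton_polytope M = convex hull (exponent_vector ` M)"

text \<open>
  The multiset consisting of \<open>\<alpha> i\<close> copies of \<open>Q i\<close> for each \<open>i \<le> s\<close>, listed in the order of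
  the \<open>Q i\<close>; mixed volumes do not depend on the order.
\<close>

definition repeated :: "nat \<Rightarrow> (nat \<Rightarrow>\<^sub>0 nat) \<Rightarrow> (nat \<Rightarrow> 'b) \<Rightarrow> 'b list" where
  "repeated s \<alpha> Q = concat (map (\<lambda>i. replicate (Poly_Mapping.lookup \<alpha> i) (Q i)) [0..<Suc s])"

end

theory Submission
  imports Defs
begin

text \<open>
  All monomials generating \<open>m\<^bsup>u 0\<^esup> J\<^sub>1\<^bsup>u 1\<^esup> \<dots> J\<^sub>s\<^bsup>u s\<^esup>\<close> have the same degree, so the length of its
  quotient by \<open>m\<^bsup>u 0 + 1\<^esup> J\<^sub>1\<^bsup>u 1\<^esup> \<dots> J\<^sub>s\<^bsup>u s\<^esup>\<close> is the cardinality of the sumset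
  \<open>u\<^sub>0 M\<^sub>0 + \<dots> + u\<^sub>s M\<^sub>s\<close> of exponents, which is a polynomial in \<open>u\<close> for large \<open>u\<close> by Khovanskii's
  theorem.  As \<open>M\<^sub>0\<close> contains all variables, up to a bounded error this sumset consists of all
  lattice points of the Minkowski sum \<open>u\<^sub>0 Q\<^sub>0 + \<dots> + u\<^sub>s Q\<^sub>s\<close> in a hyperplane of constant coordinate
  sum, whose lattice has covolume \<open>sqrt n\<close>.  Hence the form of degree \<open>n - 1\<close> of the polynomial is
  \<open>V(u\<^sub>0 Q\<^sub>0 + \<dots> + u\<^sub>s Q\<^sub>s) / sqrt n\<close>, and the alternating sum defining the mixed volume is the
  polarization of this form, which computes its coefficients.
\<close>

section \<open>Polynomial functions and the growth of sumsets\<close>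

text \<open>Neither side can be used as it stands. The Minkowski sums lie in hyperplanes and are
  null sets of the ambient space, so each is replaced by the prism over it whose coordinate sum runs
  through an interval of length 1. The Euclidean thickness of this prism is 1 / sqrt n, which is the
  source of the factor, while a suitably shaped lattice cell inside it has volume exactly 1. On the
  other side, a lattice point of a Minkowski sum need not be a sum of points of the sets
  \<open>M i\<close>. Rounding real coefficients down leaves a remainder of bounded degree; once a
  fixed translation has made its coordinates nonnegative, it is a product of variables and is
  absorbed by \<open>M 0\<close>. All limits run along rays t u + c with one large offset c.
  Polarization needs the leading form at vectors u with zero entries, where the Hilbert function
  itself may differ from its polynomial; the offset keeps the rays in the region of agreement and
  disappears in the limit.\<close>

abbreviation "lookup \<equiv> Poly_Mapping.lookup"
abbreviation "keys \<equiv> Poly_Mapping.keys"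
abbreviation "single \<equiv> Poly_Mapping.single"

abbreviation monomial_value :: "nat \<Rightarrow> (nat \<Rightarrow>\<^sub>0 nat) \<Rightarrow> (nat \<Rightarrow> nat) \<Rightarrow> real" where
  "monomial_value s \<beta> u \<equiv> \<Prod>i\<le>s. real (u i) ^ lookup \<beta> i"

lemma eval_poly_eq_sum:
  assumes "finite B" "keys P \<subseteq> B" "\<forall>\<beta>\<in>B. keys \<beta> \<subseteq> {..s}"
  shows "eval_poly P u =
    (\<Sum>\<beta>\<in>B. lookup P \<beta> * monomial_value s \<beta> u)"
proof -
  have *: "(\<Prod>i\<in>keys \<beta>. real (u i) ^ lookup \<beta> i)
      = monomial_value s \<beta> u" if "\<beta> \<in> B" for \<beta>
    by (rule prod.mono_neutral_left) (use assms that in \<open>auto simp: in_keys_iff\<close>)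
  have "eval_poly P u = (\<Sum>\<beta>\<in>keys P. lookup P \<beta> * monomial_value s \<beta> u)"
    unfolding eval_poly_def by (intro sum.cong refl) (use * assms(2) in auto)
  also have "\<dots> = (\<Sum>\<beta>\<in>B. lookup P \<beta> * monomial_value s \<beta> u)"
    by (rule sum.mono_neutral_left) (use assms in \<open>auto simp: in_keys_iff\<close>)
  finally show ?thesis .
qed

definition polyfun :: "nat \<Rightarrow> ((nat \<Rightarrow> nat) \<Rightarrow> real) \<Rightarrow> bool" where
  "polyfun s f \<longleftrightarrow> (\<exists>P. (\<forall>\<beta>\<in>keys P. keys \<beta> \<subseteq> {..s}) \<and> f = eval_poly P)"

lemma polyfun_monomial:
  assumes "keys \<beta> \<subseteq> {..s}"
  shows "polyfun s (\<lambda>u. c * monomial_value s \<beta> u)"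
proof -
  have "eval_poly (single \<beta> c) = (\<lambda>u. c * monomial_value s \<beta> u)"
    by (rule ext, subst eval_poly_eq_sum[of "{\<beta>}" _ s]) (use assms in auto)
  then show ?thesis
    unfolding polyfun_def using assms by (metis empty_iff insert_iff keys_single)
qed

lemma polyfun_add:
  assumes "polyfun s f" "polyfun s g"
  shows "polyfun s (\<lambda>u. f u + g u)"
proof -
  obtain P Q where P: "\<forall>\<beta>\<in>keys P. keys \<beta> \<subseteq> {..s}" "f = eval_poly P"
    and Q: "\<forall>\<beta>\<in>keys Q. keys \<beta> \<subseteq> {..s}" "g = eval_poly Q"
    using assms by (auto simp: polyfun_def)
  let ?B = "keys P \<union> keys Q"
  have k: "keys (P + Q) \<subseteq> ?B" by (rule keys_add)
  have "eval_poly (P + Q) u = f u + g u" for u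
    using P Q k by (simp add: eval_poly_eq_sum[of ?B _ s] lookup_add distrib_right sum.distrib ball_Un)
  then show ?thesis
    unfolding polyfun_def using P(1) Q(1) k by (intro exI[of _ "P + Q"]) fastforce
qed

lemma polyfun_const: "polyfun s (\<lambda>u. c)"
  using polyfun_monomial[of 0 s c] by simp

lemma polyfun_sum:
  assumes "\<And>a. a \<in> A \<Longrightarrow> polyfun s (f a)"
  shows "polyfun s (\<lambda>u. \<Sum>a\<in>A. f a u)"
  using assms by (induction A rule: infinite_finite_induct) (auto intro: polyfun_const polyfun_add)

lemma polyfun_mult:
  assumes "polyfun s f" "polyfun s g"
  shows "polyfun s (\<lambda>u. f u * g u)"
proof -
  obtain P Q where P: "\<forall>\<beta>\<in>keys P. keys \<beta> \<subseteq> {..s}" "f = eval_poly P"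
    and Q: "\<forall>\<beta>\<in>keys Q. keys \<beta> \<subseteq> {..s}" "g = eval_poly Q"
    using assms by (auto simp: polyfun_def)
  have "(\<lambda>u. f u * g u) = (\<lambda>u. \<Sum>\<beta>\<in>keys P. \<Sum>\<gamma>\<in>keys Q.
      (lookup P \<beta> * lookup Q \<gamma>) *
      monomial_value s (\<beta> + \<gamma>) u)"
    using P Q by (auto simp: eval_poly_eq_sum[OF _ order_refl, of _ s] sum_product lookup_add power_add prod.distrib
        mult_ac intro!: ext sum.cong)
  moreover have "polyfun s \<dots>"
    by (intro polyfun_sum polyfun_monomial order_trans[OF keys_add]) (use P Q in auto)
  ultimately show ?thesis by simp
qed

lemma polyfun_var:
  assumes "i \<le> s"
  shows "polyfun s (\<lambda>u. real (u i))"
proof -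
  have "(\<Prod>j\<le>s. real (u j) ^ lookup (single i (1::nat)) j) = real (u i)" for u
  proof -
    have "(\<Prod>j\<le>s. real (u j) ^ lookup (single i (1::nat)) j)
       = (\<Prod>j\<le>s. if j = i then real (u j) else 1)"
      by (intro prod.cong) (auto simp: lookup_single)
    then show ?thesis using assms by (simp add: prod.delta)
  qed
  then show ?thesis
    using polyfun_monomial[of "single i (1::nat)" s 1] assms by simp
qed

lemma polyfun_prod:
  assumes "\<And>a. a \<in> A \<Longrightarrow> polyfun s (f a)"
  shows "polyfun s (\<lambda>u. \<Prod>a\<in>A. f a u)"
  using assms by (induction A rule: infinite_finite_induct) (auto intro: polyfun_const polyfun_mult)

lemma polyfun_power:
  assumes "polyfun s f"
  shows "polyfun s (\<lambda>u. f u ^ k)"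
  using assms by (induction k) (auto intro: polyfun_const polyfun_mult)

lemma polyfun_binomial:
  assumes "i \<le> s"
  shows "polyfun s (\<lambda>u. real ((u i + k) choose k))"
proof -
  have "real ((u i + k) choose k) = (\<Prod>j<k. (real (u i) + real (Suc j)) * inverse (real (Suc j)))" for u
  proof (induction k)
    case (Suc k)
    have "Suc k * ((u i + Suc k) choose Suc k) = (u i + Suc k) * ((u i + k) choose k)"
      using Suc_times_binomial_eq[of "u i + k" k] by (simp add: mult.commute)
    then have "real (Suc k) * real ((u i + Suc k) choose Suc k) = real (u i + Suc k) * real ((u i + k) choose k)"
      by (metis of_nat_mult)
    then have "real ((u i + Suc k) choose Suc k) = (real (u i) + real (Suc k)) * real ((u i + k) choose k) * inverse (real (Suc k))"
      by (simp add: divide_simps mult.commute del: of_nat_Suc binomial_Suc_Suc)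
    then show ?case
      using Suc by (simp only: prod.lessThan_Suc mult_ac)
  qed simp
  moreover have "polyfun s (\<lambda>u. \<Prod>j<k. (real (u i) + real (Suc j)) * inverse (real (Suc j)))"
    by (intro polyfun_prod polyfun_mult polyfun_add polyfun_const polyfun_var assms)
  ultimately show ?thesis by simp
qed

definition eventually_polyfun :: "nat \<Rightarrow> ((nat \<Rightarrow> nat) \<Rightarrow> nat) \<Rightarrow> bool" where
  "eventually_polyfun s h \<longleftrightarrow>
     (\<exists>f N. polyfun s f \<and> (\<forall>u. (\<forall>i\<le>s. N \<le> u i) \<longrightarrow> real (h u) = f u))"

lemma eventually_polyfunI:
  "polyfun s f \<Longrightarrow> (\<And>u. (\<forall>i\<le>s. N \<le> u i) \<Longrightarrow> real (h u) = f u) \<Longrightarrow> eventually_polyfun s h"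
  unfolding eventually_polyfun_def by blast

lemma eventually_polyfun_const: "eventually_polyfun s (\<lambda>u. c)"
  unfolding eventually_polyfun_def by (blast intro: polyfun_const)

lemma eventually_polyfun_add:
  assumes "eventually_polyfun s h" "eventually_polyfun s h'"
  shows "eventually_polyfun s (\<lambda>u. h u + h' u)"
proof -
  obtain f N f' N' where "polyfun s f" "\<And>u. (\<forall>i\<le>s. N \<le> u i) \<Longrightarrow> real (h u) = f u"
    "polyfun s f'" "\<And>u. (\<forall>i\<le>s. N' \<le> u i) \<Longrightarrow> real (h' u) = f' u"
    using assms unfolding eventually_polyfun_def by blast
  then have "polyfun s (\<lambda>u. f u + f' u)"
    "\<And>u. (\<forall>i\<le>s. max N N' \<le> u i) \<Longrightarrow> real (h u + h' u) = f u + f' u"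
    by (auto intro: polyfun_add)
  then show ?thesis by (rule eventually_polyfunI)
qed

lemma eventually_polyfun_diff:
  assumes "eventually_polyfun s h" "eventually_polyfun s h'" "\<And>u. h' u \<le> h u"
  shows "eventually_polyfun s (\<lambda>u. h u - h' u)"
proof -
  obtain f N f' N' where "polyfun s f" "\<And>u. (\<forall>i\<le>s. N \<le> u i) \<Longrightarrow> real (h u) = f u"
    "polyfun s f'" "\<And>u. (\<forall>i\<le>s. N' \<le> u i) \<Longrightarrow> real (h' u) = f' u"
    using assms unfolding eventually_polyfun_def by blast
  then have "polyfun s (\<lambda>u. f u + (-1) * f' u)"
    "\<And>u. (\<forall>i\<le>s. max N N' \<le> u i) \<Longrightarrow> real (h u - h' u) = f u + (-1) * f' u"
    using assms(3) polyfun_add[OF _ polyfun_mult[OF polyfun_const, of s f' "-1"], of f]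
    by (auto simp: of_nat_diff)
  then show ?thesis by (rule eventually_polyfunI)
qed

lemma eventually_polyfun_cong:
  assumes "eventually_polyfun s h" "\<And>u. (\<forall>i\<le>s. c i \<le> u i) \<Longrightarrow> h' u = h u"
  shows "eventually_polyfun s h'"
proof -
  obtain f N where "polyfun s f" "\<And>u. (\<forall>i\<le>s. N \<le> u i) \<Longrightarrow> real (h u) = f u"
    using assms unfolding eventually_polyfun_def by metis
  moreover have "h' u = h u" if "\<forall>i\<le>s. max N (Max (c ` {..s})) \<le> u i" for u
    using that by (intro assms(2)) (auto)
  ultimately have "\<And>u. (\<forall>i\<le>s. max N (Max (c ` {..s})) \<le> u i) \<Longrightarrow> real (h' u) = f u"
    by simp
  then show ?thesis by (rule eventually_polyfunI[OF \<open>polyfun s f\<close>])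
qed

lemma eventually_polyfun_shift:
  assumes "eventually_polyfun s h"
  shows "eventually_polyfun s (\<lambda>u. h (\<lambda>i. u i - c i))"
proof -
  obtain f N where f: "polyfun s f" "\<And>u. (\<forall>i\<le>s. N \<le> u i) \<Longrightarrow> real (h u) = f u"
    using assms unfolding eventually_polyfun_def by metis
  obtain P where P: "\<forall>\<beta>\<in>keys P. keys \<beta> \<subseteq> {..s}" "f = eval_poly P"
    using f(1) by (auto simp: polyfun_def)
  define g where "g = (\<lambda>u. \<Sum>\<beta>\<in>keys P. lookup P \<beta> *
    (\<Prod>i\<le>s. (real (u i) + (- real (c i))) ^ lookup \<beta> i))"
  have "polyfun s g"
    unfolding g_def
    by (intro polyfun_sum polyfun_mult polyfun_prod polyfun_power polyfun_add polyfun_const polyfun_var) auto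
  \<comment> \<open>The bound dominates every \<open>N + c i\<close> at once, so each truncated
    difference is the true difference and still at least \<open>N\<close>.\<close>
  moreover have "real (h (\<lambda>i. u i - c i)) = g u" if "\<forall>i\<le>s. N + (\<Sum>i\<le>s. c i) \<le> u i" for u
  proof -
    have ci: "N + c i \<le> u i" if "i \<le> s" for i
    proof -
      have "c i \<le> (\<Sum>i\<le>s. c i)" using that by (intro member_le_sum) auto
      moreover have "N + (\<Sum>i\<le>s. c i) \<le> u i" using \<open>\<forall>i\<le>s. N + (\<Sum>i\<le>s. c i) \<le> u i\<close> that by blast
      ultimately show ?thesis by linarith
    qed
    have "\<forall>i\<le>s. N \<le> u i - c i" using ci by fastforce
    then have "real (h (\<lambda>i. u i - c i)) = eval_poly P (\<lambda>i. u i - c i)" using f(2) P(2) by auto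
    also have "\<dots> = g u" unfolding g_def using P(1)
      by (subst eval_poly_eq_sum[OF _ order_refl, of _ s])
         (auto intro!: sum.cong prod.cong arg_cong2[of _ _ _ _ "(*)"] arg_cong2[of _ _ _ _ "(^)"]
           simp: of_nat_diff dest!: add_leD2[OF ci])
    finally show ?thesis .
  qed
  ultimately show ?thesis by (rule eventually_polyfunI)
qed

text \<open>Induction over the coordinates. The set \<open>B0\<close> obtained for the old
  coordinates already serves every element whose new coordinate is at least the maximum
  \<open>N\<close> attained on \<open>B0\<close>. Each of the finitely many smaller values of the
  new coordinate gets a finite set \<open>B1 k\<close> of its own.\<close>

lemma dickson:
  fixes B :: "'b set" and f :: "'b \<Rightarrow> 'x \<Rightarrow> nat"
  assumes "finite X"
  shows "\<exists>B0\<subseteq>B. finite B0 \<and> (\<forall>b\<in>B. \<exists>c\<in>B0. \<forall>x\<in>X. f c x \<le> f b x)"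
  using assms
proof (induction X arbitrary: B rule: finite_induct)
  case empty
  show ?case
    by (cases "B = {}") (auto intro: exI[of _ "{SOME b. b \<in> B}"] simp: some_in_eq)
next
  case (insert x X)
  obtain B0 where B0: "B0 \<subseteq> B" "finite B0" "\<forall>b\<in>B. \<exists>c\<in>B0. \<forall>x\<in>X. f c x \<le> f b x"
    using insert.IH by blast
  define N where "N = Max (insert 0 ((\<lambda>c. f c x) ` B0))"
  have "\<forall>k. \<exists>B1. B1 \<subseteq> {b\<in>B. f b x = k} \<and> finite B1 \<and>
      (\<forall>b\<in>{b\<in>B. f b x = k}. \<exists>c\<in>B1. \<forall>x\<in>X. f c x \<le> f b x)"
    using insert.IH by blast
  then obtain B1 where *: "\<forall>k. B1 k \<subseteq> {b\<in>B. f b x = k} \<and> finite (B1 k) \<and>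
      (\<forall>b\<in>{b\<in>B. f b x = k}. \<exists>c\<in>B1 k. \<forall>x\<in>X. f c x \<le> f b x)"
    by (rule choice[THEN exE])
  then have B1: "\<And>k. B1 k \<subseteq> {b\<in>B. f b x = k}" "\<And>k. finite (B1 k)"
    "\<And>k b. b \<in> B \<Longrightarrow> f b x = k \<Longrightarrow> \<exists>c\<in>B1 k. \<forall>x\<in>X. f c x \<le> f b x"
    by (blast, blast, simp)
  have "\<exists>c\<in>B0 \<union> (\<Union>k<N. B1 k). \<forall>y\<in>insert x X. f c y \<le> f b y" if "b \<in> B" for b
  proof (cases "f b x < N")
    case True
    obtain c where c: "c \<in> B1 (f b x)" "\<forall>y\<in>X. f c y \<le> f b y"
      using B1(3)[OF \<open>b \<in> B\<close>, of "f b x"] by blast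
    moreover have "f c x = f b x" using c(1) B1(1) by blast
    ultimately show ?thesis using True by (intro bexI[of _ c]) auto
  next
    case False
    obtain c where c: "c \<in> B0" "\<forall>y\<in>X. f c y \<le> f b y"
      using B0(3) \<open>b \<in> B\<close> by blast
    moreover have "f c x \<le> N" unfolding N_def using B0(2) c(1) by (intro Max_ge) auto
    ultimately show ?thesis using False by (intro bexI[of _ c]) auto
  qed
  moreover have "B0 \<union> (\<Union>k<N. B1 k) \<subseteq> B" using B0 B1 by blast
  moreover have "finite (B0 \<union> (\<Union>k<N. B1 k))" using B0 B1 by blast
  ultimately show ?case by blast
qed

section \<open>Monomials of fixed multidegree\<close>

definition block_sum :: "nat set \<Rightarrow> (nat \<Rightarrow> nat) \<Rightarrow> (nat \<Rightarrow> 'a::comm_monoid_add) \<Rightarrow> nat \<Rightarrow> 'a" where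
  "block_sum X \<tau> y i = (\<Sum>x | x \<in> X \<and> \<tau> x = i. y x)"

text \<open>The monomials of multidegree \<open>u\<close> in the polynomial ring with variables
  \<open>X\<close>, where the variable \<open>x\<close> has as its degree the unit vector of its
  block \<open>\<tau> x\<close>. Later \<open>X\<close> numbers the elements of all
  \<open>M i\<close>.\<close>

definition graded_piece :: "nat set \<Rightarrow> (nat \<Rightarrow> nat) \<Rightarrow> nat \<Rightarrow> (nat \<Rightarrow> nat) \<Rightarrow> (nat \<Rightarrow>\<^sub>0 nat) set" where
  "graded_piece X \<tau> s u =
     {y. keys y \<subseteq> X \<and> (\<forall>i\<le>s. block_sum X \<tau> (lookup y) i = u i)}"

lemma block_sum_add:
  "block_sum X \<tau> (lookup (y + z)) i
    = block_sum X \<tau> (lookup y) i + block_sum X \<tau> (lookup z) i"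
  by (simp add: block_sum_def lookup_add sum.distrib)

lemma block_sum_insert:
  assumes "finite X" "x \<notin> X"
  shows "block_sum (insert x X) \<tau> y i = (if \<tau> x = i then y x else 0) + block_sum X \<tau> y i"
proof -
  have "{z. z \<in> insert x X \<and> \<tau> z = i} = (if \<tau> x = i then insert x {z. z \<in> X \<and> \<tau> z = i} else {z. z \<in> X \<and> \<tau> z = i})"
    by auto
  then show ?thesis using assms by (auto simp: block_sum_def)
qed

lemma block_sum_cong:
  assumes "\<And>x. x \<in> X \<Longrightarrow> y x = z x"
  shows "block_sum X \<tau> y i = block_sum X \<tau> z i"
  unfolding block_sum_def by (rule sum.cong) (use assms in auto)

text \<open>Sorting by the exponent of the new variable \<open>x\<close>: \<open>v\<close> is the
  part of the degree in block \<open>\<tau> x\<close> that is left to the other variables.\<close>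

lemma graded_piece_insert:
  assumes "finite X" "x \<notin> X" "\<tau> x \<le> s"
  shows "graded_piece (insert x X) \<tau> s u =
    (\<Union>v\<le>u (\<tau> x). (\<lambda>y. y + single x (u (\<tau> x) - v)) ` graded_piece X \<tau> s (u(\<tau> x := v)))"
    (is "?L = ?R")
proof (intro set_eqI iffI)
  let ?bs = "block_sum X \<tau>"
  fix y assume y: "y \<in> ?L"
  define z where "z = y - single x (lookup y x)"
  have zx: "lookup z w = (if w = x then 0 else lookup y w)" for w
    by (simp add: z_def lookup_minus lookup_single when_def)
  have yz: "y = z + single x (lookup y x)"
    by (rule poly_mapping_eqI) (simp add: lookup_add zx lookup_single when_def)
  have bz: "?bs (lookup z) i = ?bs (lookup y) i" for i
    by (rule block_sum_cong) (use assms zx in auto)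
  have b: "(if \<tau> x = i then lookup y x else 0) + ?bs (lookup z) i = u i" if "i \<le> s" for i
    using y that unfolding graded_piece_def by (simp add: block_sum_insert[OF assms(1,2)] bz)
  have "keys z \<subseteq> X"
    using y zx unfolding graded_piece_def
    by (auto simp: in_keys_iff subset_iff split: if_splits)
  moreover have "?bs (lookup z) i = (u(\<tau> x := ?bs (lookup z) (\<tau> x))) i"
    if "i \<le> s" for i
    using b[OF that] by (cases "\<tau> x = i") simp_all
  ultimately have "z \<in> graded_piece X \<tau> s (u(\<tau> x := ?bs (lookup z) (\<tau> x)))"
    by (simp add: graded_piece_def)
  moreover have "u (\<tau> x) - ?bs (lookup z) (\<tau> x) = lookup y x"
     "?bs (lookup z) (\<tau> x) \<le> u (\<tau> x)"
    using b[OF assms(3)] by simp_all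
  ultimately show "y \<in> ?R" using yz
    by (intro UN_I[of "?bs (lookup z) (\<tau> x)"] image_eqI[of _ _ z]) simp_all
next
  let ?bs = "block_sum X \<tau>"
  fix y assume "y \<in> ?R"
  then obtain v z where v: "v \<le> u (\<tau> x)" and z: "z \<in> graded_piece X \<tau> s (u(\<tau> x := v))"
    and y: "y = z + single x (u (\<tau> x) - v)" by blast
  have k: "keys z \<subseteq> X" using z by (simp add: graded_piece_def)
  have zx: "lookup z x = 0" using k assms(2) by (auto simp: in_keys_iff)
  have yl: "lookup y w = (if w = x then u (\<tau> x) - v else lookup z w)" for w
    by (simp add: y lookup_add lookup_single when_def zx)
  have bz: "?bs (lookup y) i = ?bs (lookup z) i" for i
    by (rule block_sum_cong) (use assms yl in auto)
  have "keys y \<subseteq> insert x X"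
    using k yl by (auto simp: in_keys_iff subset_iff split: if_splits)
  moreover have "block_sum (insert x X) \<tau> (lookup y) i = u i" if "i \<le> s" for i
    using z v that unfolding graded_piece_def by (auto simp: block_sum_insert[OF assms(1,2)] bz yl)
  ultimately show "y \<in> ?L" by (simp add: graded_piece_def)
qed

lemma finite_graded_piece:
  assumes "finite X" "\<tau> ` X \<subseteq> {..s}"
  shows "finite (graded_piece X \<tau> s u)"
  using assms
proof (induction X arbitrary: u rule: finite_induct)
  case empty
  have "graded_piece {} \<tau> s u \<subseteq> {0}" by (auto simp: graded_piece_def)
  then show ?case by (rule finite_subset) simp
next
  case (insert x X)
  then show ?case by (subst graded_piece_insert) auto
qed

lemma card_graded_piece_insert:
  assumes "finite X" "x \<notin> X" "\<tau> ` insert x X \<subseteq> {..s}"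
  shows "card (graded_piece (insert x X) \<tau> s u) = (\<Sum>v\<le>u (\<tau> x). card (graded_piece X \<tau> s (u(\<tau> x := v))))"
proof -
  let ?A = "\<lambda>v. (\<lambda>y. y + single x (u (\<tau> x) - v)) ` graded_piece X \<tau> s (u(\<tau> x := v))"
  have "lookup y x = u (\<tau> x) - v" if "y \<in> ?A v" for y v
    using that assms(2) by (auto simp: graded_piece_def lookup_add in_keys_iff)
  note l = this
  have disj: "?A v \<inter> ?A w = {}" if "v \<le> u (\<tau> x)" "w \<le> u (\<tau> x)" "v \<noteq> w" for v w
  proof (rule ccontr)
    assume "?A v \<inter> ?A w \<noteq> {}"
    then obtain y where "y \<in> ?A v" "y \<in> ?A w" by blast
    then have "u (\<tau> x) - v = u (\<tau> x) - w" using l by metis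
    then show False using that by linarith
  qed
  have "card (\<Union>v\<le>u (\<tau> x). ?A v) = (\<Sum>v\<le>u (\<tau> x). card (?A v))"
    using assms disj by (intro card_UN_disjoint ballI impI finite_imageI finite_graded_piece) auto
  also have "\<dots> = (\<Sum>v\<le>u (\<tau> x). card (graded_piece X \<tau> s (u(\<tau> x := v))))"
    by (intro sum.cong refl card_image) (auto intro: inj_onI)
  finally show ?thesis using assms by (subst graded_piece_insert) auto
qed

text \<open>The hockey-stick identity, read as counting multisets of size \<open>u\<close> from m +
  1 elements by the number of times the last element occurs. For m = 0 truncated subtraction makes
  the term at 0 equal to 1 and all others 0, as the count requires.\<close>

lemma sum_multiset_choose: "(\<Sum>v\<le>u. (v + m - 1) choose v) = (u + m) choose u"
proof (cases m)
  case 0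
  have "(\<Sum>v\<le>u. (v - 1) choose v) = (\<Sum>v\<in>{0}. (v - 1) choose v)"
    by (rule sum.mono_neutral_right) (auto simp: binomial_eq_0)
  then show ?thesis using 0 by simp
next
  case (Suc r)
  then show ?thesis using sum_choose_lower[of r u] by (simp add: add.commute)
qed

text \<open>Stars and bars in each block separately. An empty block has to contribute 1 in degree 0
  and 0 otherwise, and the truncated subtraction gives just that.\<close>

lemma card_graded_piece:
  assumes "finite X" "\<tau> ` X \<subseteq> {..s}"
  shows "card (graded_piece X \<tau> s u) =
    (\<Prod>i\<le>s. (u i + card {x. x \<in> X \<and> \<tau> x = i} - 1) choose u i)"
  using assms
proof (induction X arbitrary: u rule: finite_induct)
  case empty
  show ?case
  proof (cases "\<forall>i\<le>s. u i = 0")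
    case True
    then have "graded_piece {} \<tau> s u = {0}" by (auto simp: graded_piece_def block_sum_def)
    then show ?thesis using True by simp
  next
    case False
    then obtain i where i: "i \<le> s" "u i \<noteq> 0" by blast
    then have "graded_piece {} \<tau> s u = {}" by (auto simp: graded_piece_def block_sum_def)
    moreover have "(\<Prod>i\<le>s. (u i - 1) choose u i) = 0"
      using i by (intro prod_zero) (auto intro!: bexI[of _ i])
    ultimately show ?thesis by simp
  qed
next
  case (insert x X)
  let ?m = "\<lambda>i. card {x. x \<in> X \<and> \<tau> x = i}"
  let ?t = "\<tau> x"
  have t: "?t \<le> s" using insert.prems by auto
  have split: "(\<Prod>i\<le>s. F i) = F ?t * (\<Prod>i\<in>{..s} - {?t}. F i)" for F :: "nat \<Rightarrow> nat"
    using t by (intro prod.remove) auto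
  have m: "card {z. z \<in> insert x X \<and> \<tau> z = i} = (if i = ?t then Suc (?m i) else ?m i)" for i
  proof -
    have "{z. z \<in> insert x X \<and> \<tau> z = i} = (if i = ?t then insert x {x. x \<in> X \<and> \<tau> x = i} else {x. x \<in> X \<and> \<tau> x = i})"
      by auto
    then show ?thesis using insert.hyps by auto
  qed
  have "card (graded_piece (insert x X) \<tau> s u) =
      (\<Sum>v\<le>u ?t. \<Prod>i\<le>s. ((u(?t := v)) i + ?m i - 1) choose (u(?t := v)) i)"
    using insert by (subst card_graded_piece_insert) auto
  also have "\<dots> = (\<Sum>v\<le>u ?t. ((v + ?m ?t - 1) choose v) * (\<Prod>i\<in>{..s} - {?t}. (u i + ?m i - 1) choose u i))"
    unfolding split by (auto intro!: sum.cong arg_cong2[of _ _ _ _ "(*)"] prod.cong)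
  also have "\<dots> = ((u ?t + ?m ?t) choose u ?t) * (\<Prod>i\<in>{..s} - {?t}. (u i + ?m i - 1) choose u i)"
    by (simp only: sum_distrib_right[symmetric] sum_multiset_choose)
  also have "\<dots> = (\<Prod>i\<le>s. (u i + (if i = ?t then Suc (?m i) else ?m i) - 1) choose u i)"
    unfolding split by (auto intro!: arg_cong2[of _ _ _ _ "(*)"] prod.cong)
  finally show ?case by (simp only: m)
qed

lemma eventually_polyfun_card_graded_piece:
  assumes "finite X" "\<tau> ` X = {..s}"
  shows "eventually_polyfun s (\<lambda>u. card (graded_piece X \<tau> s u))"
proof -
  let ?m = "\<lambda>i. card {x. x \<in> X \<and> \<tau> x = i}"
  have m: "?m i \<ge> 1" if "i \<le> s" for i
  proof -
    have "i \<in> \<tau> ` X" using that by (simp add: assms(2))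
    then have "{x. x \<in> X \<and> \<tau> x = i} \<noteq> {}" by auto
    then show ?thesis using assms(1) by (simp add: Suc_le_eq card_gt_0_iff)
  qed
  have "polyfun s (\<lambda>u. \<Prod>i\<le>s. real ((u i + (?m i - 1)) choose (?m i - 1)))"
    by (intro polyfun_prod polyfun_binomial) auto
  moreover have "real (card (graded_piece X \<tau> s u)) = (\<Prod>i\<le>s. real ((u i + (?m i - 1)) choose (?m i - 1)))" for u
  proof -
    \<comment> \<open>Symmetry makes the lower index independent of \<open>u\<close>, so the count
      is a polynomial; as the block is nonempty, subtracting 1 is not truncated.\<close>
    have "(u i + ?m i - 1) choose u i = (u i + (?m i - 1)) choose (?m i - 1)" if "i \<le> s" for i
      using m[OF that] binomial_symmetric[of "u i" "u i + (?m i - 1)"] by (simp add: add_diff_assoc)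
    then show ?thesis
      using assms by (subst card_graded_piece) (auto simp: of_nat_prod[symmetric] simp del: of_nat_prod)
  qed
  ultimately show ?thesis by (rule eventually_polyfunI)
qed

section \<open>Unions of cones and images of additive maps\<close>

lemma lookup_le_imp_diff_add:
  fixes c y :: "'b \<Rightarrow>\<^sub>0 nat"
  assumes "keys c \<subseteq> X" "\<forall>x\<in>X. lookup c x \<le> lookup y x"
  shows "c + (y - c) = y"
proof (rule poly_mapping_eqI)
  fix x
  show "lookup (c + (y - c)) x = lookup y x"
    using assms(2) subsetD[OF assms(1), of x]
    by (cases "lookup c x = 0") (auto simp: lookup_add lookup_minus in_keys_iff)
qed

text \<open>Division by the monomial \<open>c\<close> lowers the multidegree by that of
  \<open>c\<close>. The predicate \<open>P\<close> is carried along because conditions excluding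
  other cones have to be translated together with the points.\<close>

lemma graded_piece_translate:
  assumes "keys c \<subseteq> X" "\<forall>i\<le>s. block_sum X \<tau> (lookup c) i \<le> u i"
  shows "{y \<in> graded_piece X \<tau> s u. (\<forall>x\<in>X. lookup c x \<le> lookup y x) \<and> P y}
    = (\<lambda>z. c + z) ` {z \<in> graded_piece X \<tau> s (\<lambda>i. u i - block_sum X \<tau> (lookup c) i). P (c + z)}"
    (is "?L = ?R")
proof (intro set_eqI iffI)
  let ?bs = "block_sum X \<tau>"
  fix y assume y: "y \<in> ?L"
  have e: "c + (y - c) = y"
    by (rule lookup_le_imp_diff_add[of _ X]) (use y assms in auto)
  have "keys (y - c) \<subseteq> X"
    using y unfolding graded_piece_def by (auto simp: in_keys_iff lookup_minus subset_iff)
  moreover have "?bs (lookup (y - c)) i = u i - ?bs (lookup c) i" if "i \<le> s" for i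
  proof -
    have "?bs (lookup (c + (y - c))) i = u i"
      using y that unfolding e graded_piece_def by simp
    then show ?thesis by (simp add: block_sum_add)
  qed
  ultimately have "y - c \<in> {z \<in> graded_piece X \<tau> s (\<lambda>i. u i - ?bs (lookup c) i). P (c + z)}"
    using y e unfolding graded_piece_def by simp
  then show "y \<in> ?R" using e by (metis (lifting) image_eqI)
next
  let ?bs = "block_sum X \<tau>"
  fix y assume "y \<in> ?R"
  then obtain z where y: "y = c + z" and z: "z \<in> graded_piece X \<tau> s (\<lambda>i. u i - ?bs (lookup c) i)" "P (c + z)"
    by blast
  have "keys y \<subseteq> X"
    using z assms keys_add[of c z] unfolding y graded_piece_def by blast
  then show "y \<in> ?L"
    using z assms(2) unfolding y graded_piece_def by (simp add: block_sum_add lookup_add)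
qed

text \<open>By inclusion of one cone at a time: the part of a new cone that is already covered is,
  after translation, again a union of cones.\<close>

lemma eventually_polyfun_card_cones:
  assumes X: "finite X" "\<tau> ` X = {..s}"
    and "\<forall>b\<in>set bs. keys b \<subseteq> X"
  shows "eventually_polyfun s (\<lambda>u. card {y \<in> graded_piece X \<tau> s u.
    \<exists>b\<in>set bs. \<forall>x\<in>X. lookup b x \<le> lookup y x})"
  using assms(3)
\<comment> \<open>The hypothesis is needed for \<open>cs\<close> and also for the translated
  generators \<open>?ds\<close>, which are not a sublist of \<open>bs\<close> but have the same
  length as \<open>cs\<close>.\<close>
proof (induction "length bs" arbitrary: bs)
  case 0
  then show ?case by (simp add: eventually_polyfun_const)
next
  case (Suc n)
  then obtain c cs where bs: "bs = c # cs" "length cs = n" by (cases bs) auto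
  let ?le = "\<lambda>b y. \<forall>x\<in>X. lookup b x \<le> lookup y x"
  let ?G = "graded_piece X \<tau> s"
  let ?d = "block_sum X \<tau> (lookup c)"
  \<comment> \<open>\<open>c + z\<close> is divisible by \<open>b\<close> exactly if
    \<open>z\<close> is divisible by the truncated difference \<open>b - c\<close>; these
    differences generate the colon ideal of \<open>cs\<close> by \<open>c\<close>.\<close>
  let ?ds = "map (\<lambda>b. b - c) cs"
  have kc: "keys c \<subseteq> X" and kcs: "\<forall>b\<in>set cs. keys b \<subseteq> X"
    using Suc.prems bs by auto
  have kds: "\<forall>b\<in>set ?ds. keys b \<subseteq> X"
  proof
    fix b assume "b \<in> set ?ds"
    then obtain b' where "b = b' - c" "b' \<in> set cs" by auto
    then show "keys b \<subseteq> X"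
      using kcs by (force simp: in_keys_iff lookup_minus subset_iff)
  qed
  define h where "h = (\<lambda>u. card {y \<in> ?G u. \<exists>b\<in>set cs. ?le b y})"
  define h1 where "h1 = (\<lambda>u. card (?G u) - card {y \<in> ?G u. \<exists>b\<in>set ?ds. ?le b y})"
  have fin: "finite (?G u)" for u using X by (intro finite_graded_piece) auto
  have "eventually_polyfun s h" unfolding h_def
    by (rule Suc.hyps(1)) (use bs kcs in auto)
  moreover have "eventually_polyfun s h1" unfolding h1_def
  proof (rule eventually_polyfun_diff)
    show "eventually_polyfun s (\<lambda>u. card (?G u))"
      by (rule eventually_polyfun_card_graded_piece[OF X])
    show "eventually_polyfun s (\<lambda>u. card {y \<in> ?G u. \<exists>b\<in>set ?ds. ?le b y})"
      by (rule Suc.hyps(1)) (use bs kds in auto)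
    show "card {y \<in> ?G u. \<exists>b\<in>set ?ds. ?le b y} \<le> card (?G u)" for u
      using fin by (intro card_mono) auto
  qed
  ultimately have "eventually_polyfun s (\<lambda>u. h u + h1 (\<lambda>i. u i - ?d i))"
    by (intro eventually_polyfun_add eventually_polyfun_shift)
  then show ?case
  proof (rule eventually_polyfun_cong)
    fix u assume u: "\<forall>i\<le>s. ?d i \<le> u i"
    let ?v = "\<lambda>i. u i - ?d i"
    have "{y \<in> ?G u. \<exists>b\<in>set bs. ?le b y} =
        {y \<in> ?G u. \<exists>b\<in>set cs. ?le b y} \<union> {y \<in> ?G u. ?le c y \<and> \<not> (\<exists>b\<in>set cs. ?le b y)}"
      unfolding bs by auto
    then have "card {y \<in> ?G u. \<exists>b\<in>set bs. ?le b y} =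
        h u + card {y \<in> ?G u. ?le c y \<and> \<not> (\<exists>b\<in>set cs. ?le b y)}"
      unfolding h_def using fin by (auto intro!: card_Un_disjoint)
    also have "{y \<in> ?G u. ?le c y \<and> \<not> (\<exists>b\<in>set cs. ?le b y)} =
        (\<lambda>z. c + z) ` {z \<in> ?G ?v. \<not> (\<exists>b\<in>set cs. ?le b (c + z))}"
      by (rule graded_piece_translate[OF kc u])
    also have "card \<dots> = card {z \<in> ?G ?v. \<not> (\<exists>b\<in>set cs. ?le b (c + z))}"
      by (intro card_image) (auto intro: inj_onI)
    also have "{z \<in> ?G ?v. \<not> (\<exists>b\<in>set cs. ?le b (c + z))} = ?G ?v - {y \<in> ?G ?v. \<exists>b\<in>set ?ds. ?le b y}"
      by (auto simp: lookup_add lookup_minus le_diff_conv add.commute)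
    also have "card \<dots> = h1 ?v"
      unfolding h1_def using fin by (subst card_Diff_subset) auto
    finally show "card {y \<in> ?G u. \<exists>b\<in>set bs. ?le b y} = h u + h1 ?v" .
  qed
qed

text \<open>Each fibre of \<open>\<phi>\<close> is represented by its minimal element, so the image of \<open>\<phi>\<close> is counted by
  the complement of the set \<open>B\<close> of non-minimal elements, which is closed under translation.\<close>

theorem khovanskii:
  fixes \<phi> :: "(nat \<Rightarrow>\<^sub>0 nat) \<Rightarrow> 'b"
  assumes X: "finite X" "\<tau> ` X = {..s}"
    and \<phi>: "\<And>y y' z. \<phi> y = \<phi> y' \<Longrightarrow> \<phi> (y + z) = \<phi> (y' + z)"
  shows "eventually_polyfun s (\<lambda>u. card (\<phi> ` graded_piece X \<tau> s u))"
proof -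
  let ?G = "graded_piece X \<tau> s"
  let ?le = "\<lambda>b y. \<forall>x\<in>X. lookup b x \<le> lookup y x"
  \<comment> \<open>Here \<open><\<close> is the linear order on finitely supported maps, not
    divisibility. Its compatibility with addition makes \<open>B\<close> closed under multiplication
    by monomials, and its linearity leaves exactly one element outside \<open>B\<close> in each
    fibre within a graded piece.\<close>
  define B where "B = {y. \<exists>u. y \<in> ?G u \<and> (\<exists>y'\<in>?G u. y' < y \<and> \<phi> y' = \<phi> y)}"
  have kB: "keys b \<subseteq> X" if "b \<in> B" for b
    using that by (auto simp: B_def graded_piece_def)
  have fin: "finite (?G u)" for u using X by (intro finite_graded_piece) auto
  have up: "b + z \<in> B" if "b \<in> B" "keys z \<subseteq> X" for b z
  proof -
    obtain u b' where b: "b \<in> ?G u" "b' \<in> ?G u" "b' < b" "\<phi> b' = \<phi> b"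
      using \<open>b \<in> B\<close> unfolding B_def by blast
    let ?u = "\<lambda>i. u i + block_sum X \<tau> (lookup z) i"
    have "b + z \<in> ?G ?u" "b' + z \<in> ?G ?u"
      using b that(2) keys_add[of b z] keys_add[of b' z]
      unfolding graded_piece_def by (auto simp: block_sum_add)
    moreover have "b' + z < b + z" using b(3) by simp
    moreover have "\<phi> (b' + z) = \<phi> (b + z)" by (rule \<phi>[OF b(4)])
    ultimately show ?thesis unfolding B_def by blast
  qed
  obtain B0 where B0: "B0 \<subseteq> B" "finite B0" "\<forall>b\<in>B. \<exists>c\<in>B0. ?le c b"
    using dickson[OF X(1), of B lookup] by blast
  obtain bs where bs: "set bs = B0" using B0(2) finite_list by blast
  have B_iff: "y \<in> B \<longleftrightarrow> (\<exists>b\<in>set bs. ?le b y)" if "y \<in> ?G u" for y u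
  proof
    assume "\<exists>b\<in>set bs. ?le b y"
    then obtain b where b: "b \<in> B" "?le b y" using bs B0 by blast
    have "b + (y - b) = y" using kB b by (intro lookup_le_imp_diff_add) auto
    moreover have "keys (y - b) \<subseteq> X"
      using that unfolding graded_piece_def by (auto simp: in_keys_iff lookup_minus subset_iff)
    ultimately show "y \<in> B" using up[OF b(1)] by metis
  qed (use bs B0 in blast)
  have "card (\<phi> ` ?G u) = card (?G u) - card {y \<in> ?G u. \<exists>b\<in>set bs. ?le b y}" for u
  proof -
    have "\<phi> ` ?G u = \<phi> ` (?G u - B)"
    proof (intro equalityI subsetI)
      fix e assume "e \<in> \<phi> ` ?G u"
      then have ne: "{y \<in> ?G u. \<phi> y = e} \<noteq> {}" by blast
      define y where "y = Min {y \<in> ?G u. \<phi> y = e}"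
      have y: "y \<in> ?G u" "\<phi> y = e"
        using Min_in[OF _ ne] fin unfolding y_def by auto
      have "y \<notin> B"
      proof
        assume "y \<in> B"
        then obtain u' y' where y': "y \<in> ?G u'" "y' \<in> ?G u'" "y' < y" "\<phi> y' = \<phi> y"
          by (auto simp: B_def)
        then have "y' \<in> ?G u" using y(1) unfolding graded_piece_def by auto
        then have "y \<le> y'" unfolding y_def using fin y' y(2) by (intro Min_le) auto
        then show False using y'(3) by simp
      qed
      then show "e \<in> \<phi> ` (?G u - B)" using y by blast
    qed blast
    moreover have "inj_on \<phi> (?G u - B)"
    proof (rule inj_onI)
      fix y y' assume *: "y \<in> ?G u - B" "y' \<in> ?G u - B" "\<phi> y = \<phi> y'"
      then have "\<not> y < y'" "\<not> y' < y" unfolding B_def by auto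
      then show "y = y'" by simp
    qed
    ultimately have "card (\<phi> ` ?G u) = card (?G u - B)" by (simp add: card_image)
    also have "?G u - B = ?G u - {y \<in> ?G u. \<exists>b\<in>set bs. ?le b y}"
      using B_iff by blast
    also have "card \<dots> = card (?G u) - card {y \<in> ?G u. \<exists>b\<in>set bs. ?le b y}"
      using fin by (intro card_Diff_subset) auto
    finally show ?thesis .
  qed
  moreover have "eventually_polyfun s (\<lambda>u. card (?G u) - card {y \<in> ?G u. \<exists>b\<in>set bs. ?le b y})"
    using fin bs B0(1) kB
    by (intro eventually_polyfun_diff eventually_polyfun_card_graded_piece[OF X]
        eventually_polyfun_card_cones[OF X] card_mono) auto
  ultimately show ?thesis by simp
qed

section \<open>Leading forms and polarization\<close>

text \<open>The homogeneous component of degree \<open>r\<close> as a function. The degree is a free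
  parameter because it is not known in advance: it is found by testing which components
  vanish.\<close>

definition leading_form :: "nat \<Rightarrow> nat \<Rightarrow> (nat, real) mpoly \<Rightarrow> (nat \<Rightarrow> nat) \<Rightarrow> real" where
  "leading_form s r P u = (\<Sum>\<beta> | \<beta> \<in> keys P \<and> weight s \<beta> = r.
     lookup P \<beta> * monomial_value s \<beta> u)"

text \<open>After division by \<open>t ^ r\<close> each factor of a monomial of weight
  \<open>r\<close> tends to the power of \<open>u i\<close>, and monomials of smaller weight keep a
  positive power of 1 / t. The offset \<open>c\<close> is lost in the limit, so it can be chosen to
  keep all coordinates large even if \<open>u\<close> has zero entries.\<close>

lemma tendsto_leading_form:
  assumes P: "\<forall>\<beta>\<in>keys P. keys \<beta> \<subseteq> {..s} \<and> weight s \<beta> \<le> r"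
  shows "(\<lambda>t. eval_poly P (\<lambda>i. t * u i + c i) / real t ^ r) \<longlonglongrightarrow> leading_form s r P u"
proof -
  have lim1: "(\<lambda>t. real (t * u i + c i) / real t) \<longlonglongrightarrow> real (u i)" for i
  proof -
    have "(\<lambda>t. real (u i) + real (c i) / real t) \<longlonglongrightarrow> real (u i) + 0"
      by (intro tendsto_intros lim_const_over_n)
    moreover have "\<forall>\<^sub>F t in sequentially. real (u i) + real (c i) / real t = real (t * u i + c i) / real t"
      using eventually_gt_at_top[of 0] by eventually_elim (simp add: field_simps)
    ultimately have "(\<lambda>t. real (t * u i + c i) / real t) \<longlonglongrightarrow> real (u i) + 0"
      by (rule Lim_transform_eventually)
    then show ?thesis by simp
  qed
  have lim2: "(\<lambda>t. (1 / real t) ^ k) \<longlonglongrightarrow> (if k = 0 then 1 else 0)" for k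
  proof -
    have "(\<lambda>t. (1 / real t) ^ k) \<longlonglongrightarrow> 0 ^ k"
      by (intro tendsto_power lim_1_over_n)
    then show ?thesis by (simp add: power_0_left)
  qed
  have "(\<lambda>t. lookup P \<beta> * monomial_value s \<beta> (\<lambda>i. t * u i + c i) / real t ^ r)
     \<longlonglongrightarrow> (if weight s \<beta> = r then lookup P \<beta> * monomial_value s \<beta> u else 0)"
    if "\<beta> \<in> keys P" for \<beta>
  proof -
    have w: "weight s \<beta> \<le> r" using P that by blast
    have "(\<lambda>t. lookup P \<beta> * ((\<Prod>i\<le>s. (real (t * u i + c i) / real t) ^ lookup \<beta> i)
         * (1 / real t) ^ (r - weight s \<beta>)))
       \<longlonglongrightarrow> lookup P \<beta> * (monomial_value s \<beta> u
         * (if r - weight s \<beta> = 0 then 1 else 0))"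
      by (intro tendsto_mult tendsto_const tendsto_prod tendsto_power lim1 lim2)
    moreover have "\<forall>\<^sub>F t in sequentially.
        lookup P \<beta> * ((\<Prod>i\<le>s. (real (t * u i + c i) / real t) ^ lookup \<beta> i)
         * (1 / real t) ^ (r - weight s \<beta>))
        = lookup P \<beta> * monomial_value s \<beta> (\<lambda>i. t * u i + c i) / real t ^ r"
      using eventually_gt_at_top[of 0]
    proof eventually_elim
      case (elim t)
      have "real t ^ r = (\<Prod>i\<le>s. real t ^ lookup \<beta> i) * real t ^ (r - weight s \<beta>)"
        using w by (simp add: weight_def power_sum[symmetric] power_add[symmetric])
      then show ?case by (simp add: power_divide prod_dividef)
    qed
    ultimately have "(\<lambda>t. lookup P \<beta> * monomial_value s \<beta> (\<lambda>i. t * u i + c i) / real t ^ r)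
       \<longlonglongrightarrow> lookup P \<beta> * (monomial_value s \<beta> u
         * (if r - weight s \<beta> = 0 then 1 else 0))"
      by (rule Lim_transform_eventually)
    then show ?thesis using w by (auto split: if_splits)
  qed
  then have "(\<lambda>t. \<Sum>\<beta>\<in>keys P. lookup P \<beta> * monomial_value s \<beta> (\<lambda>i. t * u i + c i) / real t ^ r)
     \<longlonglongrightarrow> (\<Sum>\<beta>\<in>keys P. if weight s \<beta> = r then lookup P \<beta> * monomial_value s \<beta> u else 0)"
    by (rule tendsto_sum)
  moreover have "(\<Sum>\<beta>\<in>keys P. if weight s \<beta> = r then lookup P \<beta> * monomial_value s \<beta> u else 0)
     = leading_form s r P u"
    unfolding leading_form_def by (simp add: sum.inter_filter)
  moreover have "eval_poly P (\<lambda>i. t * u i + c i) =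
      (\<Sum>\<beta>\<in>keys P. lookup P \<beta> * monomial_value s \<beta> (\<lambda>i. t * u i + c i))" for t
    using P by (intro eval_poly_eq_sum) auto
  ultimately show ?thesis by (simp add: sum_divide_distrib)
qed

text \<open>This is the finite difference of order \<open>a\<close> of the power function at 0.
  Absorbing one factor \<open>k\<close> into the binomial coefficient lowers \<open>a\<close>, and
  expanding the power of \<open>Suc k\<close> leaves only the exponent \<open>a\<close> by the
  induction hypothesis.\<close>

lemma alternating_binomial_power_sum:
  assumes "b \<le> a"
  shows "(\<Sum>k\<le>a. (-1) ^ (a - k) * real (a choose k) * real k ^ b) = (if b = a then fact a else 0)"
  using assms
proof (induction a arbitrary: b)
  case (Suc a)
  have alt: "(\<Sum>k\<le>Suc a. (-1) ^ (Suc a - k) * real (Suc a choose k)) = 0"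
  proof -
    have "(\<Sum>k\<le>Suc a. of_nat (Suc a choose k) * (1::real) ^ k * (-1) ^ (Suc a - k)) = (1 + -1) ^ Suc a"
      by (rule binomial_ring[symmetric])
    then show ?thesis by (simp add: mult.commute)
  qed
  show ?case
  proof (cases b)
    case 0
    then show ?thesis using alt by simp
  next
    case (Suc c)
    have c: "c \<le> a" using Suc Suc.prems by simp
    \<comment> \<open>The term at 0 disappears because the exponent is positive; the remaining
      indices are shifted by one.\<close>
    have "(\<Sum>k\<le>Suc a. (-1) ^ (Suc a - k) * real (Suc a choose k) * real k ^ b)
      = (\<Sum>k\<le>a. (-1) ^ (a - k) * real (Suc a choose Suc k) * real (Suc k) ^ b)"
      using Suc by (subst sum.atMost_Suc_shift) simp
    also have "\<dots> = (\<Sum>k\<le>a. real (Suc a) * ((-1) ^ (a - k) * real (a choose k) * real (Suc k) ^ c))"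
    proof (intro sum.cong refl)
      fix k
      have "real (Suc k) * real (Suc a choose Suc k) = real (Suc a) * real (a choose k)"
        by (metis Suc_times_binomial of_nat_mult)
      then show "(-1) ^ (a - k) * real (Suc a choose Suc k) * real (Suc k) ^ b
          = real (Suc a) * ((-1) ^ (a - k) * real (a choose k) * real (Suc k) ^ c)"
        unfolding Suc power_Suc by (metis (no_types, opaque_lifting) mult.assoc mult.commute)
    qed
    also have "\<dots> = real (Suc a) * (\<Sum>k\<le>a. (-1) ^ (a - k) * real (a choose k) * (\<Sum>i\<le>c. real (c choose i) * real k ^ i))"
    proof -
      have "real (Suc k) ^ c = (\<Sum>i\<le>c. real (c choose i) * real k ^ i)" for k
        using binomial_ring[of "real k" 1 c] by (simp add: add.commute)
      then show ?thesis by (simp only: sum_distrib_left)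
    qed
    also have "\<dots> = real (Suc a) * (\<Sum>k\<le>a. \<Sum>i\<le>c. real (c choose i) * ((-1) ^ (a - k) * real (a choose k) * real k ^ i))"
      by (simp add: sum_distrib_left mult_ac)
    also have "\<dots> = real (Suc a) * (\<Sum>i\<le>c. real (c choose i) * (\<Sum>k\<le>a. (-1) ^ (a - k) * real (a choose k) * real k ^ i))"
      by (subst sum.swap) (simp add: sum_distrib_left)
    also have "\<dots> = real (Suc a) * (\<Sum>i\<le>c. real (c choose i) * (if i = a then fact a else 0))"
      using c by (intro arg_cong2[of _ _ _ _ "(*)"] refl sum.cong) (simp add: Suc.IH)
    also have "\<dots> = (if c = a then fact (Suc a) else 0)"
    proof -
      have "(\<Sum>i\<le>c. real (c choose i) * (if i = a then fact a else 0)) = (if c = a then fact a else 0)"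
      proof -
        have "(\<Sum>i\<le>c. real (c choose i) * (if i = a then fact a else 0)) = (\<Sum>i\<le>c. if i = a then real (c choose i) * fact a else 0)"
          by (rule sum.cong) auto
        also have "\<dots> = (if c = a then fact a else 0)" using c by (simp add: sum.delta)
        finally show ?thesis .
      qed
      then show ?thesis by (simp add: algebra_simps)
    qed
    finally show ?thesis using Suc by simp
  qed
qed simp

lemma sum_Pow_Un:
  assumes "A \<inter> B = {}"
  shows "(\<Sum>I\<in>Pow (A \<union> B). f I) = (\<Sum>I\<in>Pow A. \<Sum>J\<in>Pow B. f (I \<union> J))"
proof -
  have "(\<Sum>I\<in>Pow (A \<union> B). f I) = (\<Sum>(I, J)\<in>Pow A \<times> Pow B. f (I \<union> J))"
    by (rule sum.reindex_bij_witness[where i = "\<lambda>(I, J). I \<union> J" and j = "\<lambda>I. (I \<inter> A, I \<inter> B)"])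
       (use assms in \<open>auto simp: Int_Un_distrib[symmetric] Int_absorb2\<close>)
  then show ?thesis by (simp add: sum.cartesian_product)
qed

lemma sum_Pow_card:
  assumes "finite A"
  shows "(\<Sum>I\<in>Pow A. f (card I)) = (\<Sum>k\<le>card A. real (card A choose k) * f k)"
proof -
  have "(\<Sum>I\<in>Pow A. f (card I)) = (\<Sum>k\<le>card A. \<Sum>I\<in>{I \<in> Pow A. card I = k}. f (card I))"
    using assms by (intro sum.group[symmetric]) (auto intro: card_mono)
  also have "\<dots> = (\<Sum>k\<le>card A. real (card A choose k) * f k)"
    using assms by (intro sum.cong refl) (simp add: n_subsets)
  finally show ?thesis .
qed

text \<open>A subset of \<open>X\<close> is an independent choice of a subset of every block of
  \<open>\<iota>\<close>, and the sign is multiplicative over the blocks. Only the sizes of the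
  chosen parts enter, which produces the binomial coefficients.\<close>

lemma sum_Pow_blocks:
  fixes g :: "'i \<Rightarrow> nat \<Rightarrow> real"
  assumes "finite S" "finite X" "\<iota> ` X \<subseteq> S"
  shows "(\<Sum>I\<in>Pow X. (-1) ^ (card X - card I) * (\<Prod>i\<in>S. g i (card {j \<in> I. \<iota> j = i}))) =
    (\<Prod>i\<in>S. \<Sum>k\<le>card {j \<in> X. \<iota> j = i}. (-1) ^ (card {j \<in> X. \<iota> j = i} - k) * real (card {j \<in> X. \<iota> j = i} choose k) * g i k)"
  using assms
proof (induction S arbitrary: X rule: finite_induct)
  case empty
  then have "X = {}" by auto
  then show ?case by simp
next
  case (insert i S)
  define A where "A = {j \<in> X. \<iota> j = i}"
  define B where "B = {j \<in> X. \<iota> j \<noteq> i}"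
  have X: "X = A \<union> B" and AB: "A \<inter> B = {}" by (auto simp: A_def B_def)
  have fin: "finite A" "finite B" using insert.prems by (auto simp: A_def B_def)
  have B: "{j \<in> X. \<iota> j = i'} = {j \<in> B. \<iota> j = i'}" if "i' \<in> S" for i'
    using that insert.hyps by (auto simp: B_def)
  have "(-1) ^ (card X - card (I \<union> J)) * (\<Prod>i\<in>insert i S. g i (card {j \<in> I \<union> J. \<iota> j = i})) =
     ((-1) ^ (card A - card I) * g i (card I)) *
     ((-1) ^ (card B - card J) * (\<Prod>i\<in>S. g i (card {j \<in> J. \<iota> j = i})))"
    if I: "I \<in> Pow A" and J: "J \<in> Pow B" for I J
  proof -
    have fIJ: "finite I" "finite J" using fin I J by (auto intro: finite_subset)
    have "card X = card A + card B" unfolding X by (rule card_Un_disjoint[OF fin AB])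
    moreover have "card (I \<union> J) = card I + card J"
      using fIJ I J AB by (intro card_Un_disjoint) auto
    moreover have "card I \<le> card A" "card J \<le> card B"
      using I J fin by (auto intro: card_mono)
    ultimately have "card X - card (I \<union> J) = (card A - card I) + (card B - card J)" by simp
    moreover have "{j \<in> I \<union> J. \<iota> j = i} = I" using I J by (auto simp: A_def B_def)
    moreover have "{j \<in> I \<union> J. \<iota> j = i'} = {j \<in> J. \<iota> j = i'}" if "i' \<in> S" for i'
      using that I J insert.hyps by (auto simp: A_def B_def)
    ultimately show ?thesis using insert.hyps by (simp add: power_add)
  qed
  then have "(\<Sum>I\<in>Pow X. (-1) ^ (card X - card I) * (\<Prod>i\<in>insert i S. g i (card {j \<in> I. \<iota> j = i}))) =
     (\<Sum>I\<in>Pow A. \<Sum>J\<in>Pow B. ((-1) ^ (card A - card I) * g i (card I)) *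
     ((-1) ^ (card B - card J) * (\<Prod>i\<in>S. g i (card {j \<in> J. \<iota> j = i}))))"
    unfolding X sum_Pow_Un[OF AB] by (intro sum.cong refl) (simp add: X)
  also have "\<dots> = (\<Sum>I\<in>Pow A. (-1) ^ (card A - card I) * g i (card I)) *
     (\<Sum>J\<in>Pow B. (-1) ^ (card B - card J) * (\<Prod>i\<in>S. g i (card {j \<in> J. \<iota> j = i})))"
    by (simp add: sum_product)
  also have "(\<Sum>I\<in>Pow A. (-1) ^ (card A - card I) * g i (card I)) =
     (\<Sum>k\<le>card A. (-1) ^ (card A - k) * real (card A choose k) * g i k)"
    using sum_Pow_card[OF fin(1), of "\<lambda>k. (-1) ^ (card A - k) * g i k"] by (simp add: mult_ac)
  also have "(\<Sum>J\<in>Pow B. (-1) ^ (card B - card J) * (\<Prod>i\<in>S. g i (card {j \<in> J. \<iota> j = i}))) =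
    (\<Prod>i\<in>S. \<Sum>k\<le>card {j \<in> B. \<iota> j = i}. (-1) ^ (card {j \<in> B. \<iota> j = i} - k) * real (card {j \<in> B. \<iota> j = i} choose k) * g i k)"
    using insert.prems fin by (intro insert.IH) (auto simp: B_def)
  finally show ?case
    using insert.hyps by (simp add: A_def[symmetric] B)
qed

text \<open>The polarization identity, applied to each monomial separately.\<close>

lemma polarization:
  fixes P :: "(nat, real) mpoly"
  assumes P: "\<forall>\<beta>\<in>keys P. keys \<beta> \<subseteq> {..s}"
    and \<alpha>: "keys \<alpha> \<subseteq> {..s}" "weight s \<alpha> = r"
    and \<iota>: "\<And>j. j < r \<Longrightarrow> \<iota> j \<le> s" "\<And>i. i \<le> s \<Longrightarrow> card {j \<in> {..<r}. \<iota> j = i} = lookup \<alpha> i"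
  shows "(\<Sum>I\<in>Pow {..<r}. (-1) ^ (r - card I) * leading_form s r P (\<lambda>i. card {j \<in> I. \<iota> j = i})) =
    (\<Prod>i\<le>s. fact (lookup \<alpha> i)) * lookup P \<alpha>"
proof -
  let ?K = "{\<beta> \<in> keys P. weight s \<beta> = r}"
  let ?D = "\<lambda>\<beta>. \<Prod>i\<le>s. \<Sum>k\<le>lookup \<alpha> i. (-1) ^ (lookup \<alpha> i - k) *
      real (lookup \<alpha> i choose k) * real k ^ lookup \<beta> i"
  have blocks: "(\<Sum>I\<in>Pow {..<r}. (-1) ^ (r - card I) * monomial_value s \<beta> (\<lambda>i. card {j \<in> I. \<iota> j = i})) = ?D \<beta>" for \<beta>
  proof -
    have "\<iota> ` {..<r} \<subseteq> {..s}" using \<iota>(1) by auto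
    from sum_Pow_blocks[OF _ _ this, of "\<lambda>i k. real k ^ lookup \<beta> i"]
    have "(\<Sum>I\<in>Pow {..<r}. (-1) ^ (r - card I) * monomial_value s \<beta> (\<lambda>i. card {j \<in> I. \<iota> j = i})) =
      (\<Prod>i\<le>s. \<Sum>k\<le>card {j \<in> {..<r}. \<iota> j = i}. (-1) ^ (card {j \<in> {..<r}. \<iota> j = i} - k) *
        real (card {j \<in> {..<r}. \<iota> j = i} choose k) * real k ^ lookup \<beta> i)"
      by (simp only: card_lessThan finite_atMost finite_lessThan)
    also have "\<dots> = ?D \<beta>"
      by (intro prod.cong refl) (simp only: \<iota>(2) atMost_iff)
    finally show ?thesis .
  qed
  have D_other: "?D \<beta> = 0" if "\<beta> \<in> ?K" "\<beta> \<noteq> \<alpha>" for \<beta>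
  proof -
    \<comment> \<open>Two different exponents of the same weight cannot satisfy \<alpha> \<le>
      \<beta> in every coordinate. In the coordinate found here the order of the finite difference
      exceeds the power, so that factor of \<open>?D\<close> is 0.\<close>
    have "\<exists>i\<le>s. lookup \<beta> i < lookup \<alpha> i"
    proof (rule ccontr)
      assume "\<not> ?thesis"
      then have le: "\<forall>i\<in>{..s}. lookup \<alpha> i \<le> lookup \<beta> i" by auto
      have "\<exists>i. lookup \<beta> i \<noteq> lookup \<alpha> i"
        using that(2) poly_mapping_eqI[of \<beta> \<alpha>] by auto
      then obtain i where i: "lookup \<beta> i \<noteq> lookup \<alpha> i" by blast
      then have "i \<in> keys \<beta> \<or> i \<in> keys \<alpha>" by (auto simp: in_keys_iff)
      then have "i \<le> s" using that(1) P \<alpha>(1) by auto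
      then have "(\<Sum>i\<le>s. lookup \<alpha> i) < (\<Sum>i\<le>s. lookup \<beta> i)"
        using le i by (intro sum_strict_mono_ex1) (auto intro!: bexI[of _ i] simp: nat_less_le)
      then show False using that(1) \<alpha>(2) by (auto simp: weight_def)
    qed
    then obtain i where "i \<le> s" "lookup \<beta> i < lookup \<alpha> i" by blast
    then show ?thesis
      by (intro prod_zero) (auto intro!: bexI[of _ i] simp: alternating_binomial_power_sum)
  qed
  have D_same: "?D \<alpha> = (\<Prod>i\<le>s. fact (lookup \<alpha> i))"
    by (simp add: alternating_binomial_power_sum)
  have "(\<Sum>I\<in>Pow {..<r}. (-1) ^ (r - card I) * leading_form s r P (\<lambda>i. card {j \<in> I. \<iota> j = i})) =
     (\<Sum>I\<in>Pow {..<r}. \<Sum>\<beta>\<in>?K. lookup P \<beta> * ((-1) ^ (r - card I) *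
        monomial_value s \<beta> (\<lambda>i. card {j \<in> I. \<iota> j = i})))"
    unfolding leading_form_def by (simp add: sum_distrib_left mult_ac)
  also have "\<dots> = (\<Sum>\<beta>\<in>?K. lookup P \<beta> * ?D \<beta>)"
    by (subst sum.swap) (simp only: sum_distrib_left[symmetric] blocks)
  also have "\<dots> = (\<Sum>\<beta>\<in>?K. if \<beta> = \<alpha> then lookup P \<alpha> * ?D \<alpha> else 0)"
    using D_other by (intro sum.cong refl) auto
  also have "\<dots> = lookup P \<alpha> * ?D \<alpha>"
    using \<alpha>(2) by (subst sum.delta) (auto simp: in_keys_iff)
  also have "\<dots> = (\<Prod>i\<le>s. fact (lookup \<alpha> i)) * lookup P \<alpha>"
    unfolding D_same by (rule mult.commute)
  finally show ?thesis .
qed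

section \<open>Labelling of list positions and uniqueness of the Hilbert polynomial\<close>

lemma length_repeated: "length (repeated s \<alpha> Q) = weight s \<alpha>"
  by (simp add: repeated_def weight_def length_concat sum_list_distinct_conv_sum_set comp_def
      atLeast0LessThan lessThan_Suc_atMost del: upt_Suc)

text \<open>For \<open>id\<close> the list consists of the indices themselves: it records the block
  of each position and supplies the labelling \<open>\<iota>\<close> required by
  \<open>polarization\<close>.\<close>

lemma repeated_eq_map: "repeated s \<alpha> Q = map Q (repeated s \<alpha> id)"
  by (simp add: repeated_def map_concat comp_def)

lemma card_repeated:
  assumes "i \<le> s"
  shows "card {j \<in> {..<weight s \<alpha>}. repeated s \<alpha> id ! j = i} = lookup \<alpha> i"
proof -
  have "card {j \<in> {..<weight s \<alpha>}. repeated s \<alpha> id ! j = i} = length (filter (\<lambda>x. x = i) (repeated s \<alpha> id))"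
    by (simp add: length_filter_conv_card length_repeated)
  also have "\<dots> = (\<Sum>k\<le>s. if k = i then lookup \<alpha> i else 0)"
    by (simp add: repeated_def filter_concat length_concat sum_list_distinct_conv_sum_set comp_def
        atLeast0LessThan lessThan_Suc_atMost filter_replicate if_distrib cong: if_cong del: upt_Suc)
  finally show ?thesis using assms by simp
qed

lemma repeated_nth_le:
  assumes "j < weight s \<alpha>"
  shows "repeated s \<alpha> id ! j \<le> s"
proof -
  have "repeated s \<alpha> id ! j \<in> set (repeated s \<alpha> id)" using assms by (simp add: length_repeated)
  then show ?thesis by (auto simp: repeated_def)
qed

text \<open>Polarization expresses every coefficient of the form through its values at natural
  points, so vanishing values leave no monomial of weight \<open>r\<close>.\<close>

lemma leading_form_zero_imp:
  assumes "\<forall>\<beta>\<in>keys P. keys \<beta> \<subseteq> {..s}"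
    and "\<And>u. leading_form s r P u = 0"
    and "\<beta> \<in> keys P"
  shows "weight s \<beta> \<noteq> r"
proof
  assume r: "weight s \<beta> = r"
  have "(\<Prod>i\<le>s. fact (lookup \<beta> i)) * lookup P \<beta> = 0"
    using assms r card_repeated repeated_nth_le
    by (subst polarization[OF assms(1) _ r, of "\<lambda>j. repeated s \<beta> id ! j", symmetric]) auto
  then show False using assms(3) by (simp add: in_keys_iff)
qed

text \<open>The difference of two candidates vanishes wherever all coordinates are large. Along rays
  in that region its top form is a limit of zeros, which contradicts the choice of the top
  weight.\<close>

lemma hilbert_polynomial_unique:
  assumes "is_hilbert_polynomial s H P" "is_hilbert_polynomial s H Q"
  shows "P = Q"
proof (rule ccontr)
  assume ne: "P \<noteq> Q"
  define D where "D = P - Q"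
  obtain N N' where P: "\<forall>\<beta>\<in>keys P. keys \<beta> \<subseteq> {..s}"
      "\<And>u. (\<forall>i\<le>s. N \<le> u i) \<Longrightarrow> ereal_of_enat (H u) = ereal (eval_poly P u)"
    and Q: "\<forall>\<beta>\<in>keys Q. keys \<beta> \<subseteq> {..s}"
      "\<And>u. (\<forall>i\<le>s. N' \<le> u i) \<Longrightarrow> ereal_of_enat (H u) = ereal (eval_poly Q u)"
    using assms unfolding is_hilbert_polynomial_def by auto
  have kD: "keys D \<subseteq> keys P \<union> keys Q"
    unfolding D_def by (auto simp: in_keys_iff lookup_minus)
  have D: "\<forall>\<beta>\<in>keys D. keys \<beta> \<subseteq> {..s}" using kD P(1) Q(1) by blast
  let ?B = "keys P \<union> keys Q"
  have evD: "eval_poly D u = eval_poly P u - eval_poly Q u" for u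
    using P(1) Q(1) kD by (simp add: eval_poly_eq_sum[of ?B _ s] ball_Un D_def lookup_minus left_diff_distrib sum_subtractf)
  define r where "r = Max (weight s ` keys D)"
  have neD: "keys D \<noteq> {}" using ne by (simp add: D_def)
  have w: "weight s \<beta> \<le> r" if "\<beta> \<in> keys D" for \<beta>
    unfolding r_def using that by (intro Max_ge) auto
  have "r \<in> weight s ` keys D" unfolding r_def using neD by (intro Max_in) auto
  then obtain \<alpha> where \<alpha>: "\<alpha> \<in> keys D" "weight s \<alpha> = r" by blast
  have "leading_form s r D u = 0" for u
  proof -
    \<comment> \<open>The offset \<open>max N N'\<close> keeps the whole ray in the region where
      both candidates give the Hilbert function, whatever \<open>u\<close> is.\<close>
    have "(\<lambda>t. eval_poly D (\<lambda>i. t * u i + max N N') / real t ^ r) \<longlonglongrightarrow> leading_form s r D u"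
      using D w by (intro tendsto_leading_form) auto
    moreover have "eval_poly D (\<lambda>i. t * u i + max N N') = 0" for t
    proof -
      have "ereal (eval_poly P (\<lambda>i. t * u i + max N N')) = ereal (eval_poly Q (\<lambda>i. t * u i + max N N'))"
        by (subst P(2)[symmetric], intro allI impI trans_le_add2, simp, rule Q(2), intro allI impI trans_le_add2, simp)
      then show ?thesis by (simp add: evD)
    qed
    ultimately show ?thesis by (simp add: LIMSEQ_const_iff)
  qed
  from leading_form_zero_imp[OF D this \<alpha>(1)] \<alpha>(2) show False by simp
qed

section \<open>Lengths of quotients of monomial ideals\<close>

lemma module_mult: "module ((*) :: 'a::comm_ring_1 \<Rightarrow> 'a \<Rightarrow> 'a)"
  by standard (simp_all add: algebra_simps)

lemmas ideal_gen_base = module.span_base[OF module_mult, folded ideal_gen_def]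
  and ideal_gen_zero = module.span_zero[OF module_mult, folded ideal_gen_def]
  and ideal_gen_add = module.span_add[OF module_mult, folded ideal_gen_def]
  and ideal_gen_diff = module.span_diff[OF module_mult, folded ideal_gen_def]
  and ideal_gen_mult = module.span_scale[OF module_mult, folded ideal_gen_def]
  and ideal_gen_mono = module.span_mono[OF module_mult, folded ideal_gen_def]
  and ideal_gen_sum = module.span_sum[OF module_mult, folded ideal_gen_def]

lemma ideal_gen_minimal:
  assumes "S \<subseteq> T" "0 \<in> T" "\<And>x y. x \<in> T \<Longrightarrow> y \<in> T \<Longrightarrow> x + y \<in> T" "\<And>r x. x \<in> T \<Longrightarrow> r * x \<in> T"
  shows "ideal_gen S \<subseteq> T"
  unfolding ideal_gen_def
  by (rule module.span_minimal[OF module_mult]) (use assms in \<open>auto simp: module.subspace_def[OF module_mult]\<close>)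

text \<open>The elements that multiply \<open>B\<close> into the ideal generated by
  \<open>A * B\<close> form an ideal, and this ideal contains \<open>A\<close>.\<close>

lemma ideal_gen_times_ideal_gen_left: "ideal_gen (ideal_gen A * B) = ideal_gen (A * B)"
proof
  show "ideal_gen (A * B) \<subseteq> ideal_gen (ideal_gen A * B)"
    by (intro ideal_gen_mono set_times_mono2) (auto intro: ideal_gen_base)
  have "ideal_gen A \<subseteq> {a. \<forall>b\<in>B. a * b \<in> ideal_gen (A * B)}"
    by (rule ideal_gen_minimal)
      (auto simp: distrib_right mult.assoc intro: ideal_gen_base ideal_gen_zero ideal_gen_add ideal_gen_mult set_times_intro)
  then have "ideal_gen A * B \<subseteq> ideal_gen (A * B)" by (auto elim!: set_times_elim)
  then show "ideal_gen (ideal_gen A * B) \<subseteq> ideal_gen (A * B)"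
    by (rule ideal_gen_minimal) (auto intro: ideal_gen_zero ideal_gen_add ideal_gen_mult)
qed

text \<open>One factor is replaced at a time while the others are moved into \<open>B\<close>, which
  is why \<open>B\<close> has to stay arbitrary in the induction.\<close>

lemma ideal_gen_power_times: "ideal_gen (ideal_gen A ^ k * B) = ideal_gen (A ^ k * B)"
proof (induction k arbitrary: B)
  case (Suc k)
  have "ideal_gen (ideal_gen A ^ Suc k * B) = ideal_gen (ideal_gen A * (ideal_gen A ^ k * B))"
    by (simp add: mult.assoc)
  also have "\<dots> = ideal_gen (ideal_gen A ^ k * (A * B))"
    by (simp add: ideal_gen_times_ideal_gen_left mult.left_commute)
  also have "\<dots> = ideal_gen (A ^ Suc k * B)"
    unfolding Suc by (simp add: mult_ac)
  finally show ?case .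
qed simp

lemma ideal_gen_prod_power_times:
  "ideal_gen ((\<Prod>i\<in>S. ideal_gen (A i) ^ k i) * B) = ideal_gen ((\<Prod>i\<in>S. A i ^ k i) * B)"
proof (induction S arbitrary: B rule: infinite_finite_induct)
  case (insert x S)
  have "ideal_gen ((\<Prod>i\<in>insert x S. ideal_gen (A i) ^ k i) * B) =
      ideal_gen (ideal_gen (A x) ^ k x * ((\<Prod>i\<in>S. ideal_gen (A i) ^ k i) * B))"
    using insert.hyps by (simp add: mult.assoc)
  also have "\<dots> = ideal_gen ((\<Prod>i\<in>S. ideal_gen (A i) ^ k i) * (A x ^ k x * B))"
    by (simp add: ideal_gen_power_times mult.left_commute)
  also have "\<dots> = ideal_gen ((\<Prod>i\<in>insert x S. A i ^ k i) * B)"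
    unfolding insert.IH using insert.hyps by (simp add: mult_ac)
  finally show ?case .
qed simp_all

lemma power_product_ideal_gen:
  assumes "m = ideal_gen (A 0)" "\<And>i. i \<in> {1..s} \<Longrightarrow> J i = ideal_gen (A i)"
  shows "power_product m J s a u = ideal_gen (\<Prod>i\<le>s. A i ^ (u(0 := a)) i)"
proof -
  have s: "{..s} = insert 0 {1..s}" by auto
  have "m ^ a * (\<Prod>i=1..s. J i ^ u i) = (\<Prod>i\<le>s. ideal_gen (A i) ^ (u(0 := a)) i)"
    unfolding s using assms by (subst prod.insert) (auto intro!: prod.cong arg_cong2[of _ _ _ _ "(*)"])
  then show ?thesis
    unfolding power_product_def using ideal_gen_prod_power_times[of A "u(0 := a)" "{..s}" 1]
    by (simp only: mult_1_right)
qed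

lemma monomial_mult: "monomial a * monomial b = monomial (a + b)"
  by (simp add: monomial_def mult_single)

lemma monomial_image_plus: "monomial ` (A + B) = monomial ` A * monomial ` B"
  by (force simp: monomial_mult[symmetric] set_plus_def set_times_def)

lemma monomial_degree_add: "monomial_degree (a + b) = monomial_degree a + monomial_degree b"
  by (simp add: monomial_degree_def lookup_add sum.distrib)

lemma monomial_degree_eq_0_iff: "monomial_degree a = 0 \<longleftrightarrow> a = 0"
  by (auto simp: monomial_degree_def intro: poly_mapping_eqI)

lemma monomial_degree_single: "monomial_degree (single x k) = k"
  by (simp add: monomial_degree_def lookup_single when_def sum.delta)

lemma mem_ideal_gen_monomials:
  fixes p :: "('x, 'k::comm_ring_1) mpoly"
  shows "p \<in> ideal_gen (monomial ` S) \<longleftrightarrow> (\<forall>f\<in>keys p. \<exists>e\<in>S. \<exists>g. f = g + e)"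
proof
  let ?T = "{p :: ('x, 'k) mpoly. \<forall>f\<in>keys p. \<exists>e\<in>S. \<exists>g. f = g + e}"
  have "ideal_gen (monomial ` S) \<subseteq> ?T"
  proof (rule ideal_gen_minimal)
    show "monomial ` S \<subseteq> ?T"
      by (auto simp: monomial_def) (metis add_0)
  next
    fix x y assume "x \<in> ?T" "y \<in> ?T"
    then show "x + y \<in> ?T" using keys_add[of x y] by blast
  next
    fix r x :: "('x, 'k) mpoly" assume x: "x \<in> ?T"
    have "\<exists>e\<in>S. \<exists>g. f = g + e" if "f \<in> keys (r * x)" for f
    proof -
      obtain a b where "f = a + b" "b \<in> keys x"
        using \<open>f \<in> keys (r * x)\<close> keys_mult[of r x] by blast
      moreover obtain e g where "e \<in> S" "b = g + e" using x calculation(2) by blast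
      ultimately have "f = (a + g) + e" by (simp add: add.assoc)
      then show ?thesis using \<open>e \<in> S\<close> by blast
    qed
    then show "r * x \<in> ?T" by blast
  qed simp
  then show "p \<in> ideal_gen (monomial ` S) \<Longrightarrow> \<forall>f\<in>keys p. \<exists>e\<in>S. \<exists>g. f = g + e" by blast
next
  assume *: "\<forall>f\<in>keys p. \<exists>e\<in>S. \<exists>g. f = g + e"
  have "p = (\<Sum>f\<in>keys p. single f (lookup p f))"
    by (rule poly_mapping_eqI) (auto simp: lookup_sum lookup_single when_def in_keys_iff sum.delta)
  also have "\<dots> \<in> ideal_gen (monomial ` S)"
  proof (rule ideal_gen_sum)
    fix f assume "f \<in> keys p"
    then obtain e g where e: "e \<in> S" "f = g + e" using * by blast
    have "single f (lookup p f) = single g (lookup p f) * monomial e"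
      by (simp add: monomial_def mult_single e)
    also have "\<dots> \<in> ideal_gen (monomial ` S)"
      by (intro ideal_gen_mult ideal_gen_base) (use e in auto)
    finally show "single f (lookup p f) \<in> ideal_gen (monomial ` S)" .
  qed
  finally show "p \<in> ideal_gen (monomial ` S)" .
qed

lemma coset_eq_iff:
  fixes x y :: "'a::comm_ring_1"
  shows "x +o ideal_gen S = y +o ideal_gen S \<longleftrightarrow> x - y \<in> ideal_gen S"
proof
  assume "x +o ideal_gen S = y +o ideal_gen S"
  moreover have "x \<in> x +o ideal_gen S" using ideal_gen_zero[of S] by (force simp: elt_set_plus_def)
  ultimately obtain z where "z \<in> ideal_gen S" "x = y + z" by (auto simp: elt_set_plus_def)
  then show "x - y \<in> ideal_gen S" by simp
next
  assume *: "x - y \<in> ideal_gen S"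
  have "x + z = y + (x - y + z)" "y + z = x + (z - (x - y))" for z by simp_all
  then show "x +o ideal_gen S = y +o ideal_gen S"
    using * ideal_gen_add[of "x - y" S] ideal_gen_diff[of _ S "x - y"]
    unfolding elt_set_plus_def by blast
qed

lemma coset_add:
  fixes x y :: "'a::comm_ring_1"
  shows "(x +o ideal_gen S) + (y +o ideal_gen S) = (x + y) +o ideal_gen S"
proof -
  have "ideal_gen S + ideal_gen S = ideal_gen S"
    by (auto elim!: set_plus_elim intro: ideal_gen_add)
       (metis add.right_neutral ideal_gen_zero set_plus_intro)
  then show ?thesis by (simp add: set_plus_rearrange)
qed

lemma coset_scale:
  fixes r x :: "'a::comm_ring_1"
  shows "r *o (x +o ideal_gen S) + ideal_gen S = (r * x) +o ideal_gen S"
proof (intro equalityI subsetI)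
  fix z assume "z \<in> r *o (x +o ideal_gen S) + ideal_gen S"
  then obtain a b where "z = r * (x + a) + b" "a \<in> ideal_gen S" "b \<in> ideal_gen S"
    by (auto simp: set_plus_def elt_set_plus_def elt_set_times_def)
  then have "z = r * x + (r * a + b)" "r * a + b \<in> ideal_gen S"
    by (simp_all add: distrib_left add.assoc ideal_gen_add ideal_gen_mult)
  then show "z \<in> (r * x) +o ideal_gen S" by (auto simp: elt_set_plus_def)
next
  fix z assume "z \<in> (r * x) +o ideal_gen S"
  then obtain b where "z = r * (x + 0) + b" "b \<in> ideal_gen S" by (auto simp: elt_set_plus_def)
  then show "z \<in> r *o (x +o ideal_gen S) + ideal_gen S"
    using ideal_gen_zero[of S] unfolding set_plus_def elt_set_plus_def elt_set_times_def by blast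
qed

lemma zero_not_in_variables: "(0 :: 'x \<Rightarrow>\<^sub>0 nat) \<notin> variables"
proof
  assume "(0 :: 'x \<Rightarrow>\<^sub>0 nat) \<in> variables"
  then obtain x :: 'x where "single x (1::nat) = 0" by (auto simp: variables_def)
  then have "lookup (single x (1::nat)) x = 0" by simp
  then show False by simp
qed

text \<open>Multiplication by constants turns submodules into subspaces, so that linear independence
  can bound the length of chains.\<close>

lemma vector_space_mpoly: "vector_space (\<lambda>(c::'k::field) (p::('x, 'k) mpoly). single 0 c * p)"
  by standard (simp_all add: algebra_simps single_add mult_single flip: mult.assoc)

text \<open>Every monomial in the smaller ideal has degree greater than \<open>D\<close>, so
  \<open>E\<close> maps to a basis of the quotient as a vector space over the field. A strict chain
  of submodules yields linearly independent vectors in the span of \<open>E\<close>, which bounds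
  its length; adjoining the monomials of \<open>E\<close> one by one attains the bound.\<close>

lemma quotient_length_monomials:
  fixes E :: "('n::finite \<Rightarrow>\<^sub>0 nat) set"
  assumes fin: "finite E" and deg: "\<And>e. e \<in> E \<Longrightarrow> monomial_degree e = D"
  shows "quotient_length (ideal_gen (monomial ` E) :: ('n, 'k::field) mpoly set)
    (ideal_gen (monomial ` (variables + E))) = enat (card E)"
proof -
  let ?I = "ideal_gen (monomial ` E) :: ('n, 'k) mpoly set"
  let ?S = "monomial ` (variables + E) :: ('n, 'k) mpoly set"
  let ?N = "ideal_gen ?S"
  let ?q = "\<lambda>p. p +o ?N"
  let ?sm = "quotient_submodule ?I ?N"
  interpret vs: vector_space "\<lambda>(c::'k) (p::('n, 'k) mpoly). single 0 c * p"
    by (rule vector_space_mpoly)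
  have N_lookup: "lookup p e = 0" if "p \<in> ?N" "e \<in> E" for p e
  proof (rule ccontr)
    assume "lookup p e \<noteq> 0"
    then have "\<exists>e'\<in>variables + E. \<exists>g. e = g + e'"
      using that(1)[unfolded mem_ideal_gen_monomials] by (simp add: in_keys_iff)
    then obtain e' g where e': "e' \<in> variables + E" "e = g + e'" by blast
    then obtain x e'' where "e' = x + e''" "e'' \<in> E" "x \<in> variables" by (auto elim: set_plus_elim)
    then have "monomial_degree e = monomial_degree g + (monomial_degree x + D)" "x \<noteq> 0"
      using zero_not_in_variables by (auto simp: e' deg monomial_degree_add)
    then show False using deg[OF that(2)] by (simp add: monomial_degree_eq_0_iff)
  qed
  \<comment> \<open>The part of \<open>p\<close> supported on \<open>E\<close> is a representative
    modulo \<open>?N\<close> lying in a space spanned by \<open>card E\<close> vectors, which is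
    what bounds the number of independent vectors below.\<close>
  define res where "res = (\<lambda>p :: ('n, 'k) mpoly. \<Sum>e\<in>E. single e (lookup p e))"
  have lookup_res: "lookup (res p) f = (if f \<in> E then lookup p f else 0)" for p f
    using fin by (simp add: res_def lookup_sum lookup_single when_def sum.delta)
  have res_N: "p - res p \<in> ?N" if p: "p \<in> ?I" for p
    unfolding mem_ideal_gen_monomials
  proof
    fix f assume "f \<in> keys (p - res p)"
    then have f: "f \<in> keys p" "f \<notin> E"
      by (auto simp: in_keys_iff lookup_minus lookup_res split: if_splits)
    obtain e g where e: "e \<in> E" "f = g + e"
      using p[unfolded mem_ideal_gen_monomials, rule_format, OF f(1)] by blast
    then have "g \<noteq> 0" using f by auto
    then obtain x where x: "lookup g x \<noteq> 0" using poly_mapping_eqI[of g 0] by auto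
    let ?x = "single x (1::nat)"
    have "g = (g - ?x) + ?x"
      by (rule poly_mapping_eqI) (use x in \<open>auto simp: lookup_add lookup_minus lookup_single when_def\<close>)
    then have "f = (g - ?x) + (?x + e)" using e by (simp add: add.assoc[symmetric])
    moreover have "?x + e \<in> variables + E" using e by (auto simp: variables_def)
    ultimately show "\<exists>e\<in>variables + E. \<exists>g. f = g + e" by blast
  qed
  have res_span: "res p \<in> vs.span (monomial ` E)" for p
    unfolding res_def
  proof (rule vs.span_sum)
    fix e assume "e \<in> E"
    have "single e (lookup p e) = single 0 (lookup p e) * monomial e"
      by (simp add: monomial_def mult_single)
    also have "\<dots> \<in> vs.span (monomial ` E)"
      by (intro vs.span_scale vs.span_base) (use \<open>e \<in> E\<close> in auto)
    finally show "single e (lookup p e) \<in> vs.span (monomial ` E)" .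
  qed
  have upper: "l \<le> card E"
    if C: "\<forall>i\<le>l. ?sm (C i)" and strict: "\<forall>i<l. C i \<subset> C (Suc i)" for l C
  proof -
    have "\<exists>w. ?q (res w) \<in> C (Suc i) - C i" if i: "i < l" for i
    proof -
      obtain X where X: "X \<in> C (Suc i)" "X \<notin> C i" using strict i by blast
      have "?sm (C (Suc i))" using C i by simp
      then obtain v where v: "v \<in> ?I" "X = ?q v"
        using X(1) by (auto simp: quotient_submodule_def ideal_quotient_def)
      have "?q v = ?q (res v)" using res_N[OF v(1)] by (simp add: coset_eq_iff)
      then show ?thesis using X v by (intro exI[of _ v]) simp
    qed
    then have "\<forall>i. \<exists>w. i < l \<longrightarrow> ?q (res w) \<in> C (Suc i) - C i" by blast
    then obtain w where "\<forall>i. i < l \<longrightarrow> ?q (res (w i)) \<in> C (Suc i) - C i"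
      by (rule choice[THEN exE])
    then have w: "\<And>i. i < l \<Longrightarrow> ?q (res (w i)) \<in> C (Suc i) - C i" by blast
    define v where "v = (\<lambda>i. res (w i))"
    \<comment> \<open>The preimage of the chain in the polynomial ring; each \<open>v j\<close> lies
      in the next subspace and outside the present one, hence outside the span of its
      predecessors.\<close>
    define W where "W = (\<lambda>i. {p. ?q p \<in> C i})"
    have sub: "vs.subspace (W i)" if i: "i \<le> l" for i
    proof -
      have sm: "?sm (C i)" using C i by simp
      have "0 \<in> W i" using sm by (simp add: W_def quotient_submodule_def)
      moreover have "x + y \<in> W i" if "x \<in> W i" "y \<in> W i" for x y
        using sm that unfolding W_def quotient_submodule_def mem_Collect_eq coset_add[symmetric] by blast
      moreover have "r * x \<in> W i" if "x \<in> W i" for r x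
        using sm that unfolding W_def quotient_submodule_def mem_Collect_eq coset_scale[symmetric] by blast
      ultimately show ?thesis by (simp add: vs.subspace_def)
    qed
    have "vs.independent (v ` {..<j}) \<and> card (v ` {..<j}) = j \<and> v ` {..<j} \<subseteq> W j" if "j \<le> l" for j
      using that
    proof (induction j)
      case (Suc j)
      then have IH: "vs.independent (v ` {..<j})" "card (v ` {..<j}) = j" "v ` {..<j} \<subseteq> W j" by auto
      have vj: "v j \<in> W (Suc j)" "v j \<notin> W j" using w[of j] Suc.prems by (auto simp: W_def v_def)
      have "vs.span (v ` {..<j}) \<subseteq> W j" using IH(3) sub Suc.prems by (intro vs.span_minimal) auto
      then have nin: "v j \<notin> vs.span (v ` {..<j})" using vj by blast
      then have "vs.independent (insert (v j) (v ` {..<j}))" using IH(1) by (rule vs.independent_insertI)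
      moreover have "v j \<notin> v ` {..<j}" using nin vs.span_base[of "v j" "v ` {..<j}"] by blast
      moreover have "C j \<subseteq> C (Suc j)" using strict Suc.prems by (simp add: psubset_imp_subset)
      then have "W j \<subseteq> W (Suc j)" by (auto simp: W_def)
      ultimately show ?case using IH vj by (auto simp: lessThan_Suc)
    qed (simp add: vs.independent_empty)
    from this[of l] have "vs.independent (v ` {..<l})" "card (v ` {..<l}) = l" by auto
    moreover have "v ` {..<l} \<subseteq> vs.span (monomial ` E)" using res_span by (auto simp: v_def)
    ultimately have "l \<le> card (monomial ` E :: ('n, 'k) mpoly set)"
      using vs.independent_span_bound[of "monomial ` E" "v ` {..<l}"] fin by auto
    also have "\<dots> \<le> card E" by (rule card_image_le[OF fin])
    finally show ?thesis .
  qed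
  obtain e where e: "bij_betw e {..<card E} E"
    using ex_bij_betw_nat_finite[OF fin] by (auto simp: atLeast0LessThan)
  define C where "C = (\<lambda>j. ?q ` ideal_gen (monomial ` e ` {..<j}))"
  have C_sm: "?sm (C j)" if "j \<le> card E" for j
  proof -
    let ?K = "ideal_gen (monomial ` e ` {..<j}) :: ('n, 'k) mpoly set"
    have "?K \<subseteq> ?I" using e that by (intro ideal_gen_mono image_mono) (auto simp: bij_betw_def)
    then have "C j \<subseteq> ideal_quotient ?I ?N" by (auto simp: C_def ideal_quotient_def)
    moreover have "?N \<in> C j" unfolding C_def by (rule image_eqI[of _ _ 0]) (auto intro: ideal_gen_zero)
    moreover have "X + Y \<in> C j" if "X \<in> C j" "Y \<in> C j" for X Y
      using that by (auto simp: C_def coset_add intro!: imageI ideal_gen_add)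
    moreover have "r *o X + ?N \<in> C j" if "X \<in> C j" for r X
      using that by (auto simp: C_def coset_scale intro!: imageI ideal_gen_mult)
    ultimately show ?thesis by (simp add: quotient_submodule_def)
  qed
  have C_strict: "C j \<subset> C (Suc j)" if j: "j < card E" for j
    unfolding less_le_not_le
  proof
    have "ideal_gen (monomial ` e ` {..<j}) \<subseteq> (ideal_gen (monomial ` e ` {..<Suc j}) :: ('n, 'k) mpoly set)"
      by (intro ideal_gen_mono image_mono) auto
    then show "C j \<subseteq> C (Suc j)" unfolding C_def by (rule image_mono)
    have ej: "e j \<in> E" using e j by (auto simp: bij_betw_def)
    have "?q (monomial (e j)) \<in> C (Suc j)"
      unfolding C_def by (intro imageI ideal_gen_base) auto
    moreover have "?q (monomial (e j)) \<notin> C j"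
    proof
      assume "?q (monomial (e j)) \<in> C j"
      then obtain p where p: "p \<in> ideal_gen (monomial ` e ` {..<j})" "monomial (e j) - p \<in> ?N"
        by (auto simp: C_def coset_eq_iff)
      from N_lookup[OF p(2) ej] have "lookup p (e j) = 1"
        by (simp add: lookup_minus monomial_def)
      then have "e j \<in> keys p" by (simp add: in_keys_iff)
      then obtain i g where i: "i < j" "e j = g + e i"
        using bspec[OF p(1)[unfolded mem_ideal_gen_monomials], of "e j"] by auto
      \<comment> \<open>Divisibility between two monomials of the same degree is equality, so no
        monomial of \<open>E\<close> lies in the ideal of the earlier ones.\<close>
      have "e i \<in> E" using e i j by (auto simp: bij_betw_def)
      then have "monomial_degree g = 0" using i deg[of "e i"] deg[OF ej] by (simp add: monomial_degree_add)
      then have "e j = e i" using i by (simp add: monomial_degree_eq_0_iff)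
      then show False using inj_onD[OF bij_betw_imp_inj_on[OF e], of j i] i j by auto
    qed
    ultimately show "\<not> C (Suc j) \<subseteq> C j" by blast
  qed
  show ?thesis
    unfolding quotient_length_def
  proof (rule antisym)
    show "Sup {enat l |l. \<exists>C. (\<forall>i\<le>l. ?sm (C i)) \<and> (\<forall>i<l. C i \<subset> C (Suc i))} \<le> enat (card E)"
      by (rule Sup_least) (use upper in auto)
    show "enat (card E) \<le> Sup {enat l |l. \<exists>C. (\<forall>i\<le>l. ?sm (C i)) \<and> (\<forall>i<l. C i \<subset> C (Suc i))}"
      by (rule Sup_upper) (use C_sm C_strict in blast)
  qed
qed

section \<open>Sumsets of exponents and the Hilbert function\<close>

lemma nat_tuple_induct [case_names zero Suc]:
  fixes u :: "nat \<Rightarrow> nat"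
  assumes zero: "\<And>u. (\<And>i. i \<le> s \<Longrightarrow> u i = 0) \<Longrightarrow> P u"
    and Suc: "\<And>u i. i \<le> s \<Longrightarrow> P u \<Longrightarrow> P (u(i := Suc (u i)))"
  shows "P u"
proof (induction "\<Sum>i\<le>s. u i" arbitrary: u)
  case 0
  then show ?case by (intro zero) simp
next
  case (Suc n)
  have "(\<Sum>i\<le>s. u i) \<noteq> 0" unfolding Suc(2)[symmetric] by simp
  then obtain i where i: "i \<le> s" "u i \<noteq> 0"
    by (rule sum.not_neutral_contains_not_neutral) simp
  define v where "v = u(i := u i - 1)"
  have u: "u = v(i := Suc (v i))" using i by (auto simp: v_def)
  have "(\<Sum>j\<le>s. u j) = (\<Sum>j\<le>s. v j + (if j = i then 1 else 0))" by (rule sum.cong) (auto simp: u)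
  then have "n = (\<Sum>j\<le>s. v j)" using i Suc(2) by (simp add: sum.distrib)
  then show ?case unfolding u by (intro assms(2) i Suc(1))
qed

text \<open>On exponents, the substitution of the monomial \<open>\<xi> x\<close> for the variable
  \<open>x\<close>. Taking a plain function \<open>y\<close> allows rounded real coefficients to be
  inserted later.\<close>

definition combination :: "nat set \<Rightarrow> (nat \<Rightarrow> 'n \<Rightarrow>\<^sub>0 nat) \<Rightarrow> (nat \<Rightarrow> nat) \<Rightarrow> ('n \<Rightarrow>\<^sub>0 nat)" where
  "combination X \<xi> y = (\<Sum>x\<in>X. Poly_Mapping.map ((*) (y x)) (\<xi> x))"

lemma lookup_combination:
  "lookup (combination X \<xi> y) j = (\<Sum>x\<in>X. y x * lookup (\<xi> x) j)"
  by (auto simp: combination_def lookup_sum map.rep_eq when_def intro!: sum.cong)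

lemma combination_add:
  "combination X \<xi> (lookup (y + z)) =
    combination X \<xi> (lookup y) + combination X \<xi> (lookup z)"
  by (rule poly_mapping_eqI) (simp add: lookup_combination lookup_add distrib_right sum.distrib)

lemma combination_single:
  assumes "finite X" "x \<in> X"
  shows "combination X \<xi> (lookup (single x 1)) = \<xi> x"
proof (rule poly_mapping_eqI)
  fix j
  have "(\<Sum>z\<in>X. (1 when x = z) * lookup (\<xi> z) j) = (\<Sum>z\<in>X. if z = x then lookup (\<xi> z) j else 0)"
    by (rule sum.cong) (auto simp: when_def)
  then show "lookup (combination X \<xi> (lookup (single x 1))) j = lookup (\<xi> x) j"
    using assms by (simp add: lookup_combination lookup_single sum.delta)
qed

text \<open>The exponents of all products of \<open>u i\<close> monomials from block
  \<open>i\<close>, written as the image of a graded piece under an additive map so that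
  \<open>khovanskii\<close> applies.\<close>

definition sumset :: "nat set \<Rightarrow> (nat \<Rightarrow> nat) \<Rightarrow> nat \<Rightarrow> (nat \<Rightarrow> 'n \<Rightarrow>\<^sub>0 nat) \<Rightarrow> (nat \<Rightarrow> nat) \<Rightarrow> ('n \<Rightarrow>\<^sub>0 nat) set" where
  "sumset X \<tau> s \<xi> u = (\<lambda>y. combination X \<xi> (lookup y)) ` graded_piece X \<tau> s u"

lemma block_sum_single:
  assumes "finite X" "x \<in> X"
  shows "block_sum X \<tau> (lookup (single x (1::nat))) i = (if \<tau> x = i then 1 else 0)"
proof -
  have "block_sum X \<tau> (lookup (single x (1::nat))) i =
    (\<Sum>z | z \<in> X \<and> \<tau> z = i. if z = x then 1 else 0)"
    unfolding block_sum_def by (rule sum.cong) (auto simp: lookup_single when_def)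
  then show ?thesis using assms by simp
qed

text \<open>A positive degree in block \<open>i\<close> means that some variable of that block
  occurs and can be split off. For block 0 this relates the numerator and the denominator in the
  Hilbert function.\<close>

lemma sumset_Suc:
  assumes X: "finite X" and i: "i \<le> s"
  shows "sumset X \<tau> s \<xi> (u(i := Suc (u i))) = \<xi> ` {x \<in> X. \<tau> x = i} + sumset X \<tau> s \<xi> u"
proof (intro equalityI subsetI)
  let ?E = "sumset X \<tau> s \<xi>"
  let ?bs = "block_sum X \<tau>"
  let ?comb = "combination X \<xi>"
  fix e assume "e \<in> ?E (u(i := Suc (u i)))"
  then obtain y where y: "y \<in> graded_piece X \<tau> s (u(i := Suc (u i)))" "e = ?comb (lookup y)"
    by (auto simp: sumset_def)
  then have "?bs (lookup y) i = Suc (u i)" using i by (simp add: graded_piece_def)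
  then have "?bs (lookup y) i \<noteq> 0" by simp
  then obtain x where x: "x \<in> X" "\<tau> x = i" "lookup y x \<noteq> 0"
    unfolding block_sum_def by (rule sum.not_neutral_contains_not_neutral) blast
  let ?x = "single x (1::nat)"
  define z where "z = y - ?x"
  have yz: "y = ?x + z"
    by (rule poly_mapping_eqI) (use x in \<open>auto simp: z_def lookup_add lookup_minus lookup_single when_def\<close>)
  have "keys z \<subseteq> X"
    using y(1) unfolding graded_piece_def z_def by (auto simp: in_keys_iff lookup_minus subset_iff)
  moreover have "?bs (lookup z) j = u j" if "j \<le> s" for j
  proof -
    have "?bs (lookup (?x + z)) j = (u(i := Suc (u i))) j"
      using y(1) that unfolding yz[symmetric] by (simp add: graded_piece_def)
    then show ?thesis using x by (auto simp: block_sum_add block_sum_single[OF X] simp del: One_nat_def split: if_splits)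
  qed
  ultimately have "?comb (lookup z) \<in> ?E u"
    by (auto simp: sumset_def graded_piece_def)
  moreover have "e = \<xi> x + ?comb (lookup z)"
    by (simp only: y(2) yz combination_add combination_single[OF X x(1)])
  ultimately show "e \<in> \<xi> ` {x \<in> X. \<tau> x = i} + ?E u" using x by blast
next
  let ?E = "sumset X \<tau> s \<xi>"
  let ?bs = "block_sum X \<tau>"
  let ?comb = "combination X \<xi>"
  fix e assume "e \<in> \<xi> ` {x \<in> X. \<tau> x = i} + ?E u"
  then obtain x z where x: "x \<in> X" "\<tau> x = i" and z: "z \<in> graded_piece X \<tau> s u"
    and e: "e = \<xi> x + ?comb (lookup z)"
    by (auto simp: sumset_def elim!: set_plus_elim)
  let ?y = "single x (1::nat) + z"
  have "keys ?y \<subseteq> X"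
    using z x(1) by (intro order_trans[OF keys_add]) (auto simp: graded_piece_def)
  moreover have "?bs (lookup ?y) j = (u(i := Suc (u i))) j" if "j \<le> s" for j
    using z x that by (simp add: block_sum_add block_sum_single[OF X] graded_piece_def del: One_nat_def)
  ultimately have "?y \<in> graded_piece X \<tau> s (u(i := Suc (u i)))" by (simp add: graded_piece_def)
  moreover have "e = ?comb (lookup ?y)"
    by (simp only: e combination_add combination_single[OF X x(1)])
  ultimately show "e \<in> ?E (u(i := Suc (u i)))" unfolding sumset_def by blast
qed

lemma finite_sumset:
  assumes "finite X" "\<tau> ` X \<subseteq> {..s}"
  shows "finite (sumset X \<tau> s \<xi> u)"
  unfolding sumset_def by (intro finite_imageI finite_graded_piece assms)

lemma sumset_zero:
  assumes X: "finite X" "\<tau> ` X \<subseteq> {..s}" and u: "\<And>i. i \<le> s \<Longrightarrow> u i = 0"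
  shows "sumset X \<tau> s \<xi> u = {0}"
proof -
  have "graded_piece X \<tau> s u = {0}"
  proof (intro equalityI subsetI)
    fix y assume y: "y \<in> graded_piece X \<tau> s u"
    have "lookup y x = 0" if "x \<in> X" for x
    proof -
      have "block_sum X \<tau> (lookup y) (\<tau> x) = 0"
        using y u X(2) that by (auto simp: graded_piece_def)
      then show ?thesis using X(1) that by (simp add: block_sum_def)
    qed
    then have "y = 0" using y
      by (intro poly_mapping_eqI) (auto simp: graded_piece_def in_keys_iff subset_iff)
    then show "y \<in> {0}" by simp
  qed (use u in \<open>auto simp: graded_piece_def block_sum_def\<close>)
  moreover have "combination X \<xi> (lookup 0) = 0"
    by (rule poly_mapping_eqI) (simp add: lookup_combination)
  ultimately show ?thesis by (simp add: sumset_def)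
qed

lemma prod_power_monomials:
  assumes X: "finite X" "\<tau> ` X \<subseteq> {..s}"
  shows "(\<Prod>i\<le>s. (monomial ` \<xi> ` {x \<in> X. \<tau> x = i} :: ('n, 'k::comm_ring_1) mpoly set) ^ u i)
    = monomial ` sumset X \<tau> s \<xi> u"
proof (induction u rule: nat_tuple_induct[where s = s])
  case (zero u)
  have "(\<Prod>i\<le>s. (monomial ` \<xi> ` {x \<in> X. \<tau> x = i} :: ('n, 'k) mpoly set) ^ u i) = 1"
    by (intro prod.neutral) (simp add: zero)
  then show ?case by (simp add: sumset_zero[OF X zero] monomial_def set_one)
next
  case (Suc u i)
  let ?A = "\<lambda>i. monomial ` \<xi> ` {x \<in> X. \<tau> x = i} :: ('n, 'k) mpoly set"
  let ?v = "u(i := Suc (u i))"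
  have split: "(\<Prod>j\<le>s. F j) = F i * (\<Prod>j\<in>{..s} - {i}. F j)" for F :: "nat \<Rightarrow> ('n, 'k) mpoly set"
    using Suc(1) by (intro prod.remove) auto
  have "(\<Prod>j\<in>{..s} - {i}. ?A j ^ ?v j) = (\<Prod>j\<in>{..s} - {i}. ?A j ^ u j)"
    by (rule prod.cong) auto
  then have "(\<Prod>j\<le>s. ?A j ^ ?v j) = ?A i * (\<Prod>j\<le>s. ?A j ^ u j)"
    unfolding split by (simp add: mult.assoc)
  also have "\<dots> = monomial ` sumset X \<tau> s \<xi> ?v"
    unfolding Suc(2) monomial_image_plus[symmetric] sumset_Suc[OF X(1) Suc(1), symmetric] ..
  finally show ?case .
qed

lemma monomial_degree_combination:
  fixes \<xi> :: "nat \<Rightarrow> 'n::finite \<Rightarrow>\<^sub>0 nat"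
  shows "monomial_degree (combination X \<xi> y) = (\<Sum>x\<in>X. y x * monomial_degree (\<xi> x))"
  unfolding monomial_degree_def lookup_combination by (subst sum.swap) (simp add: sum_distrib_left)

lemma sum_block:
  fixes y :: "nat \<Rightarrow> 'a::comm_semiring_1"
  assumes "finite X" "\<tau> ` X \<subseteq> {..s}"
  shows "(\<Sum>x\<in>X. y x * d (\<tau> x)) = (\<Sum>i\<le>s. block_sum X \<tau> y i * d i)"
proof -
  have "(\<Sum>x\<in>X. y x * d (\<tau> x)) = (\<Sum>i\<le>s. \<Sum>x | x \<in> X \<and> \<tau> x = i. y x * d (\<tau> x))"
    using assms by (intro sum.group[symmetric]) auto
  then show ?thesis by (simp add: block_sum_def sum_distrib_right)
qed

lemma monomial_degree_sumset:
  fixes \<xi> :: "nat \<Rightarrow> 'n::finite \<Rightarrow>\<^sub>0 nat"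
  assumes X: "finite X" "\<tau> ` X \<subseteq> {..s}" and d: "\<And>x. x \<in> X \<Longrightarrow> monomial_degree (\<xi> x) = d (\<tau> x)"
    and e: "e \<in> sumset X \<tau> s \<xi> u"
  shows "monomial_degree e = (\<Sum>i\<le>s. u i * d i)"
proof -
  obtain y where y: "y \<in> graded_piece X \<tau> s u" "e = combination X \<xi> (lookup y)"
    using e by (auto simp: sumset_def)
  have "monomial_degree e = (\<Sum>x\<in>X. lookup y x * d (\<tau> x))"
    unfolding y(2) monomial_degree_combination by (rule sum.cong) (simp_all add: d)
  also have "\<dots> = (\<Sum>i\<le>s. u i * d i)"
    unfolding sum_block[OF X] using y(1) by (simp add: graded_piece_def)
  finally show ?thesis .
qed

text \<open>Raising \<open>u 0\<close> by one adds \<open>variables\<close> to the sumset, and the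
  sumset lies in a single degree, so the two ideals are exactly of the form treated in
  \<open>quotient_length_monomials\<close>.\<close>

theorem hilbert_function_eq_card_sumset:
  fixes \<xi> :: "nat \<Rightarrow> 'n::finite \<Rightarrow>\<^sub>0 nat" and J :: "nat \<Rightarrow> ('n, 'k::field) mpoly set"
  assumes X: "finite X" "\<tau> ` X \<subseteq> {..s}" and d: "\<And>x. x \<in> X \<Longrightarrow> monomial_degree (\<xi> x) = d (\<tau> x)"
    and M: "\<And>i. i \<le> s \<Longrightarrow> M i = \<xi> ` {x \<in> X. \<tau> x = i}" and M0: "M 0 = variables"
    and m: "m = maximal_graded_ideal" and J: "\<And>i. i \<le> s \<Longrightarrow> J i = monomial_ideal (M i)"
  shows "hilbert_function m J s u = enat (card (sumset X \<tau> s \<xi> u))"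
proof -
  let ?A = "\<lambda>i. monomial ` \<xi> ` {x \<in> X. \<tau> x = i} :: ('n, 'k) mpoly set"
  have m': "m = ideal_gen (?A 0)"
    using m M[of 0] M0 by (simp add: maximal_graded_ideal_def monomial_ideal_def)
  have J': "J i = ideal_gen (?A i)" if "i \<in> {1..s}" for i
    using J[of i] M[of i] that by (simp add: monomial_ideal_def)
  have pp: "power_product m J s a u = ideal_gen (monomial ` sumset X \<tau> s \<xi> (u(0 := a)))" for a
    by (rule trans[OF power_product_ideal_gen[of m ?A s J, OF m' J']])
       (simp_all only: prod_power_monomials[OF X])
  have "sumset X \<tau> s \<xi> (u(0 := u 0 + 1)) = variables + sumset X \<tau> s \<xi> u"
    using sumset_Suc[OF X(1), of 0 s \<tau> \<xi> u] M[of 0] M0 by simp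
  then show ?thesis
    unfolding hilbert_function_def pp
    using quotient_length_monomials[OF finite_sumset[OF X] monomial_degree_sumset[where d = d, OF X d]]
    by simp
qed

section \<open>Slabs over polytopes and lattice cells\<close>

definition coord_sum :: "real ^ 'n \<Rightarrow> real" where
  "coord_sum x = (\<Sum>j\<in>UNIV. x $ j)"

text \<open>The orthogonal projection onto the hyperplane of coordinate sum 0.\<close>

definition flatten :: "real ^ 'n \<Rightarrow> real ^ 'n" where
  "flatten x = x - (coord_sum x / real CARD('n)) *\<^sub>R 1"

lemma coord_sum_simps [simp]:
  "coord_sum (x + y) = coord_sum x + coord_sum y"
  "coord_sum (x - y) = coord_sum x - coord_sum y"
  "coord_sum (c *\<^sub>R x) = c * coord_sum x"
  "coord_sum (1 :: real ^ 'n) = real CARD('n)"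
  "coord_sum 0 = 0"
  by (simp_all add: coord_sum_def sum.distrib sum_subtractf sum_distrib_left)

lemma coord_sum_sum: "coord_sum (\<Sum>a\<in>A. f a) = (\<Sum>a\<in>A. coord_sum (f a))"
  unfolding coord_sum_def by (subst sum.swap) simp

lemma continuous_on_coord_sum [continuous_intros]: "continuous_on A coord_sum"
  unfolding coord_sum_def[abs_def] by (intro continuous_intros)

lemma linear_flatten: "linear flatten"
  by (rule linearI) (simp_all add: flatten_def algebra_simps add_divide_distrib scaleR_add_left)

lemma flatten_add_one: "flatten (x + c *\<^sub>R 1) = flatten x"
  by (simp add: flatten_def add_divide_distrib scaleR_add_left)

lemma flatten_eq: "x = flatten x + (coord_sum x / real CARD('n)) *\<^sub>R (1 :: real ^ 'n)"
  by (simp add: flatten_def)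

lemma continuous_on_flatten [continuous_intros]: "continuous_on A flatten"
  by (intro linear_continuous_on linear_conv_bounded_linear[THEN iffD1] linear_flatten)

text \<open>The prism over the projection of \<open>S\<close> in the direction (1, ..., 1), with its
  height measured by the coordinate sum. It has full dimension even if \<open>S\<close> lies in a
  hyperplane of constant coordinate sum, and half-open height intervals let such prisms be stacked
  without overlap.\<close>

definition slab :: "(real ^ 'n) set \<Rightarrow> real \<Rightarrow> real \<Rightarrow> (real ^ 'n) set" where
  "slab S a b = {x. flatten x \<in> flatten ` S \<and> a \<le> coord_sum x \<and> coord_sum x < b}"

lemma borel_slab:
  fixes S :: "(real ^ 'n) set"
  assumes "compact S"
  shows "slab S a b \<in> sets borel"
proof -
  have "slab S a b = (flatten -` flatten ` S) \<inter> {x. a \<le> coord_sum x} \<inter> {x. coord_sum x < b}"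
    by (auto simp: slab_def)
  moreover have "closed (flatten -` flatten ` S)"
    by (intro closed_vimage compact_imp_closed compact_continuous_image assms continuous_intros)
  moreover have "closed {x :: real ^ 'n. a \<le> coord_sum x}" "open {x :: real ^ 'n. coord_sum x < b}"
    by (intro closed_Collect_le open_Collect_less continuous_intros)+
  ultimately show ?thesis by (simp only: sets.Int borel_closed borel_open)
qed

lemma lmeasurable_slab:
  fixes S :: "(real ^ 'n) set"
  assumes "compact S"
  shows "slab S a b \<in> lmeasurable"
proof (rule bounded_set_imp_lmeasurable)
  have "compact (flatten ` S)" by (intro compact_continuous_image continuous_intros assms)
  then obtain B where B: "\<And>y. y \<in> flatten ` S \<Longrightarrow> norm y \<le> B"
    using compact_imp_bounded bounded_iff by metis
  show "bounded (slab S a b)"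
    unfolding bounded_iff
  proof (intro exI ballI)
    fix x assume x: "x \<in> slab S a b"
    then have c: "\<bar>coord_sum x\<bar> \<le> \<bar>a\<bar> + \<bar>b\<bar>" by (auto simp: slab_def)
    have "norm x \<le> norm (flatten x) + norm ((coord_sum x / real CARD('n)) *\<^sub>R (1 :: real ^ 'n))"
      by (subst flatten_eq) (rule norm_triangle_ineq)
    also have "\<dots> \<le> B + \<bar>coord_sum x\<bar> / real CARD('n) * norm (1 :: real ^ 'n)"
      using x B by (auto simp: slab_def)
    also have "\<dots> \<le> B + (\<bar>a\<bar> + \<bar>b\<bar>) / real CARD('n) * norm (1 :: real ^ 'n)"
      using c by (intro add_left_mono mult_right_mono divide_right_mono) auto
    finally show "norm x \<le> B + (\<bar>a\<bar> + \<bar>b\<bar>) / real CARD('n) * norm (1 :: real ^ 'n)" .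
  qed
qed (simp add: borel_slab[OF assms])

lemma slab_shift:
  fixes S :: "(real ^ 'n) set"
  shows "slab S (a + h) (b + h) = (+) ((h / real CARD('n)) *\<^sub>R 1) ` slab S a b"
proof (intro equalityI subsetI)
  fix x :: "real ^ 'n" assume x: "x \<in> slab S (a + h) (b + h)"
  let ?y = "x + (- (h / real CARD('n))) *\<^sub>R (1 :: real ^ 'n)"
  have "flatten ?y = flatten x" by (rule flatten_add_one)
  moreover have "coord_sum ?y = coord_sum x - h" by simp
  ultimately have "?y \<in> slab S a b" using x by (auto simp: slab_def)
  moreover have "x = (h / real CARD('n)) *\<^sub>R 1 + ?y" by simp
  ultimately show "x \<in> (+) ((h / real CARD('n)) *\<^sub>R 1) ` slab S a b" by blast
next
  fix x :: "real ^ 'n" assume "x \<in> (+) ((h / real CARD('n)) *\<^sub>R 1) ` slab S a b"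
  then obtain y where "x = y + (h / real CARD('n)) *\<^sub>R 1" "y \<in> slab S a b" by (auto simp: add.commute)
  then show "x \<in> slab S (a + h) (b + h)" by (auto simp: slab_def flatten_add_one)
qed

lemma measure_slab_shift:
  "measure lebesgue (slab S (a + h) (b + h)) = measure lebesgue (slab S a b)"
  unfolding slab_shift by (rule measure_translation)

lemma measure_slab_scale:
  fixes S :: "(real ^ 'n) set"
  assumes c: "c > 0"
  shows "measure lebesgue (slab ((*\<^sub>R) c ` S) (c * a) (c * b)) = c ^ CARD('n) * measure lebesgue (slab S a b)"
proof -
  have f: "flatten (c *\<^sub>R x) = c *\<^sub>R flatten x" for c and x :: "real ^ 'n"
    using linear_flatten by (rule linear_cmul)
  have "slab ((*\<^sub>R) c ` S) (c * a) (c * b) = (\<lambda>x. c *\<^sub>R x + 0) ` slab S a b"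
  proof (intro equalityI subsetI)
    fix x assume x: "x \<in> slab ((*\<^sub>R) c ` S) (c * a) (c * b)"
    then obtain k where k: "k \<in> S" "flatten x = flatten (c *\<^sub>R k)" by (auto simp: slab_def)
    let ?y = "inverse c *\<^sub>R x"
    have "flatten ?y = flatten k" using c k(2) by (simp add: f)
    moreover have "a \<le> coord_sum ?y" "coord_sum ?y < b" using x c by (auto simp: slab_def field_simps)
    ultimately have "?y \<in> slab S a b" using k by (auto simp: slab_def)
    moreover have "x = c *\<^sub>R ?y + 0" using c by simp
    ultimately show "x \<in> (\<lambda>x. c *\<^sub>R x + 0) ` slab S a b" by blast
  next
    fix x assume "x \<in> (\<lambda>x. c *\<^sub>R x + 0) ` slab S a b"
    then show "x \<in> slab ((*\<^sub>R) c ` S) (c * a) (c * b)"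
      using c by (auto simp: slab_def f image_image)
  qed
  then show ?thesis using c measure_lebesgue_affine[of c 0 "slab S a b"] by simp
qed

text \<open>For \<open>S\<close> in a hyperplane of constant coordinate sum this is its (n -
  1)-dimensional volume divided by sqrt n, that is, the volume normalized by the lattice of integer
  points in that hyperplane.\<close>

definition slab_volume :: "(real ^ 'n) set \<Rightarrow> real" where
  "slab_volume S = measure lebesgue (slab S 0 1)"

lemma measure_slab_multiple:
  assumes "compact S" "h \<ge> 0"
  shows "measure lebesgue (slab S 0 (real k * h)) = real k * measure lebesgue (slab S 0 h)"
proof (induction k)
  case 0
  have "slab S 0 0 = {}" by (auto simp: slab_def)
  then show ?case by simp
next
  case (Suc k)
  let ?a = "real k * h"
  have "slab S 0 (real (Suc k) * h) = slab S 0 ?a \<union> slab S (0 + ?a) (h + ?a)"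
    using assms(2) by (auto simp: slab_def algebra_simps not_less) (smt (verit) mult_nonneg_nonneg of_nat_0_le_iff)
  moreover have "slab S 0 ?a \<inter> slab S (0 + ?a) (h + ?a) = {}" by (auto simp: slab_def)
  ultimately have "measure lebesgue (slab S 0 (real (Suc k) * h)) =
      measure lebesgue (slab S 0 ?a) + measure lebesgue (slab S (0 + ?a) (h + ?a))"
    using lmeasurable_slab[OF assms(1)] by (simp add: measure_Un3 del: add_0_left)
  then show ?case unfolding measure_slab_shift Suc by (simp add: algebra_simps)
qed

text \<open>Dilation by \<open>t\<close> also stretches the height, so a slab of height 1 over the
  dilated set comes from one of height 1 / t over \<open>S\<close>. Exactly \<open>t\<close> of
  these stack up to height 1, which costs one power of \<open>t\<close>.\<close>

lemma slab_volume_scale: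
  fixes S :: "(real ^ 'n) set"
  assumes "compact S" "t > 0"
  shows "slab_volume ((*\<^sub>R) (real t) ` S) = real t ^ (CARD('n) - 1) * slab_volume S"
proof -
  have "slab_volume ((*\<^sub>R) (real t) ` S) = real t ^ CARD('n) * measure lebesgue (slab S 0 (1 / real t))"
    unfolding slab_volume_def using assms(2) measure_slab_scale[of "real t" S 0 "1 / real t"] by simp
  moreover have "slab_volume S = real t * measure lebesgue (slab S 0 (1 / real t))"
    unfolding slab_volume_def using assms measure_slab_multiple[of S "1 / real t" t] by simp
  moreover have "real t ^ CARD('n) = real t ^ (CARD('n) - 1) * real t"
    by (metis One_nat_def zero_less_card_finite Suc_pred power_Suc2)
  ultimately show ?thesis by simp
qed

text \<open>A half-open fundamental domain of the integer lattice, translated to \<open>p\<close>.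
  In contrast to the unit cube it uses the coordinate sum in place of coordinate \<open>j0\<close>,
  so the cells of all lattice points in one hyperplane fit into a single slab of height 1.\<close>

definition cell :: "'n \<Rightarrow> real ^ 'n \<Rightarrow> (real ^ 'n) set" where
  "cell j0 p = {x. (\<forall>j. j \<noteq> j0 \<longrightarrow> p $ j \<le> x $ j \<and> x $ j < p $ j + 1) \<and>
     coord_sum p \<le> coord_sum x \<and> coord_sum x < coord_sum p + 1}"

lemma cell_translate: "cell j0 p = (+) p ` cell j0 0"
proof (intro equalityI subsetI)
  fix x assume x: "x \<in> cell j0 p"
  then have "x - p \<in> cell j0 0" by (fastforce simp: cell_def)
  then show "x \<in> (+) p ` cell j0 0" by (intro image_eqI[of _ _ "x - p"]) auto
qed (auto simp: cell_def)

lemma coord_sum_axis: "coord_sum (axis j c) = c"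
  by (simp add: coord_sum_def axis_def)

lemma coord_sum_split: "coord_sum x = x $ j0 + (\<Sum>j\<in>UNIV - {j0}. x $ j)"
  unfolding coord_sum_def by (rule sum.remove) auto

text \<open>The cell and the half-open unit cube \<open>G\<close> are equidecomposable. The cell is
  cut by the integer part of coordinate \<open>j0\<close> and the cube by that of the coordinate
  sum; the pieces \<open>A m\<close> and \<open>B m\<close> differ by a translation along the axis
  \<open>j0\<close>.\<close>

lemma
  fixes j0 :: "'n::finite"
  shows lmeasurable_unit_cell: "cell j0 0 \<in> lmeasurable"
    and measure_unit_cell: "measure lebesgue (cell j0 0) = 1"
proof -
  let ?n = "CARD('n)"
  define G where "G = {x :: real ^ 'n. \<forall>j. 0 \<le> x $ j \<and> x $ j < 1}"
  define B where "B = (\<lambda>m::nat. {x \<in> G. real m \<le> coord_sum x \<and> coord_sum x < real m + 1})"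
  have cb: "cbox (0::real ^ 'n) 1 = {x. \<forall>j. 0 \<le> x $ j \<and> x $ j \<le> 1}"
    by (auto simp: mem_box_cart)
  have bx: "box (0::real ^ 'n) 1 = {x. \<forall>j. 0 < x $ j \<and> x $ j < 1}"
    by (auto simp: mem_box_cart)
  have sub: "box (0::real ^ 'n) 1 \<subseteq> G" "G \<subseteq> cbox 0 1"
    unfolding cb bx G_def by (auto simp: less_imp_le)
  have G_borel: "G \<in> sets borel"
  proof -
    have "G = (\<Inter>j. {x. 0 \<le> x $ j} \<inter> {x. x $ j < 1})" by (auto simp: G_def)
    moreover have "closed {x :: real ^ 'n. 0 \<le> x $ j}" "open {x :: real ^ 'n. x $ j < 1}" for j
      by (intro closed_Collect_le open_Collect_less continuous_intros)+
    ultimately show ?thesis by auto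
  qed
  have G: "G \<in> lmeasurable"
    using G_borel sub(2) by (intro bounded_set_imp_lmeasurable) (auto intro: bounded_subset[OF bounded_cbox])
  have m_cbox: "measure lebesgue (cbox (0::real ^ 'n) 1) = 1"
  proof -
    have "cbox (0::real ^ 'n) 1 \<noteq> {}" using cb by (auto intro!: exI[of _ 0])
    then show ?thesis by (simp add: content_cbox_cart)
  qed
  have m_box: "measure lebesgue (box (0::real ^ 'n) 1) = 1"
    using m_cbox by (simp add: measure_lborel_box_eq measure_lborel_cbox_eq)
  have mG: "measure lebesgue G = 1"
    using measure_mono_fmeasurable[OF sub(1) _ G] measure_mono_fmeasurable[OF sub(2) _ lmeasurable_cbox]
      m_cbox m_box G by auto
  have B: "B m \<in> lmeasurable" for m
  proof -
    have "B m = G \<inter> ({x. real m \<le> coord_sum x} \<inter> {x. coord_sum x < real m + 1})" by (auto simp: B_def)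
    moreover have "closed {x :: real ^ 'n. real m \<le> coord_sum x}" "open {x :: real ^ 'n. coord_sum x < real m + 1}"
      by (intro closed_Collect_le open_Collect_less continuous_intros)+
    then have "{x :: real ^ 'n. real m \<le> coord_sum x} \<inter> {x. coord_sum x < real m + 1} \<in> sets lebesgue" by auto
    ultimately show ?thesis using G by (simp add: fmeasurable_Int_fmeasurable)
  qed
  have inG: "0 \<le> coord_sum x \<and> coord_sum x < ?n + 1" if "x \<in> G" for x
  proof -
    have "(\<Sum>j\<in>UNIV. x $ j) \<le> (\<Sum>j\<in>(UNIV::'n set). 1)" using that by (intro sum_mono) (auto simp: G_def less_imp_le)
    then show ?thesis using that by (auto simp: coord_sum_def G_def intro: sum_nonneg)
  qed
  have G_un: "G = (\<Union>m\<le>?n. B m)"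
  proof (intro equalityI subsetI)
    fix x assume x: "x \<in> G"
    let ?m = "nat \<lfloor>coord_sum x\<rfloor>"
    have "real ?m \<le> coord_sum x" "coord_sum x < real ?m + 1" using inG[OF x] by (auto)
    moreover have "?m \<le> ?n" using inG[OF x] by linarith
    ultimately show "x \<in> (\<Union>m\<le>?n. B m)" using x by (auto simp: B_def)
  qed (auto simp: B_def)
  have ax: "axis j0 c $ j = (if j = j0 then c else 0)" for c :: real and j
    by (simp add: axis_def)
  define A where "A = (\<lambda>m::nat. {x \<in> cell j0 0. - real m \<le> x $ j0 \<and> x $ j0 < - real m + 1})"
  have A_eq: "A m = (+) (axis j0 (- real m)) ` B m" for m
  proof (intro equalityI subsetI)
    fix x assume x: "x \<in> A m"
    have "x - axis j0 (- real m) \<in> B m"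
      unfolding B_def G_def mem_Collect_eq
    proof (intro conjI allI)
      fix j show "0 \<le> (x - axis j0 (- real m)) $ j" "(x - axis j0 (- real m)) $ j < 1"
        using x by (cases "j = j0"; auto simp: A_def cell_def axis_def)+
    qed (use x in \<open>auto simp: A_def cell_def coord_sum_axis\<close>)
    then show "x \<in> (+) (axis j0 (- real m)) ` B m"
      by (intro image_eqI[of _ _ "x - axis j0 (- real m)"]) auto
  qed (auto simp: A_def B_def G_def cell_def ax coord_sum_axis)
  have A: "A m \<in> lmeasurable" "measure lebesgue (A m) = measure lebesgue (B m)" for m
    unfolding A_eq using B by (auto intro: measurable_translation measure_translation)
  have cell_un: "cell j0 0 = (\<Union>m\<le>?n. A m)"
  proof (intro equalityI subsetI)
    fix x assume x: "x \<in> cell j0 0"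
    have s0: "0 \<le> (\<Sum>j\<in>UNIV - {j0}. x $ j)" using x by (intro sum_nonneg) (auto simp: cell_def)
    have "(\<Sum>j\<in>UNIV - {j0}. x $ j) \<le> (\<Sum>j\<in>UNIV - {j0}. 1)"
      using x by (intro sum_mono) (auto simp: cell_def less_imp_le)
    also have "\<dots> \<le> real ?n" by simp
    finally have b: "- real ?n \<le> x $ j0" "x $ j0 < 1"
      using x s0 coord_sum_split[of x j0] by (auto simp: cell_def)
    \<comment> \<open>In the cell, coordinate \<open>j0\<close> lies between -n and 1, so its
      negated floor is a natural number at most n.\<close>
    define m where "m = nat (- \<lfloor>x $ j0\<rfloor>)"
    have "real m = - real_of_int \<lfloor>x $ j0\<rfloor>" using b(2) by (simp add: m_def floor_le_iff)
    then have "- real m \<le> x $ j0" "x $ j0 < - real m + 1" by linarith+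
    moreover have "m \<le> ?n" unfolding m_def using b(1) by linarith
    ultimately show "x \<in> (\<Union>m\<le>?n. A m)" using x by (auto simp: A_def)
  qed (auto simp: A_def)
  show "cell j0 0 \<in> lmeasurable" unfolding cell_un using A by auto
  have dA: "pairwise (\<lambda>i j. disjnt (A i) (A j)) {..?n}"
    unfolding pairwise_def disjnt_def
  proof (intro ballI impI)
    fix m m' :: nat assume "m \<noteq> m'"
    then have "real m \<le> real m' - 1 \<or> real m' \<le> real m - 1" by linarith
    then show "A m \<inter> A m' = {}" by (auto simp: A_def)
  qed
  have dB: "pairwise (\<lambda>i j. disjnt (B i) (B j)) {..?n}"
    unfolding pairwise_def disjnt_def
  proof (intro ballI impI)
    fix m m' :: nat assume "m \<noteq> m'"
    then have "real m \<le> real m' - 1 \<or> real m' \<le> real m - 1" by linarith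
    then show "B m \<inter> B m' = {}" by (auto simp: B_def)
  qed
  have "measure lebesgue (cell j0 0) = (\<Sum>m\<le>?n. measure lebesgue (A m))"
    unfolding cell_un using A by (intro measure_UNION' dA) auto
  also have "\<dots> = (\<Sum>m\<le>?n. measure lebesgue (B m))" by (simp add: A)
  also have "\<dots> = measure lebesgue G"
    unfolding G_un using B by (intro measure_UNION'[symmetric] dB) auto
  finally show "measure lebesgue (cell j0 0) = 1" using mG by simp
qed

section \<open>Exponent vectors and Minkowski sums of Newton polytopes\<close>

lemma exponent_vector_nth: "exponent_vector e $ j = real (lookup e j)"
  by (simp add: exponent_vector_def)

lemma coord_sum_exponent_vector: "coord_sum (exponent_vector e) = real (monomial_degree e)"
  by (simp add: coord_sum_def exponent_vector_nth monomial_degree_def)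

lemma sumset_add:
  assumes "a \<in> sumset X \<tau> s \<xi> u" "b \<in> sumset X \<tau> s \<xi> v"
  shows "a + b \<in> sumset X \<tau> s \<xi> (\<lambda>i. u i + v i)"
proof -
  obtain y z where y: "y \<in> graded_piece X \<tau> s u" "a = combination X \<xi> (lookup y)"
    and z: "z \<in> graded_piece X \<tau> s v" "b = combination X \<xi> (lookup z)"
    using assms by (auto simp: sumset_def)
  have "y + z \<in> graded_piece X \<tau> s (\<lambda>i. u i + v i)"
    using y(1) z(1) keys_add[of y z] by (auto simp: graded_piece_def block_sum_add)
  then show ?thesis unfolding y(2) z(2) combination_add[symmetric] sumset_def by (rule imageI)
qed

lemma combination_in_sumset:
  assumes "finite X"
  shows "combination X \<xi> y \<in> sumset X \<tau> s \<xi> (block_sum X \<tau> y)"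
proof -
  define z where "z = (\<Sum>x\<in>X. single x (y x))"
  have z: "lookup z x = (if x \<in> X then y x else 0)" for x
    using assms by (simp add: z_def lookup_sum lookup_single when_def sum.delta)
  have "combination X \<xi> y = combination X \<xi> (lookup z)"
    unfolding combination_def by (rule sum.cong) (simp_all add: z)
  moreover have "block_sum X \<tau> (lookup z) = block_sum X \<tau> y"
    by (rule ext, rule block_sum_cong) (simp add: z)
  then have "z \<in> graded_piece X \<tau> s (block_sum X \<tau> y)"
    by (auto simp: graded_piece_def z in_keys_iff split: if_splits)
  ultimately show ?thesis unfolding sumset_def by blast
qed

lemma sumset_cong:
  assumes "\<And>i. i \<le> s \<Longrightarrow> u i = v i"
  shows "sumset X \<tau> s \<xi> u = sumset X \<tau> s \<xi> v"
  using assms by (simp add: sumset_def graded_piece_def)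

definition real_combination :: "nat set \<Rightarrow> (nat \<Rightarrow> 'n::finite \<Rightarrow>\<^sub>0 nat) \<Rightarrow> (nat \<Rightarrow> real) \<Rightarrow> real ^ 'n" where
  "real_combination X \<xi> l = (\<Sum>x\<in>X. l x *\<^sub>R exponent_vector (\<xi> x))"

lemma exponent_vector_combination:
  "exponent_vector (combination X \<xi> y) = real_combination X \<xi> (\<lambda>x. real (y x))"
  by (simp add: vec_eq_iff exponent_vector_nth lookup_combination real_combination_def)

text \<open>The Minkowski sum \<open>u\<^sub>0 Q\<^sub>0 + \<dots> + u\<^sub>s Q\<^sub>s\<close> of multiples of the Newton polytopes.\<close>

definition minkowski :: "nat set \<Rightarrow> (nat \<Rightarrow> nat) \<Rightarrow> nat \<Rightarrow> (nat \<Rightarrow> 'n::finite \<Rightarrow>\<^sub>0 nat) \<Rightarrow> (nat \<Rightarrow> nat) \<Rightarrow> (real ^ 'n) set" where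
  "minkowski X \<tau> s \<xi> u =
     {real_combination X \<xi> l | l. (\<forall>x\<in>X. 0 \<le> l x) \<and> (\<forall>i\<le>s. block_sum X \<tau> l i = real (u i))}"

lemma minkowskiI:
  assumes "\<And>x. x \<in> X \<Longrightarrow> 0 \<le> l x" "\<And>i. i \<le> s \<Longrightarrow> block_sum X \<tau> l i = real (u i)"
  shows "real_combination X \<xi> l \<in> minkowski X \<tau> s \<xi> u"
  using assms unfolding minkowski_def by blast

lemma minkowski_scale:
  assumes "t > 0"
  shows "minkowski X \<tau> s \<xi> (\<lambda>i. t * u i) = (*\<^sub>R) (real t) ` minkowski X \<tau> s \<xi> u"
proof -
  let ?K = "minkowski X \<tau> s \<xi>"
  let ?rc = "real_combination X \<xi>"
  let ?bs = "block_sum X \<tau>"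
  have rc: "?rc (\<lambda>x. c * l x) = c *\<^sub>R ?rc l" for c l
    by (simp add: real_combination_def scaleR_sum_right)
  have bs: "?bs (\<lambda>x. c * l x) i = c * ?bs l i" for c :: real and l i
    by (simp add: block_sum_def sum_distrib_left)
  show ?thesis
  proof (intro equalityI subsetI)
    fix k assume "k \<in> ?K (\<lambda>i. t * u i)"
    then obtain l where l: "k = ?rc l" "\<forall>x\<in>X. 0 \<le> l x" "\<forall>i\<le>s. ?bs l i = real (t * u i)"
      unfolding minkowski_def by blast
    have "?rc (\<lambda>x. inverse (real t) * l x) \<in> ?K u"
      using l assms by (intro minkowskiI) (auto simp: bs)
    moreover have "k = real t *\<^sub>R ?rc (\<lambda>x. inverse (real t) * l x)"
      using assms by (simp add: rc l)
    ultimately show "k \<in> (*\<^sub>R) (real t) ` ?K u" by blast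
  next
    fix k assume "k \<in> (*\<^sub>R) (real t) ` ?K u"
    then obtain l where l: "k = real t *\<^sub>R ?rc l" "\<forall>x\<in>X. 0 \<le> l x" "\<forall>i\<le>s. ?bs l i = real (u i)"
      unfolding minkowski_def by blast
    show "k \<in> ?K (\<lambda>i. t * u i)"
      unfolding l(1) rc[symmetric] using l assms by (intro minkowskiI) (auto simp: bs)
  qed
qed

text \<open>To split off a point of the Newton polytope, the fraction \<open>1 / Suc (u i)\<close>
  of every coefficient in block \<open>i\<close> is taken: these parts sum to 1, and the rest of the
  block still sums to \<open>u i\<close>.\<close>

lemma minkowski_Suc:
  assumes X: "finite X" and i: "i \<le> s"
  shows "minkowski X \<tau> s \<xi> (u(i := Suc (u i))) =
    newton_polytope (\<xi> ` {x \<in> X. \<tau> x = i}) + minkowski X \<tau> s \<xi> u"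
proof -
  let ?K = "minkowski X \<tau> s \<xi>"
  let ?rc = "real_combination X \<xi>"
  let ?bs = "block_sum X \<tau>"
  let ?Xi = "{x \<in> X. \<tau> x = i}"
  have rc_add: "?rc (\<lambda>x. l x + l' x) = ?rc l + ?rc l'" for l l'
    by (simp add: real_combination_def scaleR_add_left sum.distrib)
  have bs_add: "?bs (\<lambda>x. l x + l' x) j = ?bs l j + ?bs l' j" for l l' :: "nat \<Rightarrow> real" and j
    by (simp add: block_sum_def sum.distrib)
  have bs_if: "?bs (\<lambda>x. if \<tau> x = i then l x else 0) j = (if j = i then ?bs l i else 0)" for l :: "nat \<Rightarrow> real" and j
    by (auto simp: block_sum_def)
  \<comment> \<open>The convex hull described by coefficient functions on all of \<open>X\<close>,
    masked outside block \<open>i\<close>, so that its points can be added to those of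
    \<open>?K u\<close> coefficientwise.\<close>
  let ?D = "{?rc (\<lambda>x. if \<tau> x = i then l x else 0) | l. (\<forall>x\<in>X. 0 \<le> l x) \<and> ?bs l i = 1}"
  have rc_if: "?rc (\<lambda>x. if \<tau> x = i then l x else 0) = (\<Sum>x\<in>?Xi. l x *\<^sub>R exponent_vector (\<xi> x))" for l
    unfolding real_combination_def using X by (intro sum.mono_neutral_cong_right) auto
  have newton: "newton_polytope (\<xi> ` ?Xi) = ?D"
  proof
    have "convex ?D"
      unfolding convex_alt
    proof (intro ballI allI impI, elim conjE)
      fix a b :: "real ^ 'a" and c :: real assume a: "a \<in> ?D" and b: "b \<in> ?D" and c: "0 \<le> c" "c \<le> 1"
      obtain l where l: "a = ?rc (\<lambda>x. if \<tau> x = i then l x else 0)" "\<forall>x\<in>X. 0 \<le> l x" "?bs l i = 1"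
        using a by blast
      obtain l' where l': "b = ?rc (\<lambda>x. if \<tau> x = i then l' x else 0)" "\<forall>x\<in>X. 0 \<le> l' x" "?bs l' i = 1"
        using b by blast
      have "?bs (\<lambda>x. (1 - c) * l x + c * l' x) i = (1 - c) * ?bs l i + c * ?bs l' i"
        by (simp add: block_sum_def sum.distrib sum_distrib_left)
      then have "?bs (\<lambda>x. (1 - c) * l x + c * l' x) i = 1" using l l' by simp
      moreover have "\<forall>x\<in>X. 0 \<le> (1 - c) * l x + c * l' x" using l l' c by simp
      moreover have "(1 - c) *\<^sub>R a + c *\<^sub>R b = ?rc (\<lambda>x. if \<tau> x = i then (1 - c) * l x + c * l' x else 0)"
        unfolding l l' rc_if by (simp add: scaleR_sum_right scaleR_add_left sum.distrib)
      ultimately show "(1 - c) *\<^sub>R a + c *\<^sub>R b \<in> ?D"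
        by (intro CollectI exI[of _ "\<lambda>x. (1 - c) * l x + c * l' x"]) simp
    qed
    moreover have "exponent_vector ` \<xi> ` ?Xi \<subseteq> ?D"
    proof (clarify)
      fix z assume z: "z \<in> X" "i = \<tau> z"
      have "(\<Sum>x\<in>?Xi. (if x = z then 1 else 0) *\<^sub>R exponent_vector (\<xi> x)) = (\<Sum>x\<in>?Xi. if x = z then exponent_vector (\<xi> x) else 0)"
        by (rule sum.cong) auto
      then have "exponent_vector (\<xi> z) = ?rc (\<lambda>x. if \<tau> x = i then (if x = z then 1 else 0) else 0)"
        unfolding rc_if using X z by (simp add: sum.delta)
      moreover have "?bs (\<lambda>x. if x = z then 1 else 0 :: real) i = 1"
        using X z by (simp add: block_sum_def sum.delta)
      ultimately show "\<exists>l. exponent_vector (\<xi> z) = ?rc (\<lambda>x. if \<tau> x = \<tau> z then l x else 0) \<and>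
          (\<forall>x\<in>X. 0 \<le> l x) \<and> ?bs l (\<tau> z) = 1"
        using z by (intro exI[of _ "\<lambda>x. if x = z then 1 else 0"]) simp
    qed
    ultimately show "newton_polytope (\<xi> ` ?Xi) \<subseteq> ?D" unfolding newton_polytope_def by (intro hull_minimal)
  next
    show "?D \<subseteq> newton_polytope (\<xi> ` ?Xi)"
    proof
      fix a assume "a \<in> ?D"
      then obtain l where l: "a = (\<Sum>x\<in>?Xi. l x *\<^sub>R exponent_vector (\<xi> x))" "\<forall>x\<in>X. 0 \<le> l x" "?bs l i = 1"
        unfolding rc_if by blast
      then show "a \<in> newton_polytope (\<xi> ` ?Xi)" unfolding newton_polytope_def l(1)
        using X by (intro convex_sum) (auto simp: block_sum_def intro: hull_inc)
    qed
  qed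
  show ?thesis
  proof (intro equalityI subsetI)
    fix k assume "k \<in> ?K (u(i := Suc (u i)))"
    then obtain l where l: "k = ?rc l" "\<forall>x\<in>X. 0 \<le> l x"
       "\<forall>j\<le>s. ?bs l j = real ((u(i := Suc (u i))) j)"
      unfolding minkowski_def by blast
    define c where "c = 1 / real (Suc (u i))"
    have c: "0 \<le> c" "c \<le> 1" "c * real (Suc (u i)) = 1" by (simp_all add: c_def)
    have li: "?bs l i = real (Suc (u i))" using l(3) i by simp
    have bsc: "?bs (\<lambda>x. c * l x) i = 1"
      using li c(3) by (simp add: block_sum_def sum_distrib_left[symmetric])
    let ?a = "?rc (\<lambda>x. if \<tau> x = i then c * l x else 0)"
    let ?l = "\<lambda>x. l x - (if \<tau> x = i then c * l x else 0)"
    have "\<forall>x\<in>X. 0 \<le> c * l x" using l(2) c by simp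
    then have "?a \<in> newton_polytope (\<xi> ` ?Xi)"
      unfolding newton using bsc by (intro CollectI exI[of _ "\<lambda>x. c * l x"]) simp
    moreover have "?rc ?l \<in> ?K u"
    proof (rule minkowskiI)
      fix x assume x: "x \<in> X"
      then have "c * l x \<le> 1 * l x" using l(2) c by (intro mult_right_mono) auto
      then show "0 \<le> ?l x" using l(2) x by auto
    next
      fix j assume j: "j \<le> s"
      have "?bs ?l j = ?bs l j - (if j = i then ?bs (\<lambda>x. c * l x) i else 0)"
        unfolding bs_if[symmetric] by (simp add: block_sum_def sum_subtractf)
      then show "?bs ?l j = real (u j)" using l(3) j bsc by auto
    qed
    moreover have "k = ?a + ?rc ?l"
      unfolding rc_add[symmetric] l(1) by simp
    ultimately show "k \<in> newton_polytope (\<xi> ` ?Xi) + ?K u" by blast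
  next
    fix k assume "k \<in> newton_polytope (\<xi> ` ?Xi) + ?K u"
    then obtain a b where k: "k = a + b" and a: "a \<in> ?D" and b: "b \<in> ?K u"
      unfolding newton by (rule set_plus_elim)
    obtain l where l: "a = ?rc (\<lambda>x. if \<tau> x = i then l x else 0)" "\<forall>x\<in>X. 0 \<le> l x" "?bs l i = 1"
      using a by blast
    obtain l' where l': "b = ?rc l'" "\<forall>x\<in>X. 0 \<le> l' x" "\<forall>i\<le>s. ?bs l' i = real (u i)"
      using b unfolding minkowski_def by blast
    show "k \<in> ?K (u(i := Suc (u i)))"
      unfolding k l(1) l'(1) rc_add[symmetric]
      using l l' by (intro minkowskiI) (auto simp: bs_add bs_if)
  qed
qed

lemma minkowski_zero:
  assumes X: "finite X" "\<tau> ` X \<subseteq> {..s}" and u: "\<And>i. i \<le> s \<Longrightarrow> u i = 0"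
  shows "minkowski X \<tau> s \<xi> u = {0}"
proof (intro equalityI subsetI)
  fix k assume "k \<in> minkowski X \<tau> s \<xi> u"
  then obtain l where l: "k = real_combination X \<xi> l" "\<forall>x\<in>X. 0 \<le> l x" "\<forall>i\<le>s. block_sum X \<tau> l i = real (u i)"
    unfolding minkowski_def by blast
  have "l x = 0" if "x \<in> X" for x
  proof -
    have "(\<Sum>z | z \<in> X \<and> \<tau> z = \<tau> x. l z) = 0"
      using l(3) u X(2) that unfolding block_sum_def by auto
    then show ?thesis using X(1) l(2) that by (subst (asm) sum_nonneg_eq_0_iff) auto
  qed
  then show "k \<in> {0}" by (simp add: l real_combination_def)
next
  fix k :: "real ^ 'a" assume "k \<in> {0}"
  then have "k = real_combination X \<xi> (\<lambda>x. 0)" by (simp add: real_combination_def)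
  then show "k \<in> minkowski X \<tau> s \<xi> u" using u by (auto intro!: minkowskiI simp: block_sum_def)
qed

text \<open>A Minkowski sum of polytopes depends only on how often each of them occurs. This turns
  the subset sums of the mixed volume into values of one function at the vectors of
  multiplicities.\<close>

lemma sum_newton_polytopes:
  assumes X: "finite X" "\<tau> ` X \<subseteq> {..s}" and I: "finite I" "\<And>j. j \<in> I \<Longrightarrow> \<iota> j \<le> s"
  shows "(\<Sum>j\<in>I. newton_polytope (\<xi> ` {x \<in> X. \<tau> x = \<iota> j})) = minkowski X \<tau> s \<xi> (\<lambda>i. card {j \<in> I. \<iota> j = i})"
  using I
proof (induction I rule: finite_induct)
  case empty
  then show ?case by (simp add: minkowski_zero[OF X] set_zero)
next
  case (insert j I)
  let ?u = "\<lambda>i. card {j \<in> I. \<iota> j = i}"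
  have "card {k \<in> insert j I. \<iota> k = i} = (?u(\<iota> j := Suc (?u (\<iota> j)))) i" for i
  proof -
    have "{k \<in> insert j I. \<iota> k = i} = (if i = \<iota> j then insert j {k \<in> I. \<iota> k = i} else {k \<in> I. \<iota> k = i})" by auto
    then show ?thesis using insert.hyps by auto
  qed
  then have "(\<lambda>i. card {k \<in> insert j I. \<iota> k = i}) = ?u(\<iota> j := Suc (?u (\<iota> j)))" by (rule ext)
  note cnt = this
  have "minkowski X \<tau> s \<xi> (?u(\<iota> j := Suc (?u (\<iota> j)))) =
      newton_polytope (\<xi> ` {x \<in> X. \<tau> x = \<iota> j}) + minkowski X \<tau> s \<xi> ?u"
    by (rule minkowski_Suc[OF X(1)]) (use insert.prems in auto)
  then show ?case
    unfolding cnt using insert by simp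
qed

lemma
  assumes X: "finite X" "\<tau> ` X = {..s}"
  shows compact_minkowski: "compact (minkowski X \<tau> s \<xi> u)"
    and minkowski_nonempty: "minkowski X \<tau> s \<xi> u \<noteq> {}"
proof -
  have X': "\<tau> ` X \<subseteq> {..s}" using X by simp
  have "compact (minkowski X \<tau> s \<xi> u) \<and> minkowski X \<tau> s \<xi> u \<noteq> {}"
  proof (induction u rule: nat_tuple_induct[where s = s])
    case (zero u)
    then show ?case by (simp add: minkowski_zero[OF X(1) X'])
  next
    case (Suc u i)
    let ?P = "newton_polytope (\<xi> ` {x \<in> X. \<tau> x = i})"
    let ?K = "minkowski X \<tau> s \<xi> u"
    have "i \<in> \<tau> ` X" using Suc(1) X(2) by simp
    then have P: "compact ?P" "?P \<noteq> {}"
      using X(1) by (auto simp: newton_polytope_def intro!: finite_imp_compact_convex_hull)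
    have "?P + ?K = {x + y |x y. x \<in> ?P \<and> y \<in> ?K}"
      by (auto simp: set_plus_def)
    then have "compact (?P + ?K)" using compact_sums[OF P(1), of ?K] Suc(2) by simp
    moreover have "?P + ?K \<noteq> {}" using P(2) Suc(2) by (auto simp: set_plus_def)
    ultimately show ?case unfolding minkowski_Suc[OF X(1) Suc(1)] by blast
  qed
  then show "compact (minkowski X \<tau> s \<xi> u)" "minkowski X \<tau> s \<xi> u \<noteq> {}" by blast+
qed

text \<open>If the cell of \<open>e\<close> contains a point, the floors of its coordinates give all
  entries of \<open>e\<close> except the one at \<open>j0\<close>, and the common degree gives that
  one. The cells are therefore disjoint, and each has measure 1.\<close>

lemma
  fixes E :: "('n::finite \<Rightarrow>\<^sub>0 nat) set"
  assumes "finite E" "\<And>e. e \<in> E \<Longrightarrow> monomial_degree e = D"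
  shows lmeasurable_Union_cells: "(\<Union>e\<in>E. cell j0 (exponent_vector e)) \<in> lmeasurable"
    and measure_Union_cells: "measure lebesgue (\<Union>e\<in>E. cell j0 (exponent_vector e)) = real (card E)"
proof -
  have m: "cell j0 (exponent_vector e) \<in> lmeasurable" "measure lebesgue (cell j0 (exponent_vector e)) = 1" for e
    using lmeasurable_unit_cell[of j0] measure_unit_cell[of j0]
    by (subst cell_translate, simp add: measurable_translation measure_translation)+
  show "(\<Union>e\<in>E. cell j0 (exponent_vector e)) \<in> lmeasurable"
    using assms(1) m by auto
  have "pairwise (\<lambda>e e'. disjnt (cell j0 (exponent_vector e)) (cell j0 (exponent_vector e'))) E"
    unfolding pairwise_def disjnt_def
  proof (intro ballI impI, rule ccontr)
    fix e e' assume e: "e \<in> E" "e' \<in> E" "e \<noteq> e'"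
      and "cell j0 (exponent_vector e) \<inter> cell j0 (exponent_vector e') \<noteq> {}"
    then obtain x where x: "x \<in> cell j0 (exponent_vector e)" "x \<in> cell j0 (exponent_vector e')" by blast
    have ne: "lookup e j = lookup e' j" if "j \<noteq> j0" for j
    proof -
      have "real (lookup e j) \<le> x $ j" "x $ j < real (lookup e j) + 1"
        "real (lookup e' j) \<le> x $ j" "x $ j < real (lookup e' j) + 1"
        using x that by (auto simp: cell_def exponent_vector_nth)
      then show ?thesis by linarith
    qed
    have "monomial_degree f = lookup f j0 + (\<Sum>j\<in>UNIV - {j0}. lookup f j)" for f :: "'n \<Rightarrow>\<^sub>0 nat"
      unfolding monomial_degree_def by (rule sum.remove) auto
    moreover have "(\<Sum>j\<in>UNIV - {j0}. lookup e j) = (\<Sum>j\<in>UNIV - {j0}. lookup e' j)"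
      by (rule sum.cong) (use ne in auto)
    ultimately have "lookup e j0 = lookup e' j0"
      using assms(2)[OF e(1)] assms(2)[OF e(2)] by simp
    then have "lookup e j = lookup e' j" for j
      using ne by (cases "j = j0") auto
    then show False using e(3) poly_mapping_eqI[of e e'] by blast
  qed
  then have "measure lebesgue (\<Union>e\<in>E. cell j0 (exponent_vector e)) = (\<Sum>e\<in>E. 1)"
    using assms(1) m by (subst measure_UNION') auto
  then show "measure lebesgue (\<Union>e\<in>E. cell j0 (exponent_vector e)) = real (card E)" by simp
qed

text \<open>Coordinate \<open>j0\<close> of the difference is the coordinate sum minus the other
  coordinates, hence at most n + 1 in absolute value; the others add at most n to the l1
  norm.\<close>

lemma norm_cell_diff:
  fixes x :: "real ^ 'n"
  assumes "x \<in> cell j0 p"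
  shows "norm (x - p) \<le> 2 * real CARD('n) + 1"
proof -
  let ?y = "x - p"
  have y: "\<And>j. j \<noteq> j0 \<Longrightarrow> 0 \<le> ?y $ j \<and> ?y $ j < 1" "0 \<le> coord_sum ?y" "coord_sum ?y < 1"
    using assms by (fastforce simp: cell_def)+
  have s: "(\<Sum>j\<in>UNIV - {j0}. \<bar>?y $ j\<bar>) \<le> (\<Sum>j\<in>UNIV - {j0}. 1)"
  proof (rule sum_mono)
    fix j assume "j \<in> UNIV - {j0}"
    then show "\<bar>?y $ j\<bar> \<le> 1" using y(1)[of j] by (simp del: vector_minus_component)
  qed
  have "\<bar>?y $ j0\<bar> \<le> \<bar>coord_sum ?y\<bar> + \<bar>\<Sum>j\<in>UNIV - {j0}. ?y $ j\<bar>"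
    using coord_sum_split[of ?y j0] by linarith
  moreover have "\<bar>\<Sum>j\<in>UNIV - {j0}. ?y $ j\<bar> \<le> (\<Sum>j\<in>UNIV - {j0}. \<bar>?y $ j\<bar>)" by (rule sum_abs)
  moreover have "(\<Sum>j\<in>UNIV. \<bar>?y $ j\<bar>) = \<bar>?y $ j0\<bar> + (\<Sum>j\<in>UNIV - {j0}. \<bar>?y $ j\<bar>)"
    by (rule sum.remove) auto
  moreover have "(\<Sum>j\<in>UNIV - {j0}. 1::real) \<le> real CARD('n)" by simp
  moreover have "norm ?y \<le> (\<Sum>j\<in>UNIV. \<bar>?y $ j\<bar>)" by (rule norm_le_l1_cart)
  ultimately show ?thesis using s y by linarith
qed

definition thicken :: "(real ^ 'n) set \<Rightarrow> real \<Rightarrow> (real ^ 'n) set" where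
  "thicken K r = {k + b | k b. k \<in> K \<and> b \<in> cball 0 r}"

lemma compact_thicken: "compact K \<Longrightarrow> compact (thicken K r)"
  unfolding thicken_def by (intro compact_sums compact_cball)

text \<open>The slabs decrease and have finite measure, so continuity from above applies. Their
  intersection is the slab over \<open>K\<close> because the projection of \<open>K\<close> is
  closed and \<open>flatten\<close> is Lipschitz.\<close>

lemma tendsto_slab_volume_thicken:
  fixes K :: "(real ^ 'n) set"
  assumes K: "compact K" and R: "0 \<le> R"
  shows "(\<lambda>t. slab_volume (thicken K (R / real (Suc t)))) \<longlonglongrightarrow> slab_volume K"
proof -
  define A where "A = (\<lambda>t. slab (thicken K (R / real (Suc t))) 0 1)"
  have m: "A t \<in> lmeasurable" for t unfolding A_def by (intro lmeasurable_slab compact_thicken K)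
  have "bounded_linear (flatten :: real ^ 'n \<Rightarrow> real ^ 'n)"
    using linear_flatten by (simp add: linear_conv_bounded_linear)
  then obtain C where C: "C > 0" "\<And>b :: real ^ 'n. norm (flatten b) \<le> norm b * C"
    using bounded_linear.pos_bounded by blast
  have "decseq A"
    unfolding decseq_def
  proof (intro allI impI)
    fix a b :: nat assume "a \<le> b"
    then have "R / real (Suc b) \<le> R / real (Suc a)" using R by (intro divide_left_mono) auto
    then have "thicken K (R / real (Suc b)) \<subseteq> thicken K (R / real (Suc a))"
      unfolding thicken_def by fastforce
    then show "A b \<subseteq> A a" unfolding A_def slab_def by auto
  qed
  moreover have "range A \<subseteq> sets lebesgue" using m by auto
  moreover have "emeasure lebesgue (A t) \<noteq> \<infinity>" for t using m[of t] by (auto simp: fmeasurable_def)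
  ultimately have "(\<lambda>t. measure lebesgue (A t)) \<longlonglongrightarrow> measure lebesgue (\<Inter>t. A t)"
    by (intro Lim_measure_decseq)
  moreover have "(\<Inter>t. A t) = slab K 0 1"
  proof (intro equalityI subsetI)
    fix x assume x: "x \<in> (\<Inter>t. A t)"
    have "closed (flatten ` K)"
      by (intro compact_imp_closed compact_continuous_image continuous_intros K)
    moreover have "\<exists>y\<in>flatten ` K. dist y (flatten x) < e" if e: "e > 0" for e
    proof -
      obtain t :: nat where t: "C * R / e < real t" using reals_Archimedean2 by blast
      have "x \<in> A t" using x by blast
      then obtain k b where kb: "k \<in> K" "norm b \<le> R / real (Suc t)" "flatten x = flatten (k + b)"
        by (auto simp: A_def slab_def thicken_def)
      have "dist (flatten k) (flatten x) = norm (flatten b)"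
        unfolding kb(3) linear_add[OF linear_flatten] by (simp add: dist_norm)
      also have "\<dots> \<le> R / real (Suc t) * C"
        by (rule order_trans[OF C(2)]) (use C(1) kb(2) in \<open>intro mult_right_mono; simp\<close>)
      also have "\<dots> < e"
      proof -
        have "C * R < real t * e" using t e by (simp add: field_simps)
        also have "\<dots> \<le> real (Suc t) * e" using e by simp
        finally show ?thesis by (simp add: field_simps del: of_nat_Suc)
      qed
      finally show ?thesis using kb(1) by blast
    qed
    ultimately have "flatten x \<in> flatten ` K" using closed_approachable[of "flatten ` K" "flatten x"] by blast
    moreover have "x \<in> A 0" using x by blast
    ultimately show "x \<in> slab K 0 1" by (auto simp: A_def slab_def)
  next
    fix x assume x: "x \<in> slab K 0 1"
    have "K \<subseteq> thicken K (R / real (Suc t))" for t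
      unfolding thicken_def using R by (force intro: exI[of _ 0])
    then show "x \<in> (\<Inter>t. A t)" using x unfolding A_def slab_def by blast
  qed
  ultimately show ?thesis by (simp add: A_def slab_volume_def)
qed

text \<open>The index set \<open>X\<close> represents the disjoint union of the blocks: a monomial
  that occurs in several blocks can have an index in each of them.\<close>

locale monomial_system =
  fixes X :: "nat set" and \<tau> :: "nat \<Rightarrow> nat" and s :: nat and \<xi> :: "nat \<Rightarrow> 'n::finite \<Rightarrow>\<^sub>0 nat" and d :: "nat \<Rightarrow> nat"
  assumes finite_X: "finite X" and image_X: "\<tau> ` X = {..s}"
    and degree: "\<And>x. x \<in> X \<Longrightarrow> monomial_degree (\<xi> x) = d (\<tau> x)"
    and block_0: "\<xi> ` {x \<in> X. \<tau> x = 0} = variables"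
begin

abbreviation "E \<equiv> sumset X \<tau> s \<xi>"
abbreviation "K \<equiv> minkowski X \<tau> s \<xi>"

lemma image_X': "\<tau> ` X \<subseteq> {..s}" using image_X by simp

lemma finite_E: "finite (E u)"
  by (rule finite_sumset[OF finite_X image_X'])

lemma degree_E: "e \<in> E u \<Longrightarrow> monomial_degree e = (\<Sum>i\<le>s. u i * d i)"
  by (rule monomial_degree_sumset[where d = d, OF finite_X image_X' degree])

lemma coord_sum_K:
  assumes "k \<in> K u"
  shows "coord_sum k = real (\<Sum>i\<le>s. u i * d i)"
proof -
  obtain l where l: "k = real_combination X \<xi> l" "\<forall>i\<le>s. block_sum X \<tau> l i = real (u i)"
    using assms unfolding minkowski_def by blast
  have "coord_sum k = (\<Sum>x\<in>X. l x * real (d (\<tau> x)))"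
    by (simp add: l(1) real_combination_def coord_sum_sum coord_sum_exponent_vector degree)
  also have "\<dots> = (\<Sum>i\<le>s. block_sum X \<tau> l i * real (d i))"
    by (rule sum_block[OF finite_X image_X'])
  finally show ?thesis using l(2) by simp
qed

text \<open>Shrinking the coefficients of a point of the sumset block by block moves it into
  \<open>t\<close> times \<open>K u\<close>, and each coefficient loses at most
  \<open>c (\<tau> x)\<close>. The first summand of \<open>R\<close> bounds this displacement and
  the second one the size of a cell, so all cells lie in a slab over a dilated neighbourhood of
  \<open>K u\<close>.\<close>

lemma card_E_upper:
  assumes t: "t > 0" and R: "R = (\<Sum>x\<in>X. real (c (\<tau> x)) * norm (exponent_vector (\<xi> x))) + (2 * real CARD('n) + 1)"
  shows "real (card (E (\<lambda>i. t * u i + c i))) \<le> real t ^ (CARD('n) - 1) * slab_volume (thicken (K u) (R / real t))"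
proof -
  let ?v = "\<lambda>i. t * u i + c i"
  let ?D = "real (\<Sum>i\<le>s. ?v i * d i)"
  let ?S = "(*\<^sub>R) (real t) ` thicken (K u) (R / real t)"
  have cS: "compact (thicken (K u) (R / real t))"
    by (intro compact_thicken compact_minkowski finite_X image_X)
  then have cS': "compact ?S" by (rule compact_scaling)
  fix j0 :: 'n
  have "(\<Union>e\<in>E ?v. cell j0 (exponent_vector e)) \<subseteq> slab ?S (0 + ?D) (1 + ?D)"
  proof
    fix x assume "x \<in> (\<Union>e\<in>E ?v. cell j0 (exponent_vector e))"
    then obtain e where e: "e \<in> E ?v" and x: "x \<in> cell j0 (exponent_vector e)" by blast
    obtain y where y: "y \<in> graded_piece X \<tau> s ?v" and ey: "e = combination X \<xi> (lookup y)"
      using e by (auto simp: sumset_def)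
    \<comment> \<open>The factor corrects the block sum from \<open>?v i\<close> to
      \<open>t * u i\<close>. If \<open>?v i\<close> is 0, the quotient is 0 by convention, which is
      consistent since all coefficients of the block are then 0.\<close>
    define l where "l = (\<lambda>x. real (lookup y x) * (real (t * u (\<tau> x)) / real (?v (\<tau> x))))"
    define k where "k = real_combination X \<xi> l"
    have "k \<in> K (\<lambda>i. t * u i)"
      unfolding k_def
    proof (rule minkowskiI)
      fix i assume i: "i \<le> s"
      have "block_sum X \<tau> l i = (\<Sum>x | x \<in> X \<and> \<tau> x = i. real (lookup y x)) * (real (t * u i) / real (?v i))"
        unfolding block_sum_def l_def sum_distrib_right by (rule sum.cong) auto
      also have "(\<Sum>x | x \<in> X \<and> \<tau> x = i. real (lookup y x)) = real (?v i)"
        using y i unfolding graded_piece_def block_sum_def by (simp flip: of_nat_sum)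
      finally have eq: "block_sum X \<tau> l i = real (?v i) * (real (t * u i) / real (?v i))" .
      show "block_sum X \<tau> l i = real (t * u i)"
      proof (cases "?v i = 0")
        case True
        then have "t * u i = 0" by simp
        then show ?thesis unfolding eq by (simp del: of_nat_add of_nat_mult)
      next
        case False
        then show ?thesis unfolding eq by (simp del: of_nat_add of_nat_mult)
      qed
    qed (simp add: l_def)
    then obtain k0 where k0: "k0 \<in> K u" "k = real t *\<^sub>R k0"
      unfolding minkowski_scale[OF t] by blast
    have diff: "0 \<le> real (lookup y x) - l x" "real (lookup y x) - l x \<le> real (c (\<tau> x))" if x: "x \<in> X" for x
    proof -
      let ?i = "\<tau> x"
      have i: "?i \<le> s" using x image_X' by auto
      have "lookup y x \<le> block_sum X \<tau> (lookup y) ?i"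
        unfolding block_sum_def using x finite_X by (intro member_le_sum) auto
      then have yv: "lookup y x \<le> ?v ?i" using y i by (simp add: graded_piece_def)
      show "0 \<le> real (lookup y x) - l x" "real (lookup y x) - l x \<le> real (c (\<tau> x))"
      proof (atomize (full), cases "?v ?i = 0")
        case True
        then show "0 \<le> real (lookup y x) - l x \<and> real (lookup y x) - l x \<le> real (c (\<tau> x))"
        proof -
          have "t * u ?i = 0" "lookup y x = 0" using True yv by linarith+
          then show ?thesis by (simp add: l_def)
        qed
      next
        case False
        have "real (lookup y x) - l x = real (lookup y x) / real (?v ?i) * real (c ?i)"
        proof -
          define V where "V = real (?v ?i)"
          have V: "V \<noteq> 0" "real (t * u ?i) = V - real (c ?i)" using False unfolding V_def by (simp only: of_nat_eq_0_iff not_False_eq_True, simp)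
          show ?thesis unfolding l_def V_def[symmetric] V(2) using V(1) by (simp add: field_simps)
        qed
        moreover have "real (lookup y x) / real (?v ?i) \<le> 1"
          using yv False by (simp add: divide_le_eq_1 del: of_nat_add of_nat_mult)
        ultimately show "0 \<le> real (lookup y x) - l x \<and> real (lookup y x) - l x \<le> real (c (\<tau> x))"
          using mult_left_le_one_le[of "real (c ?i)" "real (lookup y x) / real (?v ?i)"]
          by (simp del: of_nat_add of_nat_mult)
      qed
    qed
    have "exponent_vector e - k = (\<Sum>x\<in>X. (real (lookup y x) - l x) *\<^sub>R exponent_vector (\<xi> x))"
      unfolding ey exponent_vector_combination k_def real_combination_def
      by (simp add: scaleR_diff_left sum_subtractf)
    also have "norm \<dots> \<le> (\<Sum>x\<in>X. real (c (\<tau> x)) * norm (exponent_vector (\<xi> x)))"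
      by (rule order_trans[OF norm_sum], rule sum_mono) (use diff in \<open>auto intro: mult_right_mono\<close>)
    finally have "norm (exponent_vector e - k) \<le> (\<Sum>x\<in>X. real (c (\<tau> x)) * norm (exponent_vector (\<xi> x)))" .
    then have "norm (x - k) \<le> R"
      using norm_cell_diff[OF x] norm_triangle_ineq[of "x - exponent_vector e" "exponent_vector e - k"]
      unfolding R by simp
    then have "norm (inverse (real t) *\<^sub>R (x - k)) \<le> R / real t"
      unfolding norm_scaleR using t by (simp add: field_simps)
    then have "k0 + inverse (real t) *\<^sub>R (x - k) \<in> thicken (K u) (R / real t)"
      using k0(1) unfolding thicken_def
      by (intro CollectI exI[of _ k0] exI[of _ "inverse (real t) *\<^sub>R (x - k)"]) (simp add: divide_inverse)
    moreover have "x = real t *\<^sub>R (k0 + inverse (real t) *\<^sub>R (x - k))"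
      using t by (simp add: algebra_simps k0(2))
    ultimately have "x \<in> ?S" by blast
    moreover have "?D \<le> coord_sum x" "coord_sum x < ?D + 1"
      using x unfolding cell_def coord_sum_exponent_vector degree_E[OF e] by simp_all
    ultimately show "x \<in> slab ?S (0 + ?D) (1 + ?D)" unfolding slab_def by (simp add: add.commute)
  qed
  then have "measure lebesgue (\<Union>e\<in>E ?v. cell j0 (exponent_vector e)) \<le> measure lebesgue (slab ?S (0 + ?D) (1 + ?D))"
    by (intro measure_mono_fmeasurable lmeasurable_slab cS'
        fmeasurableD[OF lmeasurable_Union_cells[OF finite_E degree_E]])
  also have "\<dots> = slab_volume ?S" unfolding slab_volume_def measure_slab_shift ..
  also have "\<dots> = real t ^ (CARD('n) - 1) * slab_volume (thicken (K u) (R / real t))"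
    by (rule slab_volume_scale[OF cS t])
  finally show ?thesis
    using measure_Union_cells[OF finite_E degree_E] by simp
qed

lemma degree_0: "d 0 = 1"
proof -
  fix j :: 'n
  have "single j 1 \<in> \<xi> ` {x \<in> X. \<tau> x = 0}" unfolding block_0 by (simp add: variables_def)
  then obtain x where x: "x \<in> X" "\<tau> x = 0" "\<xi> x = single j 1" by auto
  then show ?thesis using degree[OF x(1)] by (simp add: monomial_degree_single)
qed

text \<open>A monomial of degree \<open>k\<close> is a product of \<open>k\<close> variables. Block
  0 can thus supply any nonnegative remainder, and only its degree has to be controlled.\<close>

lemma mem_E_degree:
  "monomial_degree q = k \<Longrightarrow> q \<in> E (\<lambda>i. if i = 0 then k else 0)"
proof (induction k arbitrary: q)
  case 0
  then have "q = 0" by (simp add: monomial_degree_eq_0_iff)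
  then show ?case using sumset_zero[OF finite_X image_X', of "\<lambda>i. if i = 0 then 0 else 0" \<xi>] by simp
next
  case (Suc k)
  then have "q \<noteq> 0" by (auto simp: monomial_degree_eq_0_iff[symmetric])
  then obtain j where j: "lookup q j \<noteq> 0" using poly_mapping_eqI[of q 0] by auto
  let ?j = "single j (1::nat)"
  have q: "q = ?j + (q - ?j)"
    by (rule poly_mapping_eqI) (use j in \<open>auto simp: lookup_add lookup_minus lookup_single when_def\<close>)
  then have "monomial_degree (q - ?j) = k"
    using Suc.prems monomial_degree_add[of ?j "q - ?j"] by (simp add: monomial_degree_single)
  then have "q - ?j \<in> E (\<lambda>i. if i = 0 then k else 0)" by (rule Suc.IH)
  moreover have "?j \<in> \<xi> ` {x \<in> X. \<tau> x = 0}" unfolding block_0 by (simp add: variables_def)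
  ultimately have "q \<in> \<xi> ` {x \<in> X. \<tau> x = 0} + E (\<lambda>i. if i = 0 then k else 0)"
    by (subst q) (rule set_plus_intro)
  also have "\<dots> = E ((\<lambda>i. if i = 0 then k else 0)(0 := Suc k))"
    using sumset_Suc[OF finite_X, of 0 s \<tau> \<xi> "\<lambda>i. if i = 0 then k else 0"] by simp
  also have "(\<lambda>i. if i = 0 then k else 0)(0 := Suc k) = (\<lambda>i. if i = 0 then Suc k else 0)" by auto
  finally show ?case .
qed

text \<open>Rounding down the coefficients of a point of \<open>K v\<close> leaves a nonnegative remainder, which
  is a sum of variables; the shift by \<open>w\<close> makes room for the roundings in the other blocks.\<close>

lemma slab_subset_cells:
  fixes N :: nat and j0 :: 'n
  obtains c w where "\<And>i. i \<le> s \<Longrightarrow> N \<le> c i"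
    and "\<And>v. (+) w ` slab (K v) (real (\<Sum>i\<le>s. v i * d i)) (real (\<Sum>i\<le>s. v i * d i) + 1)
           \<subseteq> (\<Union>e\<in>E (\<lambda>i. v i + c i). cell j0 (exponent_vector e))"
proof -
  let ?bs = "block_sum X \<tau>"
  have "\<forall>i. \<exists>x. i \<le> s \<longrightarrow> x \<in> X \<and> \<tau> x = i"
  proof
    fix i
    show "\<exists>x. i \<le> s \<longrightarrow> x \<in> X \<and> \<tau> x = i"
    proof (cases "i \<le> s")
      case True
      then have "i \<in> \<tau> ` X" by (simp add: image_X)
      then show ?thesis by auto
    qed simp
  qed
  \<comment> \<open>One chosen monomial per block; its copies make up for the loss caused by
    rounding in that block.\<close>
  then obtain a where "\<forall>i. i \<le> s \<longrightarrow> a i \<in> X \<and> \<tau> (a i) = i" by (rule choice[THEN exE])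
  then have a: "\<And>i. i \<le> s \<Longrightarrow> a i \<in> X \<and> \<tau> (a i) = i" by blast
  define L where "L = card X"
  \<comment> \<open>In coordinate \<open>j\<close> there must be room for the loss of at most 1 in
    passing to a lattice point and for up to \<open>N + L\<close> copies of each \<open>a i\<close>,
    where \<open>L\<close> bounds the rounding loss of a block. The further summand \<open>N\<close>
    adds to the offset of block 0.\<close>
  define W where "W = (\<lambda>j. N + 1 + (\<Sum>i\<in>{1..s}. (N + L) * lookup (\<xi> (a i)) j))"
  define w :: "real ^ 'n" where "w = (\<chi> j. real (W j))"
  \<comment> \<open>Chosen so that the coordinate sum of \<open>w\<close> equals the degree
    contributed by the offset \<open>c\<close>; as \<open>d 0 = 1\<close>, block 0 can take whatever
    the others leave.\<close>
  define c where "c = (\<lambda>i::nat. if i = 0 then CARD('n) * (N + 1) + L * (\<Sum>i\<in>{1..s}. d i) else N)"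
  have split_s: "(\<Sum>i\<le>s. F i) = F 0 + (\<Sum>i\<in>{1..s}. F i)" for F :: "nat \<Rightarrow> nat"
  proof -
    have "{..s} = insert 0 {1..s}" by auto
    then show ?thesis by simp
  qed
  have sumW: "(\<Sum>j\<in>UNIV. W j) = (\<Sum>i\<le>s. c i * d i)"
  proof -
    have "(\<Sum>j\<in>UNIV. W j) = CARD('n) * (N + 1) + (\<Sum>i\<in>{1..s}. (N + L) * (\<Sum>j\<in>UNIV. lookup (\<xi> (a i)) j))"
      unfolding W_def sum.distrib by (subst sum.swap) (simp add: sum_distrib_left)
    also have "(\<Sum>i\<in>{1..s}. (N + L) * (\<Sum>j\<in>UNIV. lookup (\<xi> (a i)) j)) = (\<Sum>i\<in>{1..s}. (N + L) * d i)"
    proof (rule sum.cong)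
      fix i assume "i \<in> {1..s}"
      then show "(N + L) * (\<Sum>j\<in>UNIV. lookup (\<xi> (a i)) j) = (N + L) * d i"
        using degree[of "a i"] a[of i] by (simp add: monomial_degree_def)
    qed simp
    also have "\<dots> = L * (\<Sum>i\<in>{1..s}. d i) + (\<Sum>i\<in>{1..s}. N * d i)"
      by (simp add: distrib_right sum.distrib sum_distrib_left)
    also have "(\<Sum>i\<in>{1..s}. N * d i) = (\<Sum>i\<in>{1..s}. c i * d i)"
      by (rule sum.cong) (auto simp: c_def)
    finally show ?thesis unfolding split_s by (simp add: c_def degree_0)
  qed
  have cs_w: "coord_sum w = real (\<Sum>i\<le>s. c i * d i)"
    unfolding sumW[symmetric] by (simp add: coord_sum_def w_def)
  have "N \<le> c i" for i
  proof -
    have "1 * N \<le> CARD('n) * (N + 1)" by (intro mult_mono) (auto simp: Suc_le_eq)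
    then show ?thesis by (auto simp: c_def)
  qed
  moreover have "(+) w ` slab (K v) (real (\<Sum>i\<le>s. v i * d i)) (real (\<Sum>i\<le>s. v i * d i) + 1)
           \<subseteq> (\<Union>e\<in>E (\<lambda>i. v i + c i). cell j0 (exponent_vector e))" for v
  proof
    let ?D = "\<Sum>i\<le>s. v i * d i"
    let ?C = "\<Sum>i\<le>s. c i * d i"
    fix x assume "x \<in> (+) w ` slab (K v) (real ?D) (real ?D + 1)"
    then obtain z where x: "x = w + z" and z: "z \<in> slab (K v) (real ?D) (real ?D + 1)" by blast
    then obtain k where k: "k \<in> K v" "flatten z = flatten k" and zD: "real ?D \<le> coord_sum z" "coord_sum z < real ?D + 1"
      by (auto simp: slab_def)
    \<comment> \<open>\<open>z\<close> and \<open>k\<close> have the same projection, and the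
      coordinate sum of \<open>z\<close> is at least that of \<open>k\<close>; their difference is
      thus a nonnegative multiple of (1, ..., 1).\<close>
    have z_ge: "k $ j \<le> z $ j" for j
    proof -
      have "z - k = ((coord_sum z - coord_sum k) / real CARD('n)) *\<^sub>R 1"
        using k(2) unfolding flatten_def by (simp add: algebra_simps diff_divide_distrib scaleR_diff_left)
      from arg_cong[OF this, of "\<lambda>y. y $ j"]
      have "z $ j - k $ j = (coord_sum z - coord_sum k) / real CARD('n)" by simp
      moreover have "0 \<le> (coord_sum z - coord_sum k) / real CARD('n)"
        using zD(1) coord_sum_K[OF k(1)] by simp
      ultimately show ?thesis by linarith
    qed
    obtain l where l: "k = real_combination X \<xi> l" "\<forall>x\<in>X. 0 \<le> l x" "\<forall>i\<le>s. ?bs l i = real (v i)"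
      using k(1) unfolding minkowski_def by blast
    have csx: "real (?D + ?C) \<le> coord_sum x" "coord_sum x < real (?D + ?C) + 1"
      using zD cs_w unfolding x by simp_all
    \<comment> \<open>The lattice point whose cell contains \<open>x\<close>: floors away from
      \<open>j0\<close>, and at \<open>j0\<close> the entry forced by the coordinate sum. Each entry
      is at least that of \<open>x\<close> minus 1, for \<open>j0\<close> because the coordinate sum
      of \<open>x\<close> exceeds the degree by less than 1.\<close>
    define f where "f = (\<lambda>j. if j = j0 then int (?D + ?C) - (\<Sum>j\<in>UNIV - {j0}. \<lfloor>x $ j\<rfloor>) else \<lfloor>x $ j\<rfloor>)"
    have f_ge: "x $ j - 1 \<le> real_of_int (f j)" for j
    proof (cases "j = j0")
      case True
      have "(\<Sum>j\<in>UNIV - {j0}. real_of_int \<lfloor>x $ j\<rfloor>) \<le> (\<Sum>j\<in>UNIV - {j0}. x $ j)"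
        by (intro sum_mono) simp
      then have "x $ j0 - 1 \<le> real (?D + ?C) - (\<Sum>j\<in>UNIV - {j0}. real_of_int \<lfloor>x $ j\<rfloor>)"
        using csx(2) coord_sum_split[of x j0] by linarith
      then show ?thesis using True by (simp add: f_def)
    next
      case False
      then have "real_of_int (f j) = real_of_int \<lfloor>x $ j\<rfloor>" by (simp add: f_def)
      then show ?thesis by linarith
    qed
    have sum_f: "(\<Sum>j\<in>UNIV. f j) = int (?D + ?C)"
    proof -
      have "(\<Sum>j\<in>UNIV. f j) = f j0 + (\<Sum>j\<in>UNIV - {j0}. f j)" by (rule sum.remove) auto
      also have "(\<Sum>j\<in>UNIV - {j0}. f j) = (\<Sum>j\<in>UNIV - {j0}. \<lfloor>x $ j\<rfloor>)"
        by (rule sum.cong) (auto simp: f_def)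
      finally show ?thesis by (simp add: f_def)
    qed
    define g where "g = (\<lambda>x. nat \<lfloor>l x\<rfloor>)"
    have g: "real (g x) \<le> l x" "l x \<le> real (g x) + 1" if "x \<in> X" for x
      using l(2) that by (auto simp: g_def)
    have bg: "?bs g i \<le> v i" "v i \<le> ?bs g i + L" if i: "i \<le> s" for i
    proof -
      have "real (?bs g i) \<le> ?bs l i"
        unfolding block_sum_def of_nat_sum by (rule sum_mono) (use g in auto)
      then show "?bs g i \<le> v i" using l(3) i by simp
      have "?bs l i \<le> (\<Sum>x | x \<in> X \<and> \<tau> x = i. real (g x) + 1)"
        unfolding block_sum_def by (rule sum_mono) (use g in auto)
      also have "\<dots> = real (?bs g i) + real (card {x \<in> X. \<tau> x = i})"
        by (simp add: sum.distrib block_sum_def)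
      also have "card {x \<in> X. \<tau> x = i} \<le> L" unfolding L_def using finite_X by (intro card_mono) auto
      finally have "real (v i) \<le> real (?bs g i + L)" using l(3) i by simp
      then show "v i \<le> ?bs g i + L" by linarith
    qed
    \<comment> \<open>The loss of block \<open>i\<close> through rounding, less than or equal to the
      number of indices.\<close>
    define r where "r = (\<lambda>i. v i - ?bs g i)"
    have r: "r i \<le> L" "?bs g i + r i = v i" if "i \<le> s" for i
      using bg[OF that] by (auto simp: r_def)
    \<comment> \<open>Copies of \<open>a i\<close> raise the block sum to \<open>v i + N\<close>,
      which is \<open>v i + c i\<close>, in every block except block 0; there the variables in
      \<open>q\<close> will do it.\<close>
    define h where "h = (\<lambda>x. if \<tau> x \<noteq> 0 \<and> x = a (\<tau> x) then N + r (\<tau> x) else 0)"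
    define y where "y = (\<lambda>x. g x + h x)"
    have inner: "(\<Sum>x | x \<in> X \<and> \<tau> x = i. h x * F x) = (if i = 0 then 0 else (N + r i) * F (a i))"
      if i: "i \<le> s" for i and F :: "nat \<Rightarrow> nat"
    proof -
      have "(\<Sum>x | x \<in> X \<and> \<tau> x = i. h x * F x) = (\<Sum>x | x \<in> X \<and> \<tau> x = i. if x = a i then (if i = 0 then 0 else (N + r i) * F (a i)) else 0)"
        by (rule sum.cong) (auto simp: h_def)
      then show ?thesis using a[OF i] finite_X by (simp add: sum.delta)
    qed
    have block_y: "?bs y i = ?bs g i + (if i = 0 then 0 else N + r i)" if "i \<le> s" for i
      using inner[OF that, of "\<lambda>_. 1"] by (simp add: block_sum_def y_def sum.distrib)
    have hW: "(\<Sum>x\<in>X. h x * lookup (\<xi> x) j) + N + 1 \<le> W j" for j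
    proof -
      have "(\<Sum>x\<in>X. h x * lookup (\<xi> x) j) = (\<Sum>i\<le>s. \<Sum>x | x \<in> X \<and> \<tau> x = i. h x * lookup (\<xi> x) j)"
        using finite_X image_X' by (intro sum.group[symmetric]) auto
      also have "\<dots> = (\<Sum>i\<le>s. if i = 0 then 0 else (N + r i) * lookup (\<xi> (a i)) j)"
        by (rule sum.cong) (use inner in auto)
      also have "\<dots> = (\<Sum>i\<in>{1..s}. (N + r i) * lookup (\<xi> (a i)) j)"
      proof -
        have "(\<Sum>i\<in>{1..s}. if i = 0 then 0 else (N + r i) * lookup (\<xi> (a i)) j) =
            (\<Sum>i\<in>{1..s}. (N + r i) * lookup (\<xi> (a i)) j)"
          by (rule sum.cong) auto
        then show ?thesis unfolding split_s by simp
      qed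
      also have "\<dots> \<le> (\<Sum>i\<in>{1..s}. (N + L) * lookup (\<xi> (a i)) j)"
        using r(1) by (intro sum_mono mult_right_mono) auto
      finally show ?thesis by (simp add: W_def)
    qed
    have gk: "(\<Sum>x\<in>X. real (g x * lookup (\<xi> x) j)) \<le> k $ j" for j
    proof -
      have "(\<Sum>x\<in>X. real (g x * lookup (\<xi> x) j)) \<le> (\<Sum>x\<in>X. l x * real (lookup (\<xi> x) j))"
        unfolding of_nat_mult by (intro sum_mono mult_right_mono) (use g in auto)
      also have "\<dots> = k $ j" by (simp add: l(1) real_combination_def exponent_vector_nth)
      finally show ?thesis .
    qed
    let ?b = "combination X \<xi> y"
    have b_le: "int (lookup ?b j) \<le> f j" for j
    proof -
      have "lookup ?b j = (\<Sum>x\<in>X. g x * lookup (\<xi> x) j) + (\<Sum>x\<in>X. h x * lookup (\<xi> x) j)"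
        by (simp add: lookup_combination y_def distrib_right sum.distrib)
      moreover have "real (\<Sum>x\<in>X. h x * lookup (\<xi> x) j) + 1 \<le> w $ j"
        using hW[of j] by (simp add: w_def del: of_nat_sum)
      moreover have "real (\<Sum>x\<in>X. g x * lookup (\<xi> x) j) \<le> z $ j"
        using gk[of j] z_ge[of j] by simp
      moreover have "x $ j = w $ j + z $ j" by (simp add: x)
      ultimately have "real (lookup ?b j) \<le> real_of_int (f j)"
        using f_ge[of j] by linarith
      then show ?thesis by linarith
    qed
    \<comment> \<open>By \<open>b_le\<close> the subtraction is not truncated: \<open>q\<close> is
      the exact remainder, hence a product of variables.\<close>
    define q where "q = Abs_poly_mapping (\<lambda>j. nat (f j) - lookup ?b j)"
    have q: "lookup q j = nat (f j) - lookup ?b j" for j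
      by (simp add: q_def)
    define e where "e = ?b + q"
    have e: "int (lookup e j) = f j" for j
      using b_le[of j] by (simp add: e_def lookup_add q)
    have "int (monomial_degree e) = int (?D + ?C)"
      by (simp only: monomial_degree_def of_nat_sum e sum_f)
    then have deg_e: "monomial_degree e = ?D + ?C" by linarith
    let ?u = "\<lambda>i. ?bs y i + (if i = 0 then monomial_degree q else 0)"
    have mem: "e \<in> E ?u"
      unfolding e_def by (intro sumset_add combination_in_sumset finite_X mem_E_degree refl)
    have u1: "?u i = v i + c i" if "i \<in> {1..s}" for i
      using that by (simp add: block_y r c_def)
    \<comment> \<open>The degree of \<open>q\<close> need not be computed: the total degree is
      known, all blocks but 0 agree with \<open>v i + c i\<close>, and \<open>d 0 = 1\<close> then
      forces block 0.\<close>
    have "?u 0 + (\<Sum>i\<in>{1..s}. ?u i * d i) = (v 0 + c 0) + (\<Sum>i\<in>{1..s}. (v i + c i) * d i)"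
      using degree_E[OF mem] deg_e unfolding split_s degree_0 by (simp add: distrib_right sum.distrib)
    moreover have "(\<Sum>i\<in>{1..s}. ?u i * d i) = (\<Sum>i\<in>{1..s}. (v i + c i) * d i)"
      by (rule sum.cong) (use u1 in auto)
    ultimately have "?u 0 = v 0 + c 0" by linarith
    then have "?u i = v i + c i" if "i \<le> s" for i using u1 that by (cases "i = 0") auto
    then have "e \<in> E (\<lambda>i. v i + c i)" using mem sumset_cong[of s ?u "\<lambda>i. v i + c i"] by blast
    moreover have "x \<in> cell j0 (exponent_vector e)"
    proof -
      have "real (lookup e j) = real_of_int \<lfloor>x $ j\<rfloor>" if "j \<noteq> j0" for j
        using e[of j] that by (simp add: f_def)
      then show ?thesis
        using csx unfolding cell_def coord_sum_exponent_vector deg_e by (simp add: exponent_vector_nth)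
    qed
    ultimately show "x \<in> (\<Union>e\<in>E (\<lambda>i. v i + c i). cell j0 (exponent_vector e))" by blast
  qed
  ultimately show ?thesis by (intro that[of c w]) auto
qed

text \<open>The slab inclusion gives a lower bound without error term, as the translation by
  \<open>w\<close> preserves measure; the upper bound involves a neighbourhood of radius
  proportional to 1 / t. The offset does not depend on \<open>u\<close> and can be taken large
  enough for the Hilbert polynomial to apply along the rays.\<close>

theorem card_E_asymptotics:
  obtains c where "\<And>i. i \<le> s \<Longrightarrow> N \<le> c i"
    and "\<And>u. (\<lambda>t. real (card (E (\<lambda>i. t * u i + c i))) / real t ^ (CARD('n) - 1)) \<longlonglongrightarrow> slab_volume (K u)"
proof -
  fix j0 :: 'n
  obtain c w where c: "\<And>i. i \<le> s \<Longrightarrow> N \<le> c i"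
    and sub: "\<And>v. (+) w ` slab (K v) (real (\<Sum>i\<le>s. v i * d i)) (real (\<Sum>i\<le>s. v i * d i) + 1)
           \<subseteq> (\<Union>e\<in>E (\<lambda>i. v i + c i). cell j0 (exponent_vector e))"
    using slab_subset_cells[of N j0] by blast
  have cK: "compact (K u)" for u by (intro compact_minkowski finite_X image_X)
  have "(\<lambda>t. real (card (E (\<lambda>i. t * u i + c i))) / real t ^ (CARD('n) - 1)) \<longlonglongrightarrow> slab_volume (K u)" for u
  proof -
    define R where "R = (\<Sum>x\<in>X. real (c (\<tau> x)) * norm (exponent_vector (\<xi> x))) + (2 * real CARD('n) + 1)"
    have R: "0 \<le> R" unfolding R_def by (intro add_nonneg_nonneg sum_nonneg) auto
    let ?a = "\<lambda>t. real (card (E (\<lambda>i. t * u i + c i))) / real t ^ (CARD('n) - 1)"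
    have "slab_volume (K u) \<le> ?a (Suc t)" for t
    proof -
      let ?v = "\<lambda>i. Suc t * u i"
      let ?D = "real (\<Sum>i\<le>s. ?v i * d i)"
      have "real (Suc t) ^ (CARD('n) - 1) * slab_volume (K u) = slab_volume (K ?v)"
        using minkowski_scale[of "Suc t" X \<tau> s \<xi> u] slab_volume_scale[OF cK[of u], of "Suc t"] by simp
      also have "\<dots> = measure lebesgue (slab (K ?v) (0 + ?D) (1 + ?D))"
        unfolding slab_volume_def measure_slab_shift ..
      also have "\<dots> = measure lebesgue (slab (K ?v) ?D (?D + 1))"
        by (simp add: add.commute)
      also have "\<dots> = measure lebesgue ((+) w ` slab (K ?v) ?D (?D + 1))"
        by (rule measure_translation[symmetric])
      also have "\<dots> \<le> measure lebesgue (\<Union>e\<in>E (\<lambda>i. ?v i + c i). cell j0 (exponent_vector e))"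
        by (rule measure_mono_fmeasurable[OF sub fmeasurableD[OF measurable_translation[OF lmeasurable_slab[OF cK]]]
              lmeasurable_Union_cells[OF finite_E degree_E]])
      also have "\<dots> = real (card (E (\<lambda>i. ?v i + c i)))"
        by (rule measure_Union_cells[OF finite_E degree_E])
      finally show ?thesis by (simp add: field_simps del: of_nat_Suc mult_Suc)
    qed
    moreover have "?a (Suc t) \<le> slab_volume (thicken (K u) (R / real (Suc t)))" for t
      using card_E_upper[OF _ R_def, of "Suc t" u] by (simp add: field_simps del: of_nat_Suc mult_Suc)
    ultimately have "(\<lambda>t. ?a (Suc t)) \<longlonglongrightarrow> slab_volume (K u)"
      by (intro tendsto_sandwich[OF _ _ tendsto_const tendsto_slab_volume_thicken[OF cK R]]) auto
    then show ?thesis by (rule LIMSEQ_imp_Suc)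
  qed
  with c show ?thesis by (rule that)
qed

end

section \<open>Volumes in orthonormal frames\<close>

lemma sum_standard_frame_inner:
  fixes e :: "nat \<Rightarrow> 'e::euclidean_space"
  assumes e: "bij_betw e {..<m} Basis" and j: "j < m"
  shows "(\<Sum>i<m. y i *\<^sub>R e i) \<bullet> e j = y j"
proof -
  have "(\<Sum>i<m. y i *\<^sub>R e i) \<bullet> e j = (\<Sum>i<m. if i = j then y i else 0)"
    unfolding inner_sum_left
  proof (rule sum.cong)
    fix i assume i: "i \<in> {..<m}"
    have "e i \<in> Basis" "e j \<in> Basis" "e i = e j \<longleftrightarrow> i = j"
      using e i j by (auto simp: bij_betw_def inj_on_def)
    then show "y i *\<^sub>R e i \<bullet> e j = (if i = j then y i else 0)" by (simp add: inner_Basis)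
  qed simp
  then show ?thesis using j by simp
qed

text \<open>A box pulls back to a product of intervals, whose product measure is the product of the
  side lengths.\<close>

lemma distr_standard_frame:
  fixes e :: "nat \<Rightarrow> 'e::euclidean_space"
  assumes e: "bij_betw e {..<m} Basis"
  shows "distr (\<Pi>\<^sub>M i\<in>{..<m}. lborel) borel (\<lambda>y. \<Sum>i<m. y i *\<^sub>R e i) = lborel"
proof (rule lborel_eqI[symmetric])
  interpret product_sigma_finite "\<lambda>_::nat. lborel :: real measure" ..
  fix l u :: 'e assume le: "\<And>b. b \<in> Basis \<Longrightarrow> l \<bullet> b \<le> u \<bullet> b"
  have eB: "e i \<in> Basis" if "i < m" for i using e that by (auto simp: bij_betw_def)
  let ?\<Psi> = "\<lambda>y. \<Sum>i<m. y i *\<^sub>R e i"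
  have all: "(\<forall>b\<in>Basis. P b) \<longleftrightarrow> (\<forall>i<m. P (e i))" for P
    unfolding bij_betw_imp_surj_on[OF e, symmetric] by auto
  have "?\<Psi> -` box l u \<inter> space (\<Pi>\<^sub>M i\<in>{..<m}. lborel) = (\<Pi>\<^sub>E i\<in>{..<m}. {l \<bullet> e i<..<u \<bullet> e i})"
  proof (rule set_eqI)
    fix y
    have "?\<Psi> y \<in> box l u \<longleftrightarrow> (\<forall>i<m. l \<bullet> e i < y i \<and> y i < u \<bullet> e i)"
      unfolding mem_box all by (simp only: sum_standard_frame_inner[OF e] cong: all_cong)
    then show "y \<in> ?\<Psi> -` box l u \<inter> space (\<Pi>\<^sub>M i\<in>{..<m}. lborel) \<longleftrightarrow> y \<in> (\<Pi>\<^sub>E i\<in>{..<m}. {l \<bullet> e i<..<u \<bullet> e i})"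
      by (simp add: space_PiM PiE_iff conj_commute Ball_def)
  qed
  then have "emeasure (distr (\<Pi>\<^sub>M i\<in>{..<m}. lborel) borel ?\<Psi>) (box l u)
      = emeasure (\<Pi>\<^sub>M i\<in>{..<m}. lborel) (\<Pi>\<^sub>E i\<in>{..<m}. {l \<bullet> e i<..<u \<bullet> e i})"
    by (subst emeasure_distr) auto
  also have "\<dots> = (\<Prod>i<m. emeasure lborel {l \<bullet> e i<..<u \<bullet> e i})"
    by (rule emeasure_PiM) auto
  also have "\<dots> = (\<Prod>i<m. ennreal ((u - l) \<bullet> e i))"
    by (rule prod.cong) (auto simp: le eB inner_diff_left)
  also have "\<dots> = ennreal (\<Prod>i<m. (u - l) \<bullet> e i)"
    by (rule prod_ennreal) (auto simp: le eB inner_diff_left)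
  also have "(\<Prod>i<m. (u - l) \<bullet> e i) = (\<Prod>b\<in>Basis. (u - l) \<bullet> b)"
    by (rule prod.reindex_bij_betw[OF e])
  finally show "emeasure (distr (\<Pi>\<^sub>M i\<in>{..<m}. lborel) borel ?\<Psi>) (box l u) = ennreal (\<Prod>b\<in>Basis. (u - l) \<bullet> b)" .
qed simp

text \<open>The library proves invariance of Lebesgue measure under orthogonal maps of \<open>real ^ 'n\<close> only for
  well-ordered index types, so an arbitrary finite index type is first replaced by a well-ordered copy.\<close>

typedef 'a ordered_index = "UNIV :: 'a set"
  by simp

instance ordered_index :: (finite) finite
proof
  have "(UNIV :: ('a::finite) ordered_index set) = Abs_ordered_index ` UNIV"
    by (metis Rep_ordered_index_inverse surjI)
  then show "finite (UNIV :: ('a::finite) ordered_index set)"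
    by (rule ssubst) simp
qed

instantiation ordered_index :: (finite) wellorder
begin

definition less_eq_ordered_index :: "'a ordered_index \<Rightarrow> 'a ordered_index \<Rightarrow> bool" where
  "x \<le> y \<longleftrightarrow> to_nat (Rep_ordered_index x) \<le> to_nat (Rep_ordered_index y)"

definition less_ordered_index :: "'a ordered_index \<Rightarrow> 'a ordered_index \<Rightarrow> bool" where
  "x < y \<longleftrightarrow> to_nat (Rep_ordered_index x) < to_nat (Rep_ordered_index y)"

instance
proof
  fix P :: "'a ordered_index \<Rightarrow> bool" and x
  assume "\<And>x. (\<And>y. y < x \<Longrightarrow> P y) \<Longrightarrow> P x"
  then show "P x"
    unfolding less_ordered_index_def
    by (induction x rule: measure_induct[of "\<lambda>x. to_nat (Rep_ordered_index x)"]) blast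
qed (auto simp: less_eq_ordered_index_def less_ordered_index_def Rep_ordered_index_inject)

end

definition reindex :: "real ^ 'n \<Rightarrow> real ^ 'n ordered_index" where
  "reindex x = (\<chi> i. x $ Rep_ordered_index i)"

definition unindex :: "real ^ 'n ordered_index \<Rightarrow> real ^ 'n" where
  "unindex x = (\<chi> i. x $ Abs_ordered_index i)"

lemma reindex_inverse [simp]: "unindex (reindex x) = x" "reindex (unindex y) = y"
  by (simp_all add: reindex_def unindex_def vec_eq_iff Abs_ordered_index_inverse Rep_ordered_index_inverse)

lemma linear_reindex: "linear reindex" and linear_unindex: "linear unindex"
  by (auto intro!: linearI simp: reindex_def unindex_def vec_eq_iff)

lemma sum_ordered_index: "(\<Sum>i\<in>UNIV. f (Rep_ordered_index i)) = (\<Sum>j\<in>UNIV. f j)"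
  by (rule sum.reindex_bij_witness[of _ Abs_ordered_index Rep_ordered_index])
     (auto simp: Abs_ordered_index_inverse Rep_ordered_index_inverse)

lemma inner_reindex: "reindex x \<bullet> reindex y = x \<bullet> y"
  unfolding inner_vec_def reindex_def by (simp add: sum_ordered_index[of "\<lambda>i. x $ i * y $ i"])

lemma borel_measurable_linear: "linear f \<Longrightarrow> f \<in> borel_measurable borel"
  for f :: "'a::euclidean_space \<Rightarrow> 'b::euclidean_space"
  by (auto intro!: borel_measurable_continuous_onI linear_continuous_on simp: linear_conv_bounded_linear)

lemma borel_measurable_reindex [measurable]: "reindex \<in> borel_measurable borel"
  and borel_measurable_unindex [measurable]: "unindex \<in> borel_measurable borel"
  by (rule borel_measurable_linear linear_reindex linear_unindex)+

text \<open>Basis vectors are mapped to basis vectors, so both measures are images of the same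
  product measure under a standard frame.\<close>

lemma distr_reindex: "distr lborel borel (reindex :: real ^ 'n \<Rightarrow> _) = lborel"
proof -
  let ?n = "CARD('n)"
  have "card (Basis :: (real ^ 'n) set) = ?n" by simp
  then obtain e :: "nat \<Rightarrow> real ^ 'n" where e: "bij_betw e {..<?n} Basis"
    using ex_bij_betw_nat_finite[OF finite_Basis] by (metis atLeast0LessThan)
  have axis: "reindex (axis (Rep_ordered_index i) 1) = axis i 1" for i :: "'n ordered_index"
    by (simp add: reindex_def axis_def vec_eq_iff Rep_ordered_index_inject)
  have "bij_betw reindex (Basis :: (real ^ 'n) set) Basis"
  proof (rule bij_betwI')
    fix x :: "real ^ 'n" assume "x \<in> Basis"
    then obtain j where "x = axis j 1" by (auto simp: Basis_vec_def)
    then have "reindex x = axis (Abs_ordered_index j) 1"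
      using axis[of "Abs_ordered_index j"] by (simp add: Abs_ordered_index_inverse)
    then show "reindex x \<in> Basis" by (simp add: Basis_vec_def) blast
  next
    fix y :: "real ^ 'n ordered_index" assume "y \<in> Basis"
    then obtain i where "y = axis i 1" by (auto simp: Basis_vec_def)
    then have "y = reindex (axis (Rep_ordered_index i) 1)" by (simp add: axis)
    then show "\<exists>x\<in>Basis. y = reindex x" by (rule bexI) (simp add: Basis_vec_def, blast)
  qed (metis reindex_inverse(1))
  then have e': "bij_betw (reindex \<circ> e) {..<?n} Basis" by (rule bij_betw_trans[OF e])
  have "distr lborel borel reindex =
      distr (distr (\<Pi>\<^sub>M i\<in>{..<?n}. lborel) borel (\<lambda>y. \<Sum>i<?n. y i *\<^sub>R e i)) borel reindex"
    unfolding distr_standard_frame[OF e] ..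
  also have "\<dots> = distr (\<Pi>\<^sub>M i\<in>{..<?n}. lborel) borel (\<lambda>y. \<Sum>i<?n. y i *\<^sub>R (reindex \<circ> e) i)"
    by (subst distr_distr) (simp_all add: comp_def linear_sum[OF linear_reindex] linear_cmul[OF linear_reindex])
  also have "\<dots> = lborel" by (rule distr_standard_frame[OF e'])
  finally show ?thesis .
qed

lemma distr_unindex: "distr lborel borel (unindex :: _ \<Rightarrow> real ^ 'n) = lborel"
  by (subst distr_reindex[symmetric], subst distr_distr) (simp_all add: comp_def distr_id2)

lemma distr_orthogonal_wellorder:
  fixes f :: "real ^ 'n::{finite,wellorder} \<Rightarrow> real ^ 'n::_"
  assumes f: "orthogonal_transformation f"
  shows "distr lborel borel f = lborel"
proof (rule lborel_eqI[symmetric])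
  have fm: "f \<in> borel_measurable borel"
    by (intro borel_measurable_linear orthogonal_transformation_linear f)
  fix l u assume le: "\<And>b. b \<in> Basis \<Longrightarrow> (l :: real ^ 'n::_) \<bullet> b \<le> u \<bullet> b"
  have pre: "f -` box l u = inv f ` box l u"
    using orthogonal_transformation_bij[OF f] by (rule bij_vimage_eq_inv_image)
  have g: "orthogonal_transformation (inv f)" by (rule orthogonal_transformation_inv[OF f])
  have "inv f ` box l u \<in> sets borel"
    unfolding pre[symmetric] using measurable_sets[OF fm, of "box l u"] by simp
  then have "emeasure (distr lborel borel f) (box l u) = emeasure lebesgue (inv f ` box l u)"
    using fm by (simp add: emeasure_distr pre)
  also have "\<dots> = ennreal (measure lebesgue (inv f ` box l u))"
    by (rule emeasure_eq_measure2[OF measurable_orthogonal_image[OF g]]) simp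
  also have "measure lebesgue (inv f ` box l u) = measure lebesgue (box l u)"
    by (rule measure_orthogonal_image[OF g]) simp
  also have "ennreal \<dots> = emeasure lebesgue (box l u)"
    by (rule emeasure_eq_measure2[symmetric]) simp
  finally show "emeasure (distr lborel borel f) (box l u) = ennreal (\<Prod>b\<in>Basis. (u - l) \<bullet> b)"
    using emeasure_lborel_box[OF le] by simp
qed simp

text \<open>Conjugation with \<open>reindex\<close> carries \<open>f\<close> to an orthogonal map
  over the well-ordered index type, and \<open>reindex\<close> and \<open>unindex\<close> preserve
  the measure.\<close>

lemma distr_orthogonal:
  fixes f :: "real ^ 'n \<Rightarrow> real ^ 'n"
  assumes f: "orthogonal_transformation f"
  shows "distr lborel borel f = lborel"
proof -
  define h where "h = reindex \<circ> f \<circ> unindex"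
  have "h v \<bullet> h w = v \<bullet> w" for v w
  proof -
    have "h v \<bullet> h w = unindex v \<bullet> unindex w"
      using f by (simp add: h_def inner_reindex orthogonal_transformation_def)
    also have "\<dots> = v \<bullet> w" by (subst inner_reindex[symmetric]) simp
    finally show ?thesis .
  qed
  moreover have "linear h" unfolding h_def
    by (intro linear_compose linear_reindex linear_unindex orthogonal_transformation_linear f)
  ultimately have h: "orthogonal_transformation h" by (simp add: orthogonal_transformation_def)
  have hm: "h \<in> borel_measurable borel" by (rule borel_measurable_linear[OF \<open>linear h\<close>])
  have "f = unindex \<circ> (h \<circ> reindex)" by (simp add: h_def fun_eq_iff)
  then have "distr lborel borel f = distr (distr (distr lborel borel reindex) borel h) borel unindex"
    using hm by (simp add: distr_distr comp_assoc)
  then show ?thesis by (simp only: distr_reindex distr_orthogonal_wellorder[OF h] distr_unindex)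
qed

text \<open>An orthonormal frame of full length is the image of the standard basis under the
  orthogonal map \<open>T\<close>.\<close>

lemma distr_orthonormal_frame:
  fixes b :: "nat \<Rightarrow> real ^ 'n"
  assumes b: "orthonormal_frame CARD('n) b"
  shows "distr (\<Pi>\<^sub>M i\<in>{..<CARD('n)}. lborel) borel (\<lambda>y. \<Sum>i<CARD('n). y i *\<^sub>R b i) = lborel"
proof -
  let ?n = "CARD('n)"
  have "card (Basis :: (real ^ 'n) set) = ?n" by simp
  then obtain e :: "nat \<Rightarrow> real ^ 'n" where e: "bij_betw e {..<?n} Basis"
    using ex_bij_betw_nat_finite[OF finite_Basis] by (metis atLeast0LessThan)
  define T where "T = (\<lambda>x. \<Sum>i<?n. (x \<bullet> e i) *\<^sub>R b i)"
  have lin: "linear T"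
    by (rule linearI) (simp_all add: T_def inner_add_left scaleR_add_left sum.distrib scaleR_sum_right)
  have "T x \<bullet> T y = x \<bullet> y" for x y
  proof -
    have "T x \<bullet> T y = (\<Sum>i<?n. \<Sum>j<?n. (x \<bullet> e i) * (y \<bullet> e j) * (b i \<bullet> b j))"
      unfolding T_def inner_sum_left inner_sum_right by (subst sum.swap) (simp add: mult_ac)
    also have "\<dots> = (\<Sum>i<?n. (x \<bullet> e i) * (y \<bullet> e i))"
    proof (rule sum.cong)
      fix i assume i: "i \<in> {..<?n}"
      have "(\<Sum>j<?n. (x \<bullet> e i) * (y \<bullet> e j) * (b i \<bullet> b j)) = (\<Sum>j<?n. if j = i then (x \<bullet> e i) * (y \<bullet> e i) else 0)"
        by (rule sum.cong) (use b i in \<open>auto simp: orthonormal_frame_def\<close>)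
      then show "(\<Sum>j<?n. (x \<bullet> e i) * (y \<bullet> e j) * (b i \<bullet> b j)) = (x \<bullet> e i) * (y \<bullet> e i)"
        using i by simp
    qed simp
    also have "\<dots> = (\<Sum>v\<in>Basis. (x \<bullet> v) * (y \<bullet> v))"
      by (rule sum.reindex_bij_betw[OF e])
    finally show ?thesis by (simp add: euclidean_inner[of x y])
  qed
  then have orth: "orthogonal_transformation T" using lin by (simp add: orthogonal_transformation_def)
  have Tm [measurable]: "T \<in> borel_measurable borel"
    by (rule borel_measurable_linear[OF lin])
  have Te: "T (\<Sum>i<?n. y i *\<^sub>R e i) = (\<Sum>i<?n. y i *\<^sub>R b i)" for y
    by (simp add: T_def sum_standard_frame_inner[OF e])
  have "lborel = distr (distr (\<Pi>\<^sub>M i\<in>{..<?n}. lborel) borel (\<lambda>y. \<Sum>i<?n. y i *\<^sub>R e i)) borel T"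
    unfolding distr_standard_frame[OF e] distr_orthogonal[OF orth] ..
  also have "\<dots> = distr (\<Pi>\<^sub>M i\<in>{..<?n}. lborel) borel (\<lambda>y. \<Sum>i<?n. y i *\<^sub>R b i)"
    by (subst distr_distr) (simp_all add: comp_def Te)
  finally show ?thesis by simp
qed

text \<open>The slab lies in a translate of the span of the directions of \<open>K\<close> together
  with (1, ..., 1), whose dimension is still less than n.\<close>

lemma negligible_slab:
  fixes K :: "(real ^ 'n) set"
  assumes dim: "aff_dim K < int CARD('n) - 1"
  shows "negligible (slab K a b)"
proof (cases "K = {}")
  case True
  then show ?thesis by (simp add: slab_def)
next
  case False
  then obtain k0 where k0: "k0 \<in> K" by blast
  let ?K = "(\<lambda>x. - k0 + x) ` K"
  let ?V = "span (insert 1 ?K)"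
  have "aff_dim K = int (dim ?K)" using k0 by (intro aff_dim_eq_dim hull_inc)
  then have "dim (insert 1 ?K) < CARD('n)" using dim by (auto simp: dim_insert)
  then have "negligible ?V" by (intro negligible_lowdim) (simp add: dim_span)
  then have "negligible ((+) k0 ` ?V)" by (rule negligible_translation)
  moreover have "slab K a b \<subseteq> (+) k0 ` ?V"
  proof
    fix x assume "x \<in> slab K a b"
    then obtain k where k: "k \<in> K" "flatten x = flatten k" by (auto simp: slab_def)
    define c where "c = (coord_sum x - coord_sum k) / real CARD('n)"
    have "x = k0 + ((- k0 + k) + c *\<^sub>R 1)"
      using k(2) unfolding flatten_def c_def by (simp add: algebra_simps diff_divide_distrib scaleR_diff_left)
    moreover have "(- k0 + k) + c *\<^sub>R 1 \<in> ?V"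
      using k(1) by (intro span_add span_scale span_base) auto
    ultimately show "x \<in> (+) k0 ` ?V" by blast
  qed
  ultimately show ?thesis by (rule negligible_subset)
qed

text \<open>Extending the frame by the unit normal of the hyperplane gives orthonormal coordinates
  of the whole space. In these the slab is the product of the coordinate set \<open>A\<close> with
  an interval of length 1 / sqrt n, and Fubini separates the two.\<close>

lemma volume_eq_slab_volume_of_frame:
  fixes K :: "(real ^ 'n) set" and r :: nat
  assumes K: "compact K" "k0 \<in> K" "\<And>k. k \<in> K \<Longrightarrow> coord_sum k = D"
    and r: "Suc r = CARD('n)" and dim: "aff_dim K \<ge> int r"
    and b: "orthonormal_frame r b" and sub: "K \<subseteq> range (frame_point r p b)"
  shows "measure (\<Pi>\<^sub>M i\<in>{..<r}. lborel) {y \<in> extensional {..<r}. frame_point r p b y \<in> K}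
    = sqrt (real CARD('n)) * slab_volume K"
proof -
  let ?n = "CARD('n)"
  let ?B = "b ` {..<r}"
  let ?K = "(\<lambda>x. - k0 + x) ` K"
  have bb: "b i \<bullet> b j = (if i = j then 1 else 0)" if "i < r" "j < r" for i j
    using b that by (simp add: orthonormal_frame_def)
  have K_sub: "?K \<subseteq> span ?B"
  proof
    fix v assume "v \<in> ?K"
    then obtain k where k: "k \<in> K" "v = - k0 + k" by blast
    obtain y y0 where "k = frame_point r p b y" "k0 = frame_point r p b y0" using sub k(1) K(2) by blast
    then have "v = (\<Sum>i<r. y i *\<^sub>R b i) - (\<Sum>i<r. y0 i *\<^sub>R b i)" by (simp add: k(2) frame_point_def)
    also have "\<dots> \<in> span ?B" by (intro span_diff span_sum span_scale span_base) auto
    finally show "v \<in> span ?B" .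
  qed
  \<comment> \<open>\<open>K\<close> has dimension at least \<open>r\<close>, so its directions
    already span the whole frame. This forces the frame vectors to have coordinate sum 0, hence to
    be orthogonal to the normal.\<close>
  have "int r \<le> int (dim ?K)" using aff_dim_eq_dim[of k0 K] K(2) dim by (simp add: hull_inc)
  moreover have "dim (span ?B) \<le> r"
    using dim_le_card[of "span ?B" ?B] card_image_le[of "{..<r}" b] by simp
  moreover have "span ?K \<subseteq> span ?B" using K_sub by (simp add: span_minimal)
  ultimately have "span ?K = span ?B" by (intro subspace_dim_equal) auto
  moreover have "span ?K \<subseteq> {v. coord_sum v = 0}"
  proof (rule span_minimal)
    show "?K \<subseteq> {v. coord_sum v = 0}"
    proof
      fix v assume "v \<in> ?K"
      then obtain k where "k \<in> K" "v = k - k0" by auto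
      then show "v \<in> {v. coord_sum v = 0}" using K(2,3) by simp
    qed
    show "subspace {v :: real ^ 'n. coord_sum v = 0}" by (simp add: subspace_def)
  qed
  ultimately have b0: "coord_sum (b i) = 0" if "i < r" for i
    using that span_base[of "b i" ?B] by auto
  define \<nu> :: "real ^ 'n" where "\<nu> = (1 / sqrt (real ?n)) *\<^sub>R 1"
  have inner_one: "x \<bullet> 1 = coord_sum x" for x :: "real ^ 'n" by (simp add: inner_vec_def coord_sum_def)
  have \<nu>: "\<nu> \<bullet> \<nu> = 1" "coord_sum \<nu> = sqrt (real ?n)"
    by (simp_all add: \<nu>_def inner_one field_simps real_div_sqrt)
  define b' where "b' = b(r := \<nu>)"
  have "orthonormal_frame ?n b'"
    unfolding orthonormal_frame_def
  proof (intro allI impI)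
    fix i j assume "i < ?n" "j < ?n"
    then have ij: "i = r \<or> i < r" "j = r \<or> j < r" using r by linarith+
    have "b i \<bullet> \<nu> = 0" "\<nu> \<bullet> b i = 0" if "i < r" for i
      using b0[OF that] by (simp_all add: \<nu>_def inner_one inner_commute[of 1])
    then show "b' i \<bullet> b' j = (if i = j then 1 else 0)" using ij bb \<nu>(1) by (auto simp: b'_def)
  qed
  note full = distr_orthonormal_frame[OF this]
  let ?P = "\<lambda>m. \<Pi>\<^sub>M i\<in>{..<m::nat}. (lborel :: real measure)"
  define \<Psi> where "\<Psi> = (\<lambda>y :: nat \<Rightarrow> real. \<Sum>i<?n. y i *\<^sub>R b' i)"
  have \<Psi>m [measurable]: "\<Psi> \<in> borel_measurable (?P ?n)" unfolding \<Psi>_def by measurable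
  \<comment> \<open>With the base point moved to coordinate sum 0, the height of a point depends on
    the last coordinate alone.\<close>
  define p0 where "p0 = flatten p"
  have cp: "coord_sum p = D"
  proof -
    obtain y0 where "k0 = frame_point r p b y0" using sub K(2) by blast
    then have "coord_sum k0 = coord_sum p" using b0 by (simp add: frame_point_def coord_sum_sum)
    then show ?thesis using K(3)[OF K(2)] by simp
  qed
  have p0: "p0 = p - (D / real ?n) *\<^sub>R 1" "coord_sum p0 = 0" by (simp_all add: p0_def flatten_def cp)
  have n: "{..<?n} = insert r {..<r}" using r by (auto simp: lessThan_Suc[symmetric])
  have \<Psi>_split: "\<Psi> y = (\<Sum>i<r. y i *\<^sub>R b i) + y r *\<^sub>R \<nu>" for y
    unfolding \<Psi>_def n by (simp add: b'_def add.commute)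
  define S where "S = (\<lambda>y. p0 + \<Psi> y) -` slab K 0 1 \<inter> space (?P ?n)"
  define A where "A = {y \<in> extensional {..<r}. frame_point r p b y \<in> K}"
  \<comment> \<open>The unit normal has coordinate sum sqrt n, so heights from 0 to 1 correspond to
    this interval.\<close>
  define J where "J = {0..<1 / sqrt (real ?n)}"
  have mem_slab: "p0 + \<Psi> y \<in> slab K 0 1 \<longleftrightarrow> frame_point r p b y \<in> K \<and> y r \<in> J" for y
  proof -
    have cs: "coord_sum (p0 + \<Psi> y) = y r * sqrt (real ?n)"
      by (simp add: p0(2) \<Psi>_split coord_sum_sum b0 \<nu>)
    have cf: "coord_sum (frame_point r p b y) = D"
      by (simp add: frame_point_def coord_sum_sum b0 cp)
    have "flatten (p0 + \<Psi> y) = flatten (p0 + (\<Sum>i<r. y i *\<^sub>R b i) + (y r / sqrt (real ?n)) *\<^sub>R 1)"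
      by (simp add: \<Psi>_split \<nu>_def add.assoc)
    also have "\<dots> = flatten (p0 + (\<Sum>i<r. y i *\<^sub>R b i))" by (rule flatten_add_one)
    also have "p0 + (\<Sum>i<r. y i *\<^sub>R b i) = frame_point r p b y + (- D / real ?n) *\<^sub>R 1"
      by (simp add: p0(1) frame_point_def)
    also have "flatten (frame_point r p b y + (- D / real ?n) *\<^sub>R 1) = flatten (frame_point r p b y)"
      by (rule flatten_add_one)
    finally have fl: "flatten (p0 + \<Psi> y) = flatten (frame_point r p b y)" .
    have "flatten (frame_point r p b y) \<in> flatten ` K \<longleftrightarrow> frame_point r p b y \<in> K"
    proof
      assume "flatten (frame_point r p b y) \<in> flatten ` K"
      then obtain k where "k \<in> K" "flatten (frame_point r p b y) = flatten k" by blast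
      then show "frame_point r p b y \<in> K" using K(3)[of k] cf by (simp add: flatten_def)
    qed blast
    moreover have "0 \<le> y r * sqrt (real ?n) \<and> y r * sqrt (real ?n) < 1 \<longleftrightarrow> y r \<in> J"
      by (auto simp: J_def field_simps zero_le_mult_iff)
    ultimately show ?thesis unfolding slab_def mem_Collect_eq cs fl by simp
  qed
  have slab_borel: "slab K 0 1 \<in> sets borel" by (rule borel_slab[OF K(1)])
  have S_sets: "S \<in> sets (?P ?n)"
    unfolding S_def by (rule measurable_sets[OF _ slab_borel]) measurable
  have fpm: "frame_point r p b \<in> borel_measurable (?P r)" unfolding frame_point_def[abs_def] by measurable
  have "frame_point r p b -` K \<inter> space (?P r) \<in> sets (?P r)"
    by (rule measurable_sets[OF fpm borel_compact[OF K(1)]])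
  moreover have "frame_point r p b -` K \<inter> space (?P r) = A"
    by (auto simp: A_def space_PiM PiE_def)
  ultimately have A_sets: "A \<in> sets (?P r)" by simp
  interpret product_sigma_finite "\<lambda>_::nat. lborel :: real measure" ..
  have "emeasure lborel (slab K 0 1) = emeasure (distr lborel borel ((+) p0)) (slab K 0 1)"
    by (simp only: lborel_distr_plus)
  also have "\<dots> = emeasure (distr (distr (?P ?n) borel \<Psi>) borel ((+) p0)) (slab K 0 1)"
    unfolding \<Psi>_def full ..
  also have "\<dots> = emeasure (?P ?n) S"
    unfolding S_def using slab_borel by (subst distr_distr) (simp_all add: emeasure_distr comp_def)
  also have "\<dots> = (\<integral>\<^sup>+ y. indicator S y \<partial>?P ?n)" using S_sets by simp
  also have "\<dots> = (\<integral>\<^sup>+ x. (\<integral>\<^sup>+ t. indicator S (x(r := t)) \<partial>lborel) \<partial>?P r)"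
    using S_sets unfolding n by (intro product_nn_integral_insert) auto
  also have "\<dots> = (\<integral>\<^sup>+ x. (\<integral>\<^sup>+ t. indicator A x * indicator J t \<partial>lborel) \<partial>?P r)"
  proof (intro nn_integral_cong)
    fix x :: "nat \<Rightarrow> real" and t :: real assume "x \<in> space (?P r)"
    then have x: "x \<in> extensional {..<r}" by (auto simp: space_PiM PiE_def)
    then have xt: "x(r := t) \<in> space (?P ?n)" unfolding n by (auto simp: space_PiM PiE_def extensional_def)
    have "frame_point r p b (x(r := t)) = frame_point r p b x" by (simp add: frame_point_def)
    then have "x(r := t) \<in> S \<longleftrightarrow> x \<in> A \<and> t \<in> J"
      using xt x by (simp add: S_def A_def mem_slab)
    then show "(indicator S (x(r := t)) :: ennreal) = indicator A x * indicator J t"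
      by (simp add: indicator_def)
  qed
  also have "\<dots> = emeasure (?P r) A * emeasure lborel J"
    using A_sets by (simp add: nn_integral_cmult nn_integral_multc J_def)
  finally have "emeasure lborel (slab K 0 1) = emeasure (?P r) A * ennreal (1 / sqrt (real ?n))"
    by (simp add: J_def)
  then have "measure lborel (slab K 0 1) = measure (?P r) A * (1 / sqrt (real ?n))"
    by (simp add: measure_def enn2real_mult)
  then show ?thesis
    using slab_borel by (simp add: slab_volume_def A_def)
qed

text \<open>In low dimension both sides vanish. Otherwise an orthonormal basis of the hyperplane of
  coordinate sum 0 shows that a suitable frame exists, and the preceding lemma holds for every such
  frame, in particular for the one selected by \<open>SOME\<close>.\<close>

lemma volume_eq_slab_volume:
  fixes K :: "(real ^ 'n) set"
  assumes K: "compact K" "K \<noteq> {}" "\<And>k. k \<in> K \<Longrightarrow> coord_sum k = D"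
  shows "volume (CARD('n) - 1) K = sqrt (real CARD('n)) * slab_volume K"
proof -
  obtain r where r: "Suc r = CARD('n)" using zero_less_card_finite[where 'a='n] gr0_implies_Suc by metis
  then have r': "CARD('n) - 1 = r" by simp
  obtain k0 where k0: "k0 \<in> K" using K(2) by blast
  show ?thesis
  proof (cases "aff_dim K < int r")
    case True
    then have "negligible (slab K 0 1)" using r by (intro negligible_slab) linarith
    then show ?thesis unfolding r' using True by (simp add: volume_def slab_volume_def negligible_imp_measure0)
  next
    case False
    let ?Q = "\<lambda>(p, b). orthonormal_frame r b \<and> K \<subseteq> range (frame_point r p b)"
    have "\<exists>pb. ?Q pb"
    proof -
      let ?H = "{v :: real ^ 'n. coord_sum v = 0}"
      have H: "subspace ?H" by (simp add: subspace_def)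
      have inner_one: "1 \<bullet> x = coord_sum x" for x :: "real ^ 'n" by (simp add: inner_vec_def coord_sum_def)
      have "dim {x :: real ^ 'n. 1 \<bullet> x = 0} = DIM(real ^ 'n) - 1"
        by (rule dim_hyperplane) (simp add: vec_eq_iff)
      then have dH: "dim ?H = r" using r by (simp add: inner_one)
      obtain B where B: "B \<subseteq> ?H" "pairwise orthogonal B" "\<And>x. x \<in> B \<Longrightarrow> norm x = 1"
        "independent B" "card B = dim ?H" "span B = ?H"
        using orthonormal_basis_subspace[OF H] by blast
      have fB: "finite B" using B(4) by (rule independent_imp_finite)
      obtain b where b: "bij_betw b {..<r} B"
        using ex_bij_betw_nat_finite[OF fB] B(5) dH by (metis atLeast0LessThan)
      have "orthonormal_frame r b"
        unfolding orthonormal_frame_def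
      proof (intro allI impI)
        fix i j assume ij: "i < r" "j < r"
        then have mem: "b i \<in> B" "b j \<in> B" "b i = b j \<longleftrightarrow> i = j" using b by (auto simp: bij_betw_def inj_on_def)
        show "b i \<bullet> b j = (if i = j then 1 else 0)"
        proof (cases "i = j")
          case True
          then show ?thesis using B(3)[OF mem(1)] by (simp add: norm_eq_1)
        next
          case False
          then show ?thesis using B(2) mem by (auto simp: pairwise_def orthogonal_def)
        qed
      qed
      moreover have "K \<subseteq> range (frame_point r k0 b)"
      proof
        fix k assume "k \<in> K"
        then have "k - k0 \<in> span B" using K(3) k0 by (simp add: B(6))
        then obtain u where "k - k0 = (\<Sum>v\<in>B. u v *\<^sub>R v)" using span_finite[OF fB] by auto
        also have "\<dots> = (\<Sum>i<r. u (b i) *\<^sub>R b i)" by (rule sum.reindex_bij_betw[OF b, symmetric])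
        finally have "k = frame_point r k0 b (\<lambda>i. u (b i))" by (simp add: frame_point_def algebra_simps)
        then show "k \<in> range (frame_point r k0 b)" by blast
      qed
      ultimately show ?thesis by auto
    qed
    then have Q: "?Q (SOME pb. ?Q pb)" by (rule someI_ex)
    obtain p b where pb: "(SOME pb. ?Q pb) = (p, b)" by (cases "SOME pb. ?Q pb") auto
    have "orthonormal_frame r b" "K \<subseteq> range (frame_point r p b)" using Q unfolding pb by auto
    from volume_eq_slab_volume_of_frame[OF K(1) k0 K(3) r _ this] False
    show ?thesis unfolding r' volume_def pb by simp
  qed
qed

section \<open>The Hilbert polynomial\<close>

context monomial_system
begin

lemma eventually_polyfun_card_E: "eventually_polyfun s (\<lambda>u. card (E u))"
  unfolding sumset_def
  by (rule khovanskii[OF finite_X image_X]) (simp only: combination_add)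

text \<open>At this \<open>u\<close> the Minkowski sum is the standard simplex. A small cube at the
  origin lies in the slab over it; this positivity is what prevents the degree from dropping below n
  - 1.\<close>

lemma slab_volume_K_pos: "slab_volume (K (\<lambda>i. if i = 0 then 1 else 0)) > 0"
proof -
  let ?n = "real CARD('n)"
  let ?u = "\<lambda>i::nat. if i = 0 then 1 else 0 :: nat"
  have "K ((\<lambda>_. 0)(0 := Suc 0)) = newton_polytope (\<xi> ` {x \<in> X. \<tau> x = 0}) + K (\<lambda>_. 0)"
    using minkowski_Suc[OF finite_X, of 0 s \<tau> \<xi> "\<lambda>_. 0"] by simp
  also have "K (\<lambda>_. 0) = {0}" by (rule minkowski_zero[OF finite_X image_X']) simp
  also have "newton_polytope (\<xi> ` {x \<in> X. \<tau> x = 0}) + {0} = newton_polytope variables"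
    unfolding block_0 by (auto simp: set_plus_def)
  also have "(\<lambda>_. 0)(0 := Suc 0) = ?u" by auto
  finally have K: "K ?u = newton_polytope variables" .
  have var: "exponent_vector (single j (1::nat)) = axis j 1" for j :: 'n
    by (simp add: vec_eq_iff exponent_vector_nth axis_def lookup_single when_def)
  have "box 0 ((1 / ?n) *\<^sub>R 1) \<subseteq> slab (K ?u) 0 1"
  proof
    fix x :: "real ^ 'n" assume "x \<in> box 0 ((1 / ?n) *\<^sub>R 1)"
    then have x: "0 < x $ j" "x $ j < 1 / ?n" for j by (simp_all add: mem_box_cart)
    have pos: "0 \<le> coord_sum x" unfolding coord_sum_def by (intro sum_nonneg) (simp add: x less_imp_le)
    have "coord_sum x < (\<Sum>j\<in>(UNIV :: 'n set). 1 / ?n)"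
      unfolding coord_sum_def by (rule sum_strict_mono) (simp_all add: x)
    then have lt: "coord_sum x < 1" by simp
    \<comment> \<open>The point of coordinate sum 1 on the line through \<open>x\<close> in the
      direction (1, ..., 1); its nonnegative coordinates serve as the convex coefficients.\<close>
    define y where "y = x + ((1 - coord_sum x) / ?n) *\<^sub>R 1"
    have y: "0 \<le> y $ j" for j using x(1)[of j] lt by (simp add: y_def)
    have "(\<Sum>j\<in>UNIV. y $ j) = 1"
      unfolding coord_sum_def[symmetric] by (simp add: y_def)
    then have "(\<Sum>j\<in>UNIV. y $ j *\<^sub>R axis j 1) \<in> newton_polytope variables"
      unfolding newton_polytope_def using y
      by (intro convex_sum) (auto simp: var[symmetric] variables_def intro!: hull_inc)
    moreover have "(\<Sum>j\<in>UNIV. y $ j *\<^sub>R axis j 1) = y"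
      using basis_expansion[of y] by (simp add: scalar_mult_eq_scaleR)
    ultimately have "flatten y \<in> flatten ` K ?u" unfolding K by auto
    moreover have "flatten y = flatten x" unfolding y_def by (rule flatten_add_one)
    ultimately show "x \<in> slab (K ?u) 0 1" using pos lt by (simp add: slab_def)
  qed
  moreover have cK: "compact (K ?u)" by (intro compact_minkowski finite_X image_X)
  ultimately have "measure lebesgue (box 0 ((1 / ?n) *\<^sub>R (1 :: real ^ 'n))) \<le> slab_volume (K ?u)"
    unfolding slab_volume_def by (intro measure_mono_fmeasurable lmeasurable_slab) auto
  moreover have "0 < measure lebesgue (box 0 ((1 / ?n) *\<^sub>R (1 :: real ^ 'n)))"
  proof -
    have "(0 :: real ^ 'n) \<in> cbox 0 ((1 / ?n) *\<^sub>R 1)" by (simp add: mem_box_cart)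
    then have "cbox (0 :: real ^ 'n) ((1 / ?n) *\<^sub>R 1) \<noteq> {}" by blast
    then have "measure lborel (cbox (0 :: real ^ 'n) ((1 / ?n) *\<^sub>R 1)) = (\<Prod>j\<in>(UNIV :: 'n set). 1 / ?n)"
      by (simp add: content_cbox_cart)
    then have "measure lborel (cbox (0 :: real ^ 'n) ((1 / ?n) *\<^sub>R 1)) > 0" by simp
    then show ?thesis by (simp add: measure_lborel_box_eq measure_lborel_cbox_eq)
  qed
  ultimately show ?thesis by linarith
qed

lemma volume_K: "volume (CARD('n) - 1) (K u) = sqrt (real CARD('n)) * slab_volume (K u)"
  by (rule volume_eq_slab_volume[OF compact_minkowski[OF finite_X image_X]
        minkowski_nonempty[OF finite_X image_X] coord_sum_K])

text \<open>This is the term of the empty subset, which polarization includes and the mixed volume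
  omits. For n > 1 it is 0; for n = 1 it is the only term and matches the convention that the empty
  mixed volume is 1.\<close>

lemma slab_volume_K_zero: "slab_volume (K (\<lambda>_. 0)) = (if CARD('n) = 1 then 1 else 0)"
proof -
  have K0: "K (\<lambda>_. 0) = {0}" by (rule minkowski_zero[OF finite_X image_X']) simp
  show ?thesis
  proof (cases "CARD('n) = 1")
    case True
    then obtain j0 :: 'n where j0: "UNIV = {j0}" by (auto simp: card_1_singleton_iff)
    have "flatten x = 0" for x :: "real ^ 'n"
    proof -
      have "coord_sum x = x $ j0" unfolding coord_sum_def j0 by simp
      moreover have "x $ j = x $ j0" for j using j0 by (metis UNIV_I singletonD)
      ultimately show ?thesis using True by (simp add: flatten_def vec_eq_iff)
    qed
    then have "slab {0} 0 1 = cell j0 0"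
      using j0 by (auto simp: slab_def cell_def)
    then show ?thesis using True measure_unit_cell[of j0] by (simp add: slab_volume_def K0)
  next
    case False
    then have "1 < CARD('n)" using zero_less_card_finite[where 'a='n] by linarith
    then have "aff_dim {0 :: real ^ 'n} < int CARD('n) - 1" by simp
    then have "negligible (slab {0 :: real ^ 'n} 0 1)" by (rule negligible_slab)
    then show ?thesis using False by (simp add: slab_volume_def K0 negligible_imp_measure0)
  qed
qed

lemma mixed_volume_eq_polarization:
  assumes "weight s \<alpha> = CARD('n) - 1"
  defines "\<iota> \<equiv> \<lambda>j. repeated s \<alpha> id ! j"
  shows "mixed_volume (repeated s \<alpha> (\<lambda>i. newton_polytope (\<xi> ` {x \<in> X. \<tau> x = i}))) =
    sqrt (real CARD('n)) * (\<Sum>I\<in>Pow {..<CARD('n) - 1}. (-1) ^ (CARD('n) - 1 - card I) *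
      slab_volume (K (\<lambda>i. card {j \<in> I. \<iota> j = i})))"
proof -
  let ?Q = "\<lambda>i. newton_polytope (\<xi> ` {x \<in> X. \<tau> x = i})"
  let ?r = "CARD('n) - 1"
  let ?G = "\<lambda>I. (-1) ^ (?r - card I) * (sqrt (real CARD('n)) * slab_volume (K (\<lambda>i. card {j \<in> I. \<iota> j = i})))"
  have len: "length (repeated s \<alpha> ?Q) = ?r" by (simp only: length_repeated assms(1))
  have nth: "repeated s \<alpha> ?Q ! j = ?Q (\<iota> j)" if "j < ?r" for j
    by (subst repeated_eq_map, subst nth_map) (use that in \<open>simp_all add: length_repeated assms(1) \<iota>_def\<close>)
  have vol: "volume ?r (\<Sum>j\<in>I. repeated s \<alpha> ?Q ! j) = sqrt (real CARD('n)) * slab_volume (K (\<lambda>i. card {j \<in> I. \<iota> j = i}))"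
    if I: "I \<subseteq> {..<?r}" for I
  proof -
    have "(\<Sum>j\<in>I. repeated s \<alpha> ?Q ! j) = (\<Sum>j\<in>I. ?Q (\<iota> j))"
      by (rule sum.cong) (use I nth in auto)
    also have "\<dots> = K (\<lambda>i. card {j \<in> I. \<iota> j = i})"
    proof (rule sum_newton_polytopes[OF finite_X image_X'])
      show "finite I" using I by (rule finite_subset) simp
      show "\<iota> j \<le> s" if "j \<in> I" for j
        unfolding \<iota>_def by (rule repeated_nth_le) (use that I assms(1) in auto)
    qed
    finally show ?thesis by (simp only: volume_K)
  qed
  have "mixed_volume (repeated s \<alpha> ?Q) = (\<Sum>I\<in>Pow {..<?r}. ?G I)"
  proof (cases "?r = 0")
    case True
    then have 1: "CARD('n) = 1" using zero_less_card_finite[where 'a='n] by linarith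
    then have "slab_volume (K (\<lambda>_. 0)) = 1" using slab_volume_K_zero by simp
    then show ?thesis unfolding mixed_volume_def len Let_def using True 1 by simp
  next
    case False
    have "mixed_volume (repeated s \<alpha> ?Q) =
        (\<Sum>h=1..?r. \<Sum>I | I \<subseteq> {..<?r} \<and> card I = h. (-1) ^ (?r - h) * volume ?r (\<Sum>j\<in>I. repeated s \<alpha> ?Q ! j))"
      unfolding mixed_volume_def len Let_def using False by simp
    also have "\<dots> = (\<Sum>h=1..?r. \<Sum>I | I \<in> Pow {..<?r} - {{}} \<and> card I = h. ?G I)"
    proof (rule sum.cong[OF refl], rule sum.cong)
      fix h :: nat assume "h \<in> {1..?r}"
      then show "{I. I \<subseteq> {..<?r} \<and> card I = h} = {I. I \<in> Pow {..<?r} - {{}} \<and> card I = h}" by auto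
    next
      fix h :: nat and I assume I: "I \<in> {I. I \<in> Pow {..<?r} - {{}} \<and> card I = h}"
      then have "I \<subseteq> {..<?r}" by blast
      moreover have "card I = h" using I by blast
      ultimately show "(-1) ^ (?r - h) * volume ?r (\<Sum>j\<in>I. repeated s \<alpha> ?Q ! j) = ?G I"
        by (simp only: vol)
    qed
    also have "\<dots> = (\<Sum>I\<in>Pow {..<?r} - {{}}. ?G I)"
    proof (rule sum.group)
      show "card ` (Pow {..<?r} - {{}}) \<subseteq> {1..?r}"
      proof
        fix k assume "k \<in> card ` (Pow {..<?r} - {{}})"
        then obtain I where I: "I \<subseteq> {..<?r}" "I \<noteq> {}" "k = card I" by blast
        then have "finite I" by (meson finite_lessThan finite_subset)
        then show "k \<in> {1..?r}"
          using I card_mono[OF finite_lessThan I(1)] by (simp add: Suc_le_eq card_gt_0_iff)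
      qed
    qed auto
    also have "\<dots> = (\<Sum>I\<in>Pow {..<?r}. ?G I)"
    proof (rule sum.mono_neutral_left)
      have "slab_volume (K (\<lambda>_. 0)) = 0" using False slab_volume_K_zero by simp
      moreover have "Pow {..<?r} - (Pow {..<?r} - {{}}) = {{}}" by auto
      ultimately show "\<forall>I\<in>Pow {..<?r} - (Pow {..<?r} - {{}}). ?G I = 0" by simp
    qed auto
    finally show ?thesis .
  qed
  then show ?thesis by (simp add: sum_distrib_left mult_ac)
qed

text \<open>If the top weight \<open>m\<close> exceeded n - 1, dividing the known asymptotics by
  \<open>t ^ m\<close> would give limit 0 along every ray, so the form of weight \<open>m\<close>
  would vanish identically. With the degree bounded, the two limits along a ray identify the form of
  degree n - 1.\<close>

theorem hilbert_polynomial_card_E: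
  assumes P: "is_hilbert_polynomial s (\<lambda>u. enat (card (E u))) P"
  shows "total_degree s P = int CARD('n) - 1"
    and "\<And>u. leading_form s (CARD('n) - 1) P u = slab_volume (K u)"
proof -
  let ?r = "CARD('n) - 1"
  obtain N where kP: "\<forall>\<beta>\<in>keys P. keys \<beta> \<subseteq> {..s}"
    and N: "\<And>u. (\<forall>i\<le>s. N \<le> u i) \<Longrightarrow> real (card (E u)) = eval_poly P u"
    using P unfolding is_hilbert_polynomial_def by auto
  obtain c where c: "\<And>i. i \<le> s \<Longrightarrow> N \<le> c i"
    and lim: "\<And>u. (\<lambda>t. real (card (E (\<lambda>i. t * u i + c i))) / real t ^ ?r) \<longlonglongrightarrow> slab_volume (K u)"
    using card_E_asymptotics[of N] by blast
  have card: "real (card (E (\<lambda>i. t * u i + c i))) = eval_poly P (\<lambda>i. t * u i + c i)" for t u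
    using c by (intro N) (simp add: trans_le_add2)
  have le: "weight s \<beta> \<le> ?r" if \<beta>: "\<beta> \<in> keys P" for \<beta>
  proof -
    define m where "m = Max (weight s ` keys P)"
    have m: "weight s \<gamma> \<le> m" if "\<gamma> \<in> keys P" for \<gamma>
      unfolding m_def using that by (intro Max_ge) auto
    have "m \<in> weight s ` keys P" unfolding m_def using \<beta> by (intro Max_in) auto
    then obtain \<gamma> where \<gamma>: "\<gamma> \<in> keys P" "weight s \<gamma> = m" by blast
    have "m \<le> ?r"
    proof (rule ccontr)
      assume "\<not> m \<le> ?r"
      then have mr: "?r < m" by simp
      have "leading_form s m P u = 0" for u
      proof -
        have "(\<lambda>t. eval_poly P (\<lambda>i. t * u i + c i) / real t ^ m) \<longlonglongrightarrow> leading_form s m P u"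
          using kP m by (intro tendsto_leading_form) auto
        moreover have "(\<lambda>t. real (card (E (\<lambda>i. t * u i + c i))) / real t ^ ?r * (1 / real t) ^ (m - ?r)) \<longlonglongrightarrow> slab_volume (K u) * 0 ^ (m - ?r)"
          by (intro tendsto_mult lim tendsto_power lim_1_over_n)
        then have "(\<lambda>t. eval_poly P (\<lambda>i. t * u i + c i) / real t ^ m) \<longlonglongrightarrow> 0"
        proof -
          have "real (card (E (\<lambda>i. t * u i + c i))) / real t ^ ?r * (1 / real t) ^ (m - ?r)
              = eval_poly P (\<lambda>i. t * u i + c i) / real t ^ m" for t
            using mr by (simp add: card power_divide power_add[symmetric])
          then show ?thesis
            using \<open>(\<lambda>t. real (card (E (\<lambda>i. t * u i + c i))) / real t ^ ?r * (1 / real t) ^ (m - ?r)) \<longlonglongrightarrow> slab_volume (K u) * 0 ^ (m - ?r)\<close> mr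
            by (simp only: zero_power zero_less_diff mult_zero_right)
        qed
        ultimately show ?thesis by (rule LIMSEQ_unique)
      qed
      from leading_form_zero_imp[OF kP this \<gamma>(1)] \<gamma>(2) show False by simp
    qed
    then show ?thesis using m[OF \<beta>] by simp
  qed
  show lead: "leading_form s ?r P u = slab_volume (K u)" for u
  proof (rule LIMSEQ_unique)
    show "(\<lambda>t. eval_poly P (\<lambda>i. t * u i + c i) / real t ^ ?r) \<longlonglongrightarrow> leading_form s ?r P u"
      using kP le by (intro tendsto_leading_form) auto
    show "(\<lambda>t. eval_poly P (\<lambda>i. t * u i + c i) / real t ^ ?r) \<longlonglongrightarrow> slab_volume (K u)"
      using lim[of u] unfolding card .
  qed
  \<comment> \<open>Without a monomial of this weight the form, and hence every
    \<open>slab_volume (K u)\<close>, would be 0.\<close>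
  have "\<exists>\<beta>\<in>keys P. weight s \<beta> = ?r"
  proof (rule ccontr)
    assume "\<not> ?thesis"
    then have none: "{\<beta>. \<beta> \<in> keys P \<and> weight s \<beta> = ?r} = {}" by blast
    have "leading_form s ?r P u = 0" for u
      unfolding leading_form_def none by simp
    then show False using slab_volume_K_pos lead by simp
  qed
  then obtain \<beta> where \<beta>: "\<beta> \<in> keys P" "weight s \<beta> = ?r" by blast
  have "Max (weight s ` keys P) = ?r"
  proof (intro Max_eqI)
    show "?r \<in> weight s ` keys P" unfolding \<beta>(2)[symmetric] using \<beta>(1) by (rule imageI)
  qed (use le in auto)
  moreover have "P \<noteq> 0" using \<beta> by auto
  moreover have "int ?r = int CARD('n) - 1" using zero_less_card_finite[where 'a='n] by linarith
  ultimately show "total_degree s P = int CARD('n) - 1" by (simp add: total_degree_def)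
qed

end

theorem theorem2p4:
  fixes M :: "nat \<Rightarrow> ('n::finite \<Rightarrow>\<^sub>0 nat) set"
    and d :: "nat \<Rightarrow> nat"
    and s :: nat
    and m :: "('n, 'k::field) mpoly set"
    and J :: "nat \<Rightarrow> ('n, 'k) mpoly set"
  assumes "\<And>i. i \<le> s \<Longrightarrow> finite (M i)"
    and "\<And>i. i \<le> s \<Longrightarrow> M i \<noteq> {}"
    and "\<And>i a. i \<le> s \<Longrightarrow> a \<in> M i \<Longrightarrow> monomial_degree a = d i"
    and "M 0 = variables"
    and "m = maximal_graded_ideal"
    and "\<And>i. i \<le> s \<Longrightarrow> J i = monomial_ideal (M i)"
  shows "(\<exists>!P. is_hilbert_polynomial s (hilbert_function m J s) P) \<and>
    total_degree s (hilbert_polynomial s (hilbert_function m J s)) = int CARD('n) - 1 \<and>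
    (\<forall>\<alpha>. Poly_Mapping.keys \<alpha> \<subseteq> {..s} \<and> weight s \<alpha> = CARD('n) - 1 \<longrightarrow>
      mixed_multiplicity m J s \<alpha> =
        mixed_volume (repeated s \<alpha> (\<lambda>i. newton_polytope (M i))) / sqrt (real CARD('n)))"
proof -
  \<comment> \<open>The disjoint union keeps equal monomials of different sets apart; numbering it
    by naturals supplies the linear order on exponents that selects representatives in
    \<open>khovanskii\<close>.\<close>
  define Z where "Z = Sigma {..s} M"
  have "finite Z" unfolding Z_def using assms(1) by (intro finite_SigmaI) auto
  then obtain h where h: "bij_betw h {..<card Z} Z"
    using ex_bij_betw_nat_finite by (metis atLeast0LessThan)
  define X where "X = {..<card Z}"
  define \<tau> where "\<tau> = (\<lambda>x. fst (h x))"
  define \<xi> where "\<xi> = (\<lambda>x. snd (h x))"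
  have hX: "h ` X = Z" using h by (simp add: X_def bij_betw_def)
  have M: "M i = \<xi> ` {x \<in> X. \<tau> x = i}" if "i \<le> s" for i
  proof (intro equalityI subsetI)
    fix a assume "a \<in> M i"
    then have "(i, a) \<in> h ` X" unfolding hX Z_def using that by simp
    then obtain x where "x \<in> X" "h x = (i, a)" by (metis imageE)
    then show "a \<in> \<xi> ` {x \<in> X. \<tau> x = i}" by (force simp: \<xi>_def \<tau>_def)
  next
    fix a assume "a \<in> \<xi> ` {x \<in> X. \<tau> x = i}"
    then obtain x where x: "x \<in> X" "\<tau> x = i" "a = \<xi> x" by blast
    then have "h x \<in> Z" using hX by blast
    then show "a \<in> M i" using x by (auto simp: Z_def \<xi>_def \<tau>_def)
  qed
  have \<tau>: "\<tau> ` X = {..s}"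
  proof -
    have "\<tau> ` X = fst ` Z" unfolding \<tau>_def hX[symmetric] by (simp add: image_image)
    also have "\<dots> = {..s}" unfolding Z_def using assms(2) by force
    finally show ?thesis .
  qed
  interpret monomial_system X \<tau> s \<xi> d
  proof
    show "finite X" by (simp add: X_def)
    show "monomial_degree (\<xi> x) = d (\<tau> x)" if "x \<in> X" for x
      using that \<tau> M[of "\<tau> x"] by (intro assms(3)) auto
    show "\<xi> ` {x \<in> X. \<tau> x = 0} = variables" using M[of 0] assms(4) by simp
  qed (rule \<tau>)
  have H: "hilbert_function m J s = (\<lambda>u. enat (card (E u)))"
    by (rule ext, rule hilbert_function_eq_card_sumset[where d = d, OF finite_X image_X' degree M assms(4,5,6)])
  let ?H = "hilbert_function m J s"
  obtain f N where f: "polyfun s f" "\<And>u. (\<forall>i\<le>s. N \<le> u i) \<Longrightarrow> real (card (E u)) = f u"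
    using eventually_polyfun_card_E unfolding eventually_polyfun_def by blast
  obtain P where kP: "\<forall>\<beta>\<in>keys P. keys \<beta> \<subseteq> {..s}" and fP: "f = eval_poly P"
    using f(1) unfolding polyfun_def by blast
  have P: "is_hilbert_polynomial s ?H P"
    unfolding is_hilbert_polynomial_def H using kP f(2) fP by auto
  have ex1: "\<exists>!P. is_hilbert_polynomial s ?H P"
    using P hilbert_polynomial_unique by blast
  have hP: "hilbert_polynomial s ?H = P"
    unfolding hilbert_polynomial_def using P by (rule the1_equality[OF ex1])
  note lead = hilbert_polynomial_card_E[OF P[unfolded H]]
  have "mixed_multiplicity m J s \<alpha> =
      mixed_volume (repeated s \<alpha> (\<lambda>i. newton_polytope (M i))) / sqrt (real CARD('n))"
    if \<alpha>: "keys \<alpha> \<subseteq> {..s}" "weight s \<alpha> = CARD('n) - 1" for \<alpha>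
  proof -
    let ?\<iota> = "\<lambda>j. repeated s \<alpha> id ! j"
    have "mixed_multiplicity m J s \<alpha> = (\<Sum>I\<in>Pow {..<CARD('n) - 1}. (-1) ^ (CARD('n) - 1 - card I) *
        leading_form s (CARD('n) - 1) P (\<lambda>i. card {j \<in> I. ?\<iota> j = i}))"
      unfolding mixed_multiplicity_def hP
      using repeated_nth_le[of _ s \<alpha>] card_repeated[of _ s \<alpha>] \<alpha>(2)
      by (intro polarization[OF kP \<alpha>, symmetric]) auto
    moreover have "repeated s \<alpha> (\<lambda>i. newton_polytope (M i)) =
        repeated s \<alpha> (\<lambda>i. newton_polytope (\<xi> ` {x \<in> X. \<tau> x = i}))"
      unfolding repeated_def
    proof (intro arg_cong[where f = concat] map_cong refl)
      fix i assume "i \<in> set [0..<Suc s]"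
      then have "M i = \<xi> ` {x \<in> X. \<tau> x = i}" by (intro M) auto
      then show "replicate (lookup \<alpha> i) (newton_polytope (M i)) =
          replicate (lookup \<alpha> i) (newton_polytope (\<xi> ` {x \<in> X. \<tau> x = i}))" by simp
    qed
    ultimately show ?thesis
      using mixed_volume_eq_polarization[OF \<alpha>(2)] lead(2) by simp
  qed
  then show ?thesis using ex1 lead(1) hP by auto
qed

end
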